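(* In parts a), b) and c), $x,a,b,c$ are complex, $c$ is not a non-positive integer, $d,f$ are real, $\operatorname{Re}(c-a-b)>0$, $|x|\le 1$, $d>0$, $f>0$, with the following specializations. a) Set $f=c$ (so $c$ is a positive real) and assume $c+d\ne 1$. Then $${}_2F_1(a,b;c;x)=\frac{\Gamma(c+d-1)\Gamma(c+d-a-b)}{\Gamma(c+d-a)\Gamma(c+d-b)}\sum_{j\ge 0}K_j(x|c,d)\frac{(a)^{(j)}(b)^{(j)}(c+d-1)^{(j)}(c+d+2j-1)}{(c)^{(j)}(d+c-a)^{(j)}(d+c-b)^{(j)}}.$$ b) Set $d=f$ and assume $c=(a+b+1)/2$ and $2f+1>a+b$. Then $${}_2F_1\left(a,b;\tfrac{a+b+1}{2};x\right)=\Gamma\left(\tfrac12\right)\Gamma\left(f+(1-a-b)/2\right)\sum_{j\ge 0}K_j(x|f,f)\frac{(a)^{(j)}(b)^{(j)}\,\Gamma(f+1/2+j)}{\left(\frac{a+b+1}{2}\right)^{(j)}(2f+j-1)^{(j)}\,\Gamma\left(\frac{a+1+j}{2}\right)\Gamma\left(\frac{b+1+j}{2}\right)\Gamma\left(\frac{2f+1-a+j}{2}\right)\Gamma\left(\frac{2f+1-b+j}{2}\right)}.$$ c) Set $f=2c-b-1$ and $d=1+b+2a-2c$, and assume that $f$ and $d$ are both positive; then $f+d=2a$ and $b+f+1=2c$, and $${}_2F_1(a,b;c;x)=\Gamma\left(\tfrac12\right)\Gamma(a+1-c)\sum_{j\ge 0}K_j(x|2c-b-1,\,1+b+2a-2c)\frac{(b)^{(j)}(2a)^{(2j)}}{(c)^{(j)}(2a+j-1)^{(j)}(1+2a-c)^{(j)}}\cdot\frac{\Gamma\left(a+\frac12+j\right)\Gamma(c+j)}{\Gamma\left(\frac{b+1+j}{2}\right)\Gamma\left(c+\frac{j-1-b}{2}\right)\Gamma\left(a+\frac{j+1-b}{2}\right)\Gamma\left(a+1-c+\frac{j+b}{2}\right)}.$$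 d) Let $n\ge 0$ be an integer, and set $a=-n$ and $d=b-c+1-n$, where $c$ is not a non-positive integer and the denominators below do not vanish. Then $$(c)^{(n)}\,{}_2F_1(-n,b;c;x)=(c)^{(n)}\sum_{j=0}^n(-1)^j\binom{n}{j}\frac{(b)^{(j)}x^j}{(c)^{(j)}}$$ $$=(-1)^n\sum_{j=0}^n\frac{n!}{(n-j)!}K_j(x|f,d)\frac{(b)^{(j)}(c-b)^{(n-j)}(c-f)^{(n-j)}(d+f+2j-1)}{(d+f+j-1)^{(n+1)}}.$$
   Context: Rising factorial: $(x)^{(n)}=x(x+1)\cdots(x+n-1)$, $(x)^{(0)}=1$. $\Gamma$ is Euler's gamma function. Hypergeometric function: ${}_2F_1(a,b;c;x)=\sum_{n\ge 0}\frac{(a)^{(n)}(b)^{(n)}}{(c)^{(n)}}\frac{x^n}{n!}$. Jacobi-type polynomials: $$K_n(x|a,b)=\frac{1}{n!}\sum_{m=0}^n\binom{n}{m}(a+b+n-1)^{(m)}(b+m)^{(n-m)}(x-1)^m.$$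
   Formalization: In b) the summand gains the factor Γ((a+b+1)/2+j); in c) Γ(c+(j-1-b)/2) becomes Γ(c+(j-b)/2) and (2a)^{(2j)}/(1+2a-c)^{(j)} becomes (a)^{(j)}; in a) c+d-a, c+d-b are not non-positive integers; in a)-c) the series converges for 0<x≤1, for other x the identity assumes convergence. *)

theory Defs
  imports "HOL-Analysis.Analysis"
begin

(* Gauss hypergeometric series as a plain infinite sum; it is used only where it terminates
   or converges absolutely (norm x <= 1 and Re (c - a - b) > 0). *)
definition hyp2F1 :: "complex \<Rightarrow> complex \<Rightarrow> complex \<Rightarrow> complex \<Rightarrow> complex" where
  "hyp2F1 a b c x =
     (\<Sum>n. pochhammer a n * pochhammer b n / pochhammer c n * (x ^ n / fact n))"

(* jacobiK n x a b is the Jacobi polynomial P_n^(b-1, a-1) (2 x - 1); for a, b > 0 the family is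
   orthogonal on [0,1] for the weight x^(a-1) (1-x)^(b-1).  The coefficient of jacobiK j x f d in
   the expansion of hyp2F1 a b c x is
     (a)_j (b)_j / ((c)_j (f+d+j-1)_j) * 3F2(a+j, b+j, f+j; c+j, f+d+2j; 1).
   The 3F2 is summed by Gauss' formula for f = c and by Watson's formula both for d = f,
   2 c = a + b + 1 and for f + d = 2 a, b + f + 1 = 2 c.

   Convergence: if such an expansion has infinitely many nonzero terms, it converges for x in
   (0,1], it may converge or diverge at x = 0, and it diverges for all other complex x,
   because there the polynomials grow exponentially and the coefficients decay only polynomially.
   An identity for all norm x <= 1 therefore has to be conditional on the convergence
   of the expansion, and convergence can be asserted unconditionally for x in (0,1]. *)
definition jacobiK :: "nat \<Rightarrow> complex \<Rightarrow> complex \<Rightarrow> complex \<Rightarrow> complex" where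
  "jacobiK n x a b =
     1 / fact n * (\<Sum>m=0..n. of_nat (n choose m) * pochhammer (a + b + of_nat n - 1) m *
                              pochhammer (b + of_nat m) (n - m) * (x - 1) ^ m)"

end

theory Submission
  imports Defs
begin

text \<open>Expanding the powers \<open>x\<^sup>m\<close> in the polynomials \<open>K\<^sub>j(x|f,d)\<close> turns the coefficient of
  \<open>K\<^sub>j\<close> in the Gauss series into a \<open>\<^sub>3F\<^sub>2\<close> at \<open>1\<close>, which is summed by the theorems of Gauss (a),
  Watson (b, c) and Saalschuetz (d). It remains to compare the expansion with the function.
  At \<open>x = 1\<close> all terms of the expansions of \<open>x\<^sup>m\<close> are nonnegative, so the summations may be
  interchanged. For \<open>0 < x < 1\<close> a Christoffel--Darboux identity expresses the error of the partial
  sums by the orthonormal polynomials, which are bounded at \<open>x\<close>, times coefficients tending to \<open>0\<close>.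
  At \<open>x = 0\<close> a regular summation method, which comes from Beta weights concentrating at \<open>0\<close>,
  identifies the sum if it exists. Outside \<open>[0,1]\<close> the polynomials grow exponentially while the
  coefficients of a non-terminating expansion have term ratios tending to \<open>1\<close>, so the expansion
  converges only if it terminates. The theorems of Gauss and Watson follow from contiguous relations
  by letting a parameter tend to infinity.\<close>


subsection \<open>Three-term recurrence and expansion of powers\<close>

text \<open>No integral is formed: the Beta weight y^(f-1) (1-y)^(d-1) enters only through the
  recurrence coefficients \<open>recA\<close>, \<open>recB\<close>, \<open>recG\<close>. The
  polynomials satisfy this recurrence, the connection coefficients \<open>conn\<close> its
  transpose, and for f, d > 0 rescaling makes it symmetric. After rescaling, the connection
  coefficients become the inner products \<open>q m j\<close> of x^m with the j-th orthonormal
  polynomial. A Bessel inequality, obtained by moving powers of x from one factor to the other,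
  bounds them by 1, so the absolute convergence of the Gauss series at 1 dominates the interchanges
  of limits. The obstacle is an interior point: the bounds on \<open>q\<close> and on the
  polynomials do not control the sum over j of |q m j p_j(x)| uniformly in m, so the double series
  cannot simply be rearranged, and the partial sums are evaluated exactly instead. Growth is
  compared two indices apart because the Watson coefficients contain Gamma functions of j/2, whose
  quotients are rational only after j is raised by 2.\<close>

text \<open>For \<open>s = 1\<close> and \<open>j = 0\<close> the general formula for \<open>recA\<close> would read \<open>0/0\<close>; in \<open>recB\<close> the second
  summand vanishes at \<open>j = 0\<close> even for \<open>s = 2\<close>, by the convention \<open>0/0 = 0\<close>.\<close>

definition recA :: "'a::field_char_0 \<Rightarrow> nat \<Rightarrow> 'a" where
  "recA s j = (if j = 0 then 1 / s
     else (of_nat j + 1) * (s + of_nat j - 1) / ((s + 2 * of_nat j - 1) * (s + 2 * of_nat j)))"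

definition recB :: "'a::field_char_0 \<Rightarrow> 'a \<Rightarrow> nat \<Rightarrow> 'a" where
  "recB f s j = (of_nat j + 1) * (f + of_nat j) / (s + 2 * of_nat j)
     - of_nat j * (f + of_nat j - 1) / (s + 2 * of_nat j - 2)"

definition recG :: "'a::field_char_0 \<Rightarrow> 'a \<Rightarrow> nat \<Rightarrow> 'a" where
  "recG f s j = (f + of_nat j - 1) * (s - f + of_nat j - 1)
     / ((s + 2 * of_nat j - 1) * (s + 2 * of_nat j - 2))"

text \<open>The coefficient of (x-1)^m in K_j, where s = f + d. The value 0 for m > j allows the
  three polynomials of a recurrence to be summed over one common range.\<close>

definition jacobi_coeff :: "'a::field_char_0 \<Rightarrow> 'a \<Rightarrow> nat \<Rightarrow> nat \<Rightarrow> 'a" where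
  "jacobi_coeff s d j m = (if m \<le> j then pochhammer (s + of_nat j - 1) m *
     pochhammer (d + of_nat m) (j - m) / (fact m * fact (j - m)) else 0)"

lemma jacobiK_eq_sum:
  assumes "j \<le> M"
  shows "jacobiK j x f d = (\<Sum>m\<le>M. jacobi_coeff (f + d) d j m * (x - 1) ^ m)"
proof -
  have "jacobiK j x f d = (\<Sum>m\<le>j. jacobi_coeff (f + d) d j m * (x - 1) ^ m)"
    unfolding jacobiK_def sum_distrib_left atLeast0AtMost
    by (intro sum.cong) (auto simp: jacobi_coeff_def binomial_fact field_simps)
  also have "\<dots> = (\<Sum>m\<le>M. jacobi_coeff (f + d) d j m * (x - 1) ^ m)"
    using assms by (intro sum.mono_neutral_left) (auto simp: jacobi_coeff_def)
  finally show ?thesis .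
qed

text \<open>This is the recurrence at x = 1, divided by K_j(1) = (d)_j / j!. In the variables p = s
  + 2j and e = d + j the denominators are p, p-1, p-2, and clearing them leaves a polynomial
  identity.\<close>

lemma jacobi_rec_rational_0:
  fixes s d j :: "'a::field_char_0"
  assumes "s + 2 * j \<noteq> 0" "s + 2 * j - 1 \<noteq> 0" "s + 2 * j - 2 \<noteq> 0"
  shows "(s+j-1)*(d+j)/((s+2*j-1)*(s+2*j)) + ((j+1)*(s-d+j)/(s+2*j) - j*(s-d+j-1)/(s+2*j-2)) + (s-d+j-1)*j/((s+2*j-1)*(s+2*j-2)) = 1"
proof -
  define p e where "p = s + 2 * j" and "e = d + j"
  have s: "s = p - 2 * j" and d: "d = e - j" by (auto simp: p_def e_def)
  have nz: "p \<noteq> 0" "p - 1 \<noteq> 0" "p - 2 \<noteq> 0" using assms by (auto simp: p_def)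
  have E: "p * (p-1) * (p-2) = (p-j-1)*e*(p-2) + ((j+1)*(p-e)*(p-1)*(p-2) - j*(p-e-1)*p*(p-1)) + p*((p-e-1)*j)"
    by algebra
  have "X/((p-1)*p) + (Y/p - Z/(p-2)) + W/((p-1)*(p-2)) = (X * (p-2) + (Y*(p-1)*(p-2) - Z*p*(p-1)) + p*W) / (p * (p-1) * (p-2))" for X Y Z W
    using nz by (simp add: divide_simps) (simp add: algebra_simps)
  from this[of "(p-j-1)*e" "(j+1)*(p-e)" "j*(p-e-1)" "(p-e-1)*j"]
  have "(p-j-1)*e/((p-1)*p) + ((j+1)*(p-e)/p - j*(p-e-1)/(p-2)) + (p-e-1)*j/((p-1)*(p-2)) = 1"
    unfolding E[symmetric] using nz by simp
  then show ?thesis unfolding s d by (simp add: algebra_simps)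
qed

text \<open>The comparison of coefficients at exponent I + 1, after the common Pochhammer symbols
  and factorials have been divided out. L is a field element, not a natural number, so that L = -1
  is available for the boundary case.\<close>

lemma jacobi_rec_rational:
  fixes s d I L j :: "'a::field_char_0"
  assumes "s + 2 * j \<noteq> 0" "s + 2 * j - 1 \<noteq> 0" "s + 2 * j - 2 \<noteq> 0" "j = I + 2 + L"
  shows "(I+1)*(d+I) + (s+j-1+I)*(L+2) = (j+1)/((s+2*j-1)*(s+2*j))*((s+j-1+I)*(s+j+I)*(d+j)) + ((j+1)*(s-d+j)/(s+2*j) - j*(s-d+j-1)/(s+2*j-2))*((s+j-1+I)*(L+2)) + (s-d+j-1)/((s+2*j-1)*(s+2*j-2))*((L+1)*(L+2)*(s+j-2))"
proof -
  define p e where "p = s + 2 * j" and "e = d + j"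
  have s: "s = p - 2 * j" and L: "L = j - 2 - I" and d: "d = e - j" using assms by (auto simp: p_def e_def)
  have nz: "p \<noteq> 0" "p - 1 \<noteq> 0" "p - 2 \<noteq> 0" using assms by (auto simp: p_def)
  have E: "p * (p-1) * (p-2) * ((I+1)*(e-j+I) + (p-j-1+I)*(j-I)) = (j+1)*(p-2)*((p-j-1+I)*(p-j+I)*e) + ((j+1)*(p-e)*(p-1)*(p-2) - j*(p-e-1)*p*(p-1))*((p-j-1+I)*(j-I)) + p*(p-e-1)*((j-1-I)*(j-I)*(p-j-2))"
    by algebra
  have "(j+1)/((p-1)*p)*((p-j-1+I)*(p-j+I)*e) + ((j+1)*(p-e)/p - j*(p-e-1)/(p-2))*((p-j-1+I)*(j-I)) + (p-e-1)/((p-1)*(p-2))*((j-1-I)*(j-I)*(p-j-2)) = 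
     ((j+1)*(p-2)*((p-j-1+I)*(p-j+I)*e) + ((j+1)*(p-e)*(p-1)*(p-2) - j*(p-e-1)*p*(p-1))*((p-j-1+I)*(j-I)) + p*(p-e-1)*((j-1-I)*(j-I)*(p-j-2))) / (p * (p-1) * (p-2))"
  proof -
    have "X/((p-1)*p) * T + (Y/p - Z/(p-2))*T2 + W/((p-1)*(p-2)) * T3 = (X * (p-2) * T + (Y*(p-1)*(p-2) - Z*p*(p-1))*T2 + p*W*T3) / (p * (p-1) * (p-2))" for X T Y Z T2 W T3
      using nz by (simp add: divide_simps) (simp add: algebra_simps)
    then show ?thesis .
  qed
  also have "\<dots> = (I+1)*(e-j+I) + (p-j-1+I)*(j-I)"
    unfolding E[symmetric] using nz by simp
  finally show ?thesis unfolding s d L by (simp add: algebra_simps)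
qed
text \<open>The left-hand side is the coefficient of (x-1)^m in x K_j = (x-1) K_j + K_j. The
  conditions for j > 0 only keep s = 1 and s = 2 admissible at j = 0.\<close>

lemma jacobi_coeff_rec:
  fixes s d :: "'a::field_char_0"
  assumes "s + 2 * of_nat j \<noteq> 0" "j > 0 \<Longrightarrow> s + 2 * of_nat j - 1 \<noteq> 0"
    "j > 0 \<Longrightarrow> s + 2 * of_nat j - 2 \<noteq> 0"
  shows "(if m = 0 then 0 else jacobi_coeff s d j (m - 1)) + jacobi_coeff s d j m =
    recA s j * jacobi_coeff s d (Suc j) m + recB (s - d) s j * jacobi_coeff s d j m
    + (if j = 0 then 0 else recG (s - d) s j * jacobi_coeff s d (j - 1) m)"
proof (cases j)
  case 0
  consider "m = 0" | "m = 1" | "m > 1" by linarith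
  then show ?thesis
    using assms by cases (auto simp: 0 jacobi_coeff_def recA_def recB_def field_simps)
next
  case (Suc j')
  have nz': "s + 2 * of_nat j \<noteq> 0" "s + 2 * of_nat j - 1 \<noteq> 0" "s + 2 * of_nat j - 2 \<noteq> 0"
    using assms Suc by auto
  show ?thesis
  proof (cases m)
    case 0
    define Z where "Z = pochhammer d j' / fact j'"
    have n: "(of_nat j + 1 :: 'a) \<noteq> 0" "(of_nat j :: 'a) \<noteq> 0"
      using of_nat_neq_0[of j, where 'a='a] Suc by (auto simp: add.commute simp del: of_nat_Suc simp flip: of_nat_Suc)
    have jj: "of_nat j' = (of_nat j - 1 :: 'a)" using Suc by simp
    have A: "jacobi_coeff s d (j - 1) 0 = Z" "jacobi_coeff s d j 0 = Z * (d + of_nat j - 1) / of_nat j"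
      using n by (auto simp: jacobi_coeff_def Z_def pochhammer_Suc field_simps Suc)
    have A3: "(of_nat j + 1) * jacobi_coeff s d (Suc j) 0 = jacobi_coeff s d j 0 * (d + of_nat j)"
      using n by (simp add: jacobi_coeff_def pochhammer_Suc add.commute)
    have "recA s j * jacobi_coeff s d (Suc j) 0 = (of_nat j + 1) * jacobi_coeff s d (Suc j) 0 * (s + of_nat j - 1) / ((s + 2 * of_nat j - 1) * (s + 2 * of_nat j))"
      using Suc by (simp add: recA_def)
    also have "\<dots> = jacobi_coeff s d j 0 * ((s + of_nat j - 1) * (d + of_nat j) / ((s + 2 * of_nat j - 1) * (s + 2 * of_nat j)))"
      unfolding A3 by simp
    finally have "recA s j * jacobi_coeff s d (Suc j) 0 = \<dots>" .
    moreover have "recG (s - d) s j * jacobi_coeff s d (j - 1) 0 = jacobi_coeff s d j 0 * ((s - d + of_nat j - 1) * of_nat j / ((s + 2 * of_nat j - 1) * (s + 2 * of_nat j - 2)))"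
      unfolding A using n by (simp add: recG_def)
    ultimately have "recA s j * jacobi_coeff s d (Suc j) 0 + recB (s - d) s j * jacobi_coeff s d j 0
       + recG (s - d) s j * jacobi_coeff s d (j - 1) 0
      = jacobi_coeff s d j 0 * ((s+ of_nat j-1)*(d+ of_nat j)/((s+2* of_nat j-1)*(s+2* of_nat j)) + ((of_nat j+1)*(s-d+ of_nat j)/(s+2* of_nat j) - of_nat j*(s-d+ of_nat j-1)/(s+2* of_nat j-2)) + (s-d+ of_nat j-1)* of_nat j/((s+2* of_nat j-1)*(s+2* of_nat j-2)))"
      by (simp only: recB_def distrib_left mult.commute[of "_ - _" "jacobi_coeff s d j 0"])
    then show ?thesis unfolding jacobi_rec_rational_0[OF nz'] using Suc 0 by simp
  next
    case m: (Suc i)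
    have n: "(of_nat i + 1 :: 'a) \<noteq> 0"
      using of_nat_neq_0[of i, where 'a='a] by (simp_all add: algebra_simps)
    define Y where "Y = pochhammer (s + of_nat j - 1) i"
    have Y1: "pochhammer (s + of_nat j - 1) (Suc i) = Y * (s + of_nat j - 1 + of_nat i)"
      unfolding Y_def by (simp add: pochhammer_Suc)
    have Y2: "pochhammer (s + of_nat j - 2) (Suc i) = Y * (s + of_nat j - 2)"
      unfolding Y_def by (simp add: pochhammer_rec mult.commute algebra_simps)
    have Y3: "(s + of_nat j - 1) * pochhammer (s + of_nat j) (Suc i) = Y * (s + of_nat j - 1 + of_nat i) * (s + of_nat j + of_nat i)"
    proof -
      have "(s + of_nat j - 1) * pochhammer (s + of_nat j) i = Y * (s + of_nat j - 1 + of_nat i)"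
        using Y1 pochhammer_rec[of "s + of_nat j - 1" i] by simp
      then show ?thesis by (simp add: pochhammer_Suc mult.assoc[symmetric])
    qed
    have F: "fact (Suc i) = (of_nat i + 1) * (fact i :: 'a)" by (simp add: algebra_simps)
    \<comment> \<open>All coefficients involved are multiples of one quantity U. \<open>A3\<close>
      and \<open>A4\<close> are stated with the factors s+j-1 and d+j-1 multiplied in, since these
      occur in \<open>recA\<close> and \<open>recG\<close> and may vanish, so that division by them
      is not possible.\<close>
    have step: ?thesis
      if L: "of_nat j = of_nat i + 2 + L"
        and A1: "jacobi_coeff s d j i = U * ((of_nat i + 1) * (d + of_nat i))"
        and A2: "jacobi_coeff s d j (Suc i) = U * ((s + of_nat j - 1 + of_nat i) * (L + 2))"
        and A3: "(s + of_nat j - 1) * jacobi_coeff s d (Suc j) (Suc i) =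
          U * ((s + of_nat j - 1 + of_nat i) * (s + of_nat j + of_nat i) * (d + of_nat j))"
        and A4: "(d + of_nat j - 1) * jacobi_coeff s d (j - 1) (Suc i) = U * ((L + 1) * (L + 2) * (s + of_nat j - 2))"
      for L U
    proof -
      have "recA s j * jacobi_coeff s d (Suc j) (Suc i) = (of_nat j + 1) * ((s + of_nat j - 1) * jacobi_coeff s d (Suc j) (Suc i)) / ((s + 2 * of_nat j - 1) * (s + 2 * of_nat j))"
        using Suc by (simp add: recA_def)
      also have "\<dots> = U * ((of_nat j + 1) / ((s + 2 * of_nat j - 1) * (s + 2 * of_nat j)) * ((s + of_nat j - 1 + of_nat i) * (s + of_nat j + of_nat i) * (d + of_nat j)))"
        unfolding A3 by simp
      finally have 1: "recA s j * jacobi_coeff s d (Suc j) (Suc i) = \<dots>" .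
      have "recG (s - d) s j * jacobi_coeff s d (j - 1) (Suc i) = (s - d + of_nat j - 1) * ((d + of_nat j - 1) * jacobi_coeff s d (j - 1) (Suc i)) / ((s + 2 * of_nat j - 1) * (s + 2 * of_nat j - 2))"
        by (simp add: recG_def)
      also have "\<dots> = U * ((s - d + of_nat j - 1) / ((s + 2 * of_nat j - 1) * (s + 2 * of_nat j - 2)) * ((L + 1) * (L + 2) * (s + of_nat j - 2)))"
        unfolding A4 by simp
      finally have 2: "recG (s - d) s j * jacobi_coeff s d (j - 1) (Suc i) = \<dots>" .
      have "jacobi_coeff s d j i + jacobi_coeff s d j (Suc i) = U * ((of_nat i + 1) * (d + of_nat i) + (s + of_nat j - 1 + of_nat i) * (L + 2))"
        unfolding A1 A2 by (simp only: distrib_left)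
      also note jacobi_rec_rational[OF nz' L, of d]
      also have "U * (a + b * c + e) = U * a + b * (U * c) + U * e" for a b c e :: 'a
        by (simp add: algebra_simps)
      finally show ?thesis
        unfolding 1 2 m A2 using Suc by (simp add: A2 recB_def 1 2 del: of_nat_Suc)
    qed
    consider "i + 2 \<le> j" | "j = i + 1" | "j = i" | "j < i"
      by linarith
    then show ?thesis
    proof cases
      case ge: 1
      then obtain l where 1: "j = i + 2 + l" using le_Suc_ex by blast
      define Z where "Z = pochhammer (d + of_nat i + 1) l"
      have n2: "(of_nat l + 1 :: 'a) \<noteq> 0" "(of_nat l + 2 :: 'a) \<noteq> 0"
        using of_nat_neq_0[of l, where 'a='a] of_nat_neq_0[of "Suc l", where 'a='a] by (simp_all add: algebra_simps)
      have j: "of_nat j = of_nat i + 2 + (of_nat l :: 'a)" using 1 by simp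
      have P: "pochhammer (d + of_nat i) (Suc (Suc l)) = (d + of_nat i) * Z * (d + of_nat j - 1)"
        "pochhammer (d + of_nat (Suc i)) (Suc l) = Z * (d + of_nat j - 1)"
        "pochhammer (d + of_nat (Suc i)) (Suc (Suc l)) = Z * (d + of_nat j - 1) * (d + of_nat j)"
        "pochhammer (d + of_nat (Suc i)) l = Z"
        unfolding Z_def j by (simp_all add: pochhammer_rec[of "d + of_nat i"] pochhammer_Suc[of "d + of_nat i + 1"] pochhammer_Suc[of "1 + (d + of_nat i)"] add_ac)
      have sub: "j - i = Suc (Suc l)" "j - Suc i = Suc l" "Suc j - Suc i = Suc (Suc l)" "j - 1 - Suc i = l"
        "s + of_nat (Suc j) - 1 = s + of_nat j" "s + of_nat (j - 1) - 1 = s + of_nat j - 2"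
        using 1 by simp_all
      have F2: "fact (Suc (Suc l)) = (of_nat l + 1) * (of_nat l + 2) * (fact l :: 'a)" "fact (Suc l) = (of_nat l + 1) * (fact l :: 'a)"
        by (simp_all add: algebra_simps)
      have le: "(Suc i \<le> Suc j) = True" using 1 by simp
      have "(s + of_nat j - 1) * jacobi_coeff s d (Suc j) (Suc i) = (s + of_nat j - 1) * pochhammer (s + of_nat j) (Suc i)
          * (Z * (d + of_nat j - 1) * (d + of_nat j)) / (fact (Suc i) * fact (Suc (Suc l)))"
        unfolding jacobi_coeff_def sub P le if_True by simp
      note A3 = this[unfolded Y3 F F2]
      note jc = jacobi_coeff_def Y_def[symmetric] sub P F F2
      show ?thesis
        apply (rule step[OF j, where U = "Y * Z * (d + of_nat j - 1) / (fact i * fact l * ((of_nat i + 1) * (of_nat l + 1) * (of_nat l + 2)))"])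
        subgoal unfolding jc using 1 n n2 by (simp add: mult_ac)
        subgoal unfolding jc Y1 using 1 n n2 by (simp add: mult_ac)
        subgoal unfolding A3 by (simp add: mult_ac)
        subgoal unfolding jc Y2 using 1 n n2 by (simp add: mult_ac)
        done
    next
      case 2
      have j: "of_nat j = of_nat i + 2 + (- 1 :: 'a)" using 2 by simp
      show ?thesis
        apply (rule step[OF j, where U = "Y / (fact i * (of_nat i + 1))"])
        subgoal unfolding jacobi_coeff_def Y_def[symmetric] using 2 n by simp
        subgoal unfolding jacobi_coeff_def Y1 F using 2 n by (simp add: mult_ac)
        subgoal unfolding jacobi_coeff_def F using 2 n Y3 by (simp add: mult_ac add_ac)
        subgoal using 2 by (simp add: jacobi_coeff_def)
        done
    next
      \<comment> \<open>Only leading coefficients remain. The scheme of \<open>step\<close> with L =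
        -2 would require division by d + i, which may be 0.\<close>
      case 3
      have A1: "jacobi_coeff s d j i = Y / fact i"
        unfolding jacobi_coeff_def Y_def[symmetric] using 3 by simp
      have "jacobi_coeff s d (Suc j) (Suc i) = pochhammer (s + of_nat j) (Suc i) / ((of_nat i + 1) * fact i)"
        unfolding jacobi_coeff_def F using 3 by simp
      moreover have "j \<noteq> 0" using Suc by simp
      ultimately have "recA s j * jacobi_coeff s d (Suc j) (Suc i) = (of_nat j + 1) * ((s + of_nat j - 1) * pochhammer (s + of_nat j) (Suc i)) / ((of_nat i + 1) * fact i) / ((s + 2 * of_nat j - 1) * (s + 2 * of_nat j))"
        by (simp add: recA_def mult_ac)
      also have "\<dots> = Y / fact i * (((s + of_nat j - 1 + of_nat i) * (s + of_nat j + of_nat i)) / ((s + 2 * of_nat j - 1) * (s + 2 * of_nat j))) * ((of_nat i + 1) / (of_nat i + 1))"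
        unfolding Y3 using 3 by simp
      also have "s + of_nat j - 1 + of_nat i = s + 2 * of_nat j - 1" using 3 by simp
      also have "s + of_nat j + of_nat i = s + 2 * of_nat j" using 3 by simp
      finally have "recA s j * jacobi_coeff s d (Suc j) (Suc i) = Y / fact i" using nz' n by simp
      then show ?thesis unfolding m using 3 A1 Suc by (simp add: jacobi_coeff_def)
    next
      case 4
      then show ?thesis using m by (simp add: jacobi_coeff_def)
    qed
  qed
qed

lemma jacobiK_rec:
  assumes "f + d + 2 * of_nat j \<noteq> 0" "j > 0 \<Longrightarrow> f + d + 2 * of_nat j - 1 \<noteq> 0"
    "j > 0 \<Longrightarrow> f + d + 2 * of_nat j - 2 \<noteq> 0"
  shows "x * jacobiK j x f d = recA (f + d) j * jacobiK (Suc j) x f d + recB f (f + d) j * jacobiK j x f d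
    + (if j = 0 then 0 else recG f (f + d) j * jacobiK (j - 1) x f d)"
proof -
  let ?c = "jacobi_coeff (f + d) d"
  have "(x - 1) * jacobiK j x f d = (\<Sum>m\<le>j. ?c j m * (x - 1) ^ Suc m)"
    by (subst jacobiK_eq_sum[OF order_refl]) (simp add: sum_distrib_left mult_ac)
  also have "\<dots> = (\<Sum>m\<le>Suc j. (if m = 0 then 0 else ?c j (m - 1)) * (x - 1) ^ m)"
    by (subst sum.atMost_Suc_shift) simp
  finally have 1: "x * jacobiK j x f d = (\<Sum>m\<le>Suc j. (if m = 0 then 0 else ?c j (m - 1)) * (x - 1) ^ m) + jacobiK j x f d"
    by (simp add: algebra_simps)
  have 2: "jacobiK j x f d = (\<Sum>m\<le>Suc j. ?c j m * (x - 1) ^ m)"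
    by (rule jacobiK_eq_sum) simp
  have "x * jacobiK j x f d = (\<Sum>m\<le>Suc j. ((if m = 0 then 0 else ?c j (m - 1)) + ?c j m) * (x - 1) ^ m)"
    unfolding sum.distrib distrib_right 2[symmetric] by (fact 1)
  also have "\<dots> = (\<Sum>m\<le>Suc j. recA (f + d) j * (?c (Suc j) m * (x - 1) ^ m) + recB f (f + d) j * (?c j m * (x - 1) ^ m)
    + (if j = 0 then 0 else recG f (f + d) j * (?c (j - 1) m * (x - 1) ^ m)))"
    by (intro sum.cong refl, subst jacobi_coeff_rec[OF assms]) (auto simp: algebra_simps)
  also have "\<dots> = recA (f + d) j * (\<Sum>m\<le>Suc j. ?c (Suc j) m * (x - 1) ^ m) + recB f (f + d) j * (\<Sum>m\<le>Suc j. ?c j m * (x - 1) ^ m)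
    + (if j = 0 then 0 else recG f (f + d) j * (\<Sum>m\<le>Suc j. ?c (j - 1) m * (x - 1) ^ m))"
    by (cases "j = 0") (simp_all add: sum.distrib sum_distrib_left distrib_left del: sum.atMost_Suc)
  also have "(\<Sum>m\<le>Suc j. ?c (Suc j) m * (x - 1) ^ m) = jacobiK (Suc j) x f d"
    by (rule jacobiK_eq_sum[symmetric]) simp
  also have "(\<Sum>m\<le>Suc j. ?c j m * (x - 1) ^ m) = jacobiK j x f d"
    by (rule jacobiK_eq_sum[symmetric]) simp
  also have "(\<Sum>m\<le>Suc j. ?c (j - 1) m * (x - 1) ^ m) = jacobiK (j - 1) x f d"
    by (rule jacobiK_eq_sum[symmetric]) simp
  finally show ?thesis .
qed

lemma jacobiK_0 [simp]: "jacobiK 0 x f d = 1"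
  by (simp add: jacobiK_def)

lemma jacobiK_at_1: "jacobiK j 1 f d = pochhammer d j / fact j"
proof -
  have "jacobiK j 1 f d = (\<Sum>m\<in>{0}. jacobi_coeff (f + d) d j m * (1 - 1) ^ m)"
    unfolding jacobiK_eq_sum[OF order_refl] by (intro sum.mono_neutral_right) auto
  then show ?thesis by (simp add: jacobi_coeff_def)
qed

text \<open>Exchanging f and d turns \<open>recB\<close> into 1 - \<open>recB\<close> and keeps
  \<open>recA\<close> and \<open>recG\<close>. Hence both sides obey the same recurrence, and this
  determines them because \<open>recA\<close> does not vanish.\<close>

lemma jacobiK_reflect:
  assumes nz: "\<And>i. f + d + of_nat i \<noteq> 0"
  shows "jacobiK j (1 - x) d f = (- 1) ^ j * jacobiK j x f d"
proof (induction j rule: less_induct)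
  case (less n)
  show ?case
  proof (cases n)
    case 0
    then show ?thesis by simp
  next
    case (Suc j)
    have nz2: "f + d + 2 * of_nat j \<noteq> 0" "j > 0 \<Longrightarrow> f + d + 2 * of_nat j - 1 \<noteq> 0"
      "j > 0 \<Longrightarrow> f + d + 2 * of_nat j - 2 \<noteq> 0"
      using nz[of "2 * j"] nz[of "2 * j - 1"] nz[of "2 * j - 2"] by (auto simp: of_nat_diff algebra_simps)
    have A: "recA (f + d) j \<noteq> 0"
    proof (cases "j = 0")
      case True
      then show ?thesis using nz[of 0] by (simp add: recA_def)
    next
      case False
      then have "f + d + of_nat j - 1 \<noteq> 0" using nz[of "j - 1"] by (simp add: of_nat_diff algebra_simps)
      moreover have "of_nat j + 1 \<noteq> (0::complex)" using of_nat_neq_0[of j, where 'a=complex] by (simp add: add.commute)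
      ultimately show ?thesis using False nz2 by (simp add: recA_def)
    qed
    have B: "recB d (f + d) j = 1 - recB f (f + d) j"
    proof -
      have "recB d (f + d) j + recB f (f + d) j = (of_nat j + 1) * (f + d + 2 * of_nat j) / (f + d + 2 * of_nat j)
         - of_nat j * (f + d + 2 * of_nat j - 2) / (f + d + 2 * of_nat j - 2)"
        unfolding recB_def by (simp add: add_divide_distrib[symmetric] diff_divide_distrib[symmetric] algebra_simps)
      also have "\<dots> = 1" using nz2 by (cases "j = 0") simp_all
      finally show ?thesis by (simp add: algebra_simps)
    qed
    have G: "recG d (f + d) j = recG f (f + d) j" by (simp add: recG_def)
    note R = jacobiK_rec[of f d j x, OF nz2]
    note R' = jacobiK_rec[of d f j "1 - x", unfolded add.commute[of d f] B G, OF nz2]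
    have K: "jacobiK j (1 - x) d f = (- 1) ^ j * jacobiK j x f d" using less Suc by simp
    have K': "jacobiK (j - 1) (1 - x) d f = - ((- 1) ^ j * jacobiK (j - 1) x f d)" if "j > 0"
      using less[of "j - 1"] Suc that by (cases j) auto
    have "recA (f + d) j * jacobiK (Suc j) (1 - x) d f = - ((- 1) ^ j * (recA (f + d) j * jacobiK (Suc j) x f d))"
    proof (cases "j = 0")
      case True
      have "recA (f + d) 0 * jacobiK (Suc 0) (1 - x) d f = recB f (f + d) 0 - x" using R' True by (simp add: algebra_simps)
      moreover have "recA (f + d) 0 * jacobiK (Suc 0) x f d = x - recB f (f + d) 0" using R True by (simp add: algebra_simps)
      ultimately show ?thesis using True by simp
    next
      case False
      then have e: "(if j = 0 then 0 else X) = X" for X :: complex by simp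
      have "recA (f + d) j * jacobiK (Suc j) (1 - x) d f = (1 - x) * jacobiK j (1 - x) d f - (1 - recB f (f + d) j) * jacobiK j (1 - x) d f
         - recG f (f + d) j * jacobiK (j - 1) (1 - x) d f" using R'[unfolded e] by (simp add: algebra_simps)
      also have "\<dots> = - ((- 1) ^ j * (x * jacobiK j x f d - recB f (f + d) j * jacobiK j x f d - recG f (f + d) j * jacobiK (j - 1) x f d))"
        using K K' False by (simp add: algebra_simps)
      also have "x * jacobiK j x f d - recB f (f + d) j * jacobiK j x f d - recG f (f + d) j * jacobiK (j - 1) x f d = recA (f + d) j * jacobiK (Suc j) x f d"
        using R[unfolded e] by (simp add: algebra_simps)
      finally show ?thesis .
    qed
    then have "recA (f + d) j * jacobiK (Suc j) (1 - x) d f = recA (f + d) j * ((- 1) ^ Suc j * jacobiK (Suc j) x f d)"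
      by (simp add: mult_ac)
    then show ?thesis unfolding Suc mult_left_cancel[OF A] .
  qed
qed

text \<open>The connection coefficients: with s = f + d, the coefficient of K_j in the expansion of
  x^m.\<close>

definition conn :: "'a::field_char_0 \<Rightarrow> 'a \<Rightarrow> nat \<Rightarrow> nat \<Rightarrow> 'a" where
  "conn f s m j = of_nat (m choose j) * fact j * pochhammer (f + of_nat j) (m - j)
     / (pochhammer (s + of_nat j - 1) j * pochhammer (s + 2 * of_nat j) (m - j))"

lemma conn_eq_0 [simp]: "m < j \<Longrightarrow> conn f s m j = 0"
  by (simp add: conn_def)

lemma conn_0_right: "conn f s m 0 = pochhammer f m / pochhammer s m"
  by (simp add: conn_def)

lemma conn_0_left: "conn f s 0 j = (if j = 0 then 1 else 0)"
  by (simp add: conn_def)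

text \<open>What is left of the recurrence for \<open>conn\<close> in the range 0 < j <= m after the
  common factor is removed; again p = s + 2j reduces it to a polynomial identity.\<close>

lemma conn_rec_rational:
  fixes f s j m :: "'a::field_char_0"
  assumes "s + 2 * j \<noteq> 0" "s + 2 * j - 2 \<noteq> 0"
  shows "(m+1)*(f+m)*(s+2*j-1) = j*(f+j-1)*((s+j-1+m)*(s+j+m))/(s+2*j-2)
    + ((j+1)*(f+j)/(s+2*j) - j*(f+j-1)/(s+2*j-2))*((m+1-j)*(s+2*j-1)*(s+j+m))
    + (s-f+j)*(s+j-1)*((m+1-j)*(m-j))/(s+2*j)"
proof -
  define p where "p = s + 2 * j"
  have s: "s = p - 2 * j" by (auto simp: p_def)
  have nz: "p \<noteq> 0" "p - 2 \<noteq> 0" using assms by (auto simp: p_def)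
  have E: "p*(p-2)*((m+1)*(f+m)*(p-1)) = p*(j*(f+j-1)*((p-j-1+m)*(p-j+m)))
    + ((p-2)*((j+1)*(f+j)) - p*(j*(f+j-1)))*((m+1-j)*(p-1)*(p-j+m))
    + (p-2)*((p-2*j-f+j)*(p-j-1)*((m+1-j)*(m-j)))"
    by algebra
  have "X/(p-2) + (Y/p - Z/(p-2))*T + W/p = (p*X + ((p-2)*Y - p*Z)*T + (p-2)*W) / (p * (p-2))" for X Y Z W T
    using nz by (simp add: divide_simps) (simp add: algebra_simps)?
  from this[of "j*(f+j-1)*((p-j-1+m)*(p-j+m))" "(j+1)*(f+j)" "j*(f+j-1)" "(m+1-j)*(p-1)*(p-j+m)" "(p-2*j-f+j)*(p-j-1)*((m+1-j)*(m-j))"]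
  have "j*(f+j-1)*((p-j-1+m)*(p-j+m))/(p-2)
    + ((j+1)*(f+j)/p - j*(f+j-1)/(p-2))*((m+1-j)*(p-1)*(p-j+m))
    + (p-2*j-f+j)*(p-j-1)*((m+1-j)*(m-j))/p = (m+1)*(f+m)*(p-1)"
    unfolding E[symmetric] using nz by simp
  then show ?thesis unfolding s by (simp add: algebra_simps)
qed

text \<open>Inserting the missing factor s + 2j - 1 merges the two Pochhammer symbols of the
  denominator into one of fixed length m + 1, which makes the values at j-1, j and j+1
  comparable.\<close>

lemma conn_altdef:
  fixes f s :: "'a::field_char_0"
  assumes "j \<le> m" "s + 2 * of_nat j - 1 \<noteq> 0"
  shows "conn f s m j = fact m / fact (m - j) * pochhammer (f + of_nat j) (m - j) * (s + 2 * of_nat j - 1)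
     / pochhammer (s + of_nat j - 1) (Suc m)"
proof -
  have "pochhammer (s + of_nat j - 1) (j + Suc (m - j)) = pochhammer (s + of_nat j - 1) j
      * ((s + 2 * of_nat j - 1) * pochhammer (s + 2 * of_nat j) (m - j))"
    unfolding pochhammer_product' pochhammer_rec by (simp add: algebra_simps)
  moreover have "j + Suc (m - j) = Suc m" using assms by simp
  ultimately have P: "pochhammer (s + of_nat j - 1) (Suc m) = pochhammer (s + of_nat j - 1) j
      * ((s + 2 * of_nat j - 1) * pochhammer (s + 2 * of_nat j) (m - j))" by simp
  have "of_nat (m choose j) * fact j = (fact m / fact (m - j) :: 'a)"
    using assms by (simp add: binomial_fact)
  then show ?thesis
    unfolding conn_def P using assms by simp
qed

text \<open>The expansion of x^(m+1) = x x^m read off coefficientwise, hence the transpose of the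
  recurrence of the polynomials. The indices j = 0 and j = m + 1 are separate:
  \<open>conn_altdef\<close> would exclude s = 1 at the former and does not cover the
  latter.\<close>

lemma conn_rec:
  fixes f s :: "'a::field_char_0"
  assumes nz: "\<And>i. i < 2 * Suc m \<Longrightarrow> s + of_nat i \<noteq> 0"
  shows "conn f s (Suc m) j = (if j = 0 then 0 else recA s (j - 1) * conn f s m (j - 1))
    + recB f s j * conn f s m j + recG f s (Suc j) * conn f s m (Suc j)"
proof -
  consider "j = 0" | "j > Suc m" | "j = Suc m" | "0 < j" "j \<le> m" by linarith
  then show ?thesis
  proof cases
    case 1
    have s: "s \<noteq> 0" using nz[of 0] by simp
    show ?thesis
    proof (cases m)
      case 0
      then show ?thesis using 1 by (simp add: conn_def recB_def)
    next
      case (Suc m')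
      have s1: "s + 1 \<noteq> 0" using nz[of 1] by (simp add: Suc)
      define X where "X = pochhammer f m / (s * (s + 1) * pochhammer (s + 2) m')"
      have p1: "pochhammer s (Suc m) = s * (s + 1) * pochhammer (s + 2) m'"
        unfolding Suc pochhammer_rec by (simp add: add_ac mult_ac)
      have p2: "pochhammer s m * (s + of_nat m) = pochhammer s (Suc m)" by (simp add: pochhammer_Suc)
      have sm: "s + of_nat m \<noteq> 0" using nz[of m] by simp
      have a: "conn f s (Suc m) 0 = X * (f + of_nat m)"
        unfolding conn_0_right p1 X_def by (simp add: pochhammer_Suc)
      have b: "conn f s m 0 = X * (s + of_nat m)"
        unfolding conn_0_right X_def p1[symmetric] p2[symmetric] using sm by simp
      have "f * conn f s m 1 = f * pochhammer (f + 1) m' * of_nat m / (s * pochhammer (s + 2) m')"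
        unfolding conn_def by (simp add: Suc)
      also have "f * pochhammer (f + 1) m' = pochhammer f m" by (simp add: Suc pochhammer_rec)
      finally have c: "f * conn f s m 1 = X * of_nat m * (s + 1)"
        unfolding X_def using s1 by simp
      have "recG f s 1 * conn f s m 1 = (s - f) * (f * conn f s m 1) / ((s + 1) * s)"
        by (simp add: recG_def mult_ac add_ac)
      also have "\<dots> = X * (of_nat m * (s - f) / s)" unfolding c using s1 by simp
      finally have d: "recG f s 1 * conn f s m 1 = \<dots>" .
      have "recB f s 0 * conn f s m 0 + recG f s 1 * conn f s m 1 = X * (f / s * (s + of_nat m) + of_nat m * (s - f) / s)"
        unfolding d unfolding b by (simp add: recB_def algebra_simps)
      also have "f / s * (s + of_nat m) + of_nat m * (s - f) / s = f + of_nat m"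
        using s by (simp add: field_simps)
      finally show ?thesis using 1 a by simp
    qed
  next
    case 2
    then show ?thesis by simp
  next
    case 3
    have "s + of_nat (2 * m) \<noteq> 0" using nz[of "2 * m"] by simp
    moreover have "s + of_nat (2 * m) + 1 \<noteq> 0" using nz[of "2 * m + 1"] by (simp add: add_ac)
    ultimately have n: "s + 2 * of_nat m \<noteq> 0" "s + 2 * of_nat m + 1 \<noteq> 0" by simp_all
    have a: "conn f s (Suc m) (Suc m) = (of_nat m + 1) * fact m / pochhammer (s + of_nat m) (Suc m)"
      by (simp add: conn_def add.commute)
    have b: "conn f s m m = fact m / pochhammer (s + of_nat m - 1) m"
      by (simp add: conn_def)
    have "conn f s (Suc m) (Suc m) = recA s m * conn f s m m"
    proof (cases "m = 0")
      case True
      then show ?thesis by (simp add: conn_def recA_def)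
    next
      case False
      have n1: "s + of_nat m - 1 \<noteq> 0" using nz[of "m - 1"] False by (simp add: of_nat_diff algebra_simps)
      have n2: "s + 2 * of_nat m - 1 \<noteq> 0" using nz[of "2 * m - 1"] False by (simp add: of_nat_diff algebra_simps)
      have "pochhammer (s + of_nat m - 1) (Suc (Suc m)) = (s + of_nat m - 1) * pochhammer (s + of_nat m) (Suc m)"
        by (subst pochhammer_rec) simp
      moreover have "pochhammer (s + of_nat m - 1) (Suc (Suc m)) = pochhammer (s + of_nat m - 1) m * ((s + 2 * of_nat m - 1) * (s + 2 * of_nat m))"
        unfolding pochhammer_Suc by (simp add: algebra_simps)
      ultimately have "pochhammer (s + of_nat m) (Suc m) = pochhammer (s + of_nat m - 1) m * ((s + 2 * of_nat m - 1) * (s + 2 * of_nat m)) / (s + of_nat m - 1)"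
        using n1 by (simp add: field_simps)
      then show ?thesis unfolding a b using False n1 n n2 by (simp add: recA_def mult_ac)
    qed
    then show ?thesis using 3 by simp
  next
    case 4
    have p1: "s + 2 * of_nat j - 1 \<noteq> 0" using nz[of "2 * j - 1"] 4 by (simp add: of_nat_diff algebra_simps)
    have p2: "s + 2 * of_nat j - 2 \<noteq> 0" using nz[of "2 * j - 2"] 4 by (simp add: of_nat_diff algebra_simps)
    have p0: "s + 2 * of_nat j \<noteq> 0" using nz[of "2 * j"] 4 by simp
    have p3: "s + 2 * of_nat j + 1 \<noteq> 0" using nz[of "2 * j + 1"] 4 by (simp add: algebra_simps)
    have q1: "s + of_nat j - 1 \<noteq> 0" using nz[of "j - 1"] 4 by (simp add: of_nat_diff algebra_simps)
    have q2: "s + of_nat j + of_nat m \<noteq> 0" using nz[of "j + m"] 4 by (simp add: algebra_simps)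
    have q3: "s + of_nat j + of_nat m - 1 \<noteq> 0" using nz[of "j + m - 1"] 4 by (simp add: of_nat_diff algebra_simps)
    define l where "l = m - j"
    have m: "m = j + l" using 4 by (simp add: l_def)
    define W where "W = pochhammer (s + of_nat j - 1) (Suc (Suc m))"
    have W1: "W = pochhammer (s + of_nat j - 1) (Suc m) * (s + of_nat j + of_nat m)"
      unfolding W_def by (subst pochhammer_Suc) (simp add: algebra_simps)
    have W2: "W = (s + of_nat j - 1) * pochhammer (s + of_nat j) (Suc m)"
      unfolding W_def by (subst pochhammer_rec) (simp add: algebra_simps)
    have W3: "W = pochhammer (s + of_nat j - 1) m * ((s + of_nat j + of_nat m - 1) * (s + of_nat j + of_nat m))"
      unfolding W1 by (subst pochhammer_Suc) (simp add: algebra_simps)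
    have W1': "pochhammer (s + of_nat j - 1) (Suc m) = W / (s + of_nat j + of_nat m)" using W1 q2 by simp
    have W2': "pochhammer (s + of_nat j) (Suc m) = W / (s + of_nat j - 1)" using W2 q1 by simp
    have W3': "pochhammer (s + of_nat j - 1) m = W / ((s + of_nat j + of_nat m - 1) * (s + of_nat j + of_nat m))" using W3 q2 q3 by simp
    define U where "U = fact m / fact (Suc l) * pochhammer (f + of_nat j) l / W"
    have lm: "of_nat l = (of_nat m - of_nat j :: 'a)" by (simp add: m)
    have fl: "fact l = fact (Suc l) / (of_nat m + 1 - of_nat j :: 'a)"
    proof -
      have e: "of_nat m + 1 - of_nat j = (of_nat (Suc l) :: 'a)" using lm by simp
      show ?thesis unfolding e fact_Suc using of_nat_neq_0[of l, where 'a='a] by (simp del: of_nat_Suc)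
    qed
    have a: "conn f s (Suc m) j = U * ((of_nat m + 1) * (f + of_nat m) * (s + 2 * of_nat j - 1))"
    proof -
      have e: "Suc m - j = Suc l" using 4 by (simp add: l_def)
      have P: "pochhammer (f + of_nat j) (Suc l) = pochhammer (f + of_nat j) l * (f + of_nat m)"
        by (simp add: pochhammer_Suc m add_ac)
      have "j \<le> Suc m" using 4 by simp
      then have "conn f s (Suc m) j = fact (Suc m) / fact (Suc l) * (pochhammer (f + of_nat j) l * (f + of_nat m)) * (s + 2 * of_nat j - 1) / W"
        using conn_altdef[OF _ p1, of "Suc m" f] unfolding e P W_def by blast
      then show ?thesis by (simp add: U_def mult_ac add.commute[of 1])
    qed
    have b: "conn f s m j = U * ((of_nat m + 1 - of_nat j) * (s + 2 * of_nat j - 1) * (s + of_nat j + of_nat m))"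
    proof -
      have "conn f s m j = fact m / (fact (Suc l) / (of_nat m + 1 - of_nat j)) * pochhammer (f + of_nat j) l * (s + 2 * of_nat j - 1)
         / (W / (s + of_nat j + of_nat m))"
        using conn_altdef[OF 4(2) p1, of f] unfolding W1' l_def[symmetric] fl .
      then show ?thesis by (simp add: U_def mult_ac del: fact_Suc)
    qed
    have c: "recA s (j - 1) * conn f s m (j - 1) = U * (of_nat j * (f + of_nat j - 1) * ((s + of_nat j - 1 + of_nat m) * (s + of_nat j + of_nat m)) / (s + 2 * of_nat j - 2))"
    proof -
      have P: "pochhammer (f + of_nat j - 1) (Suc l) = (f + of_nat j - 1) * pochhammer (f + of_nat j) l"
        by (simp add: pochhammer_rec)
      have X: "recA s (j - 1) * conn f s m (j - 1) = of_nat j / (s + 2 * of_nat j - 2) * (fact m / fact (Suc l) * pochhammer (f + of_nat j - 1) (Suc l) / pochhammer (s + of_nat j - 1) m)"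
      \<comment> \<open>Here the index j - 1 is 0, where \<open>conn_altdef\<close> would again
        exclude s = 1.\<close>
      proof (cases "j = 1")
        case True
        then show ?thesis using m of_nat_neq_0[of l, where 'a='a] by (simp add: recA_def conn_0_right)
      next
        case False
        obtain i where i: "j = Suc (Suc i)" by (rule that[of "j - 2"]) (use 4 False in auto)
        have n3: "s + 2 * of_nat i + 1 \<noteq> 0" using nz[of "2 * i + 1"] 4 by (simp add: i algebra_simps)
        have n4: "s + of_nat i \<noteq> 0" using nz[of i] 4 by (simp add: i)
        have e: "s + 2 * of_nat (Suc i) - 1 = s + 2 * of_nat i + 1" by simp
        have "pochhammer (s + of_nat (Suc i) - 1) (Suc m) = (s + of_nat i) * pochhammer (s + of_nat j - 1) m"
          by (subst pochhammer_rec) (simp add: i algebra_simps)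
        moreover have "m - Suc i = Suc l" using m i by simp
        moreover have "f + of_nat (Suc i) = f + of_nat j - 1" by (simp add: i)
        moreover have "conn f s m (Suc i) = fact m / fact (m - Suc i) * pochhammer (f + of_nat (Suc i)) (m - Suc i) * (s + 2 * of_nat (Suc i) - 1)
           / pochhammer (s + of_nat (Suc i) - 1) (Suc m)"
          by (rule conn_altdef) (use m i in simp, use n3 e in metis)
        ultimately have "conn f s m (j - 1) = fact m / fact (Suc l) * pochhammer (f + of_nat j - 1) (Suc l) * (s + 2 * of_nat i + 1)
           / ((s + of_nat i) * pochhammer (s + of_nat j - 1) m)"
          by (simp only: e i diff_Suc_1)
        moreover have "recA s (j - 1) = of_nat j * (s + of_nat i) / ((s + 2 * of_nat i + 1) * (s + 2 * of_nat j - 2))"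
          by (simp add: recA_def i algebra_simps)
        ultimately show ?thesis using n3 n4 by (simp del: fact_Suc)
      qed
      show ?thesis unfolding X W3' P U_def using q2 q3 by (simp add: add_diff_eq diff_add_eq mult_ac del: fact_Suc)
    qed
    have d: "recG f s (Suc j) * conn f s m (Suc j) = U * ((s - f + of_nat j) * (s + of_nat j - 1) * ((of_nat m + 1 - of_nat j) * (of_nat m - of_nat j)) / (s + 2 * of_nat j))"
    proof (cases l)
      case 0
      then show ?thesis using m by simp
    next
      case (Suc l')
      have ls: "m - Suc j = l'" using m Suc by simp
      have fl': "(of_nat m - of_nat j) * fact l' = (fact l :: 'a)"
        using lm by (simp add: Suc)
      have mj: "of_nat m - of_nat j \<noteq> (0::'a)" using lm Suc by (metis of_nat_neq_0)
      have fl'': "fact l' = fact (Suc l) / ((of_nat m + 1 - of_nat j) * (of_nat m - of_nat j :: 'a))"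
      proof -
        have "fact l' = fact l / (of_nat m - of_nat j :: 'a)" using mj by (simp flip: fl')
        then show ?thesis unfolding fl by (simp del: fact_Suc)
      qed
      have P: "pochhammer (f + of_nat j) l = (f + of_nat j) * pochhammer (f + of_nat (Suc j)) l'"
        unfolding Suc pochhammer_rec by (simp add: add_ac)
      have e: "s + of_nat (Suc j) - 1 = s + of_nat j" "s + 2 * of_nat (Suc j) - 1 = s + 2 * of_nat j + 1" by simp_all
      have "conn f s m (Suc j) = fact m / fact l' * pochhammer (f + of_nat (Suc j)) l' * (s + 2 * of_nat j + 1) / (W / (s + of_nat j - 1))"
        using conn_altdef[of "Suc j" m s f] m Suc p3 unfolding ls W2' e by simp
      moreover have "recG f s (Suc j) = (f + of_nat j) * (s - f + of_nat j) / ((s + 2 * of_nat j + 1) * (s + 2 * of_nat j))"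
        by (simp add: recG_def algebra_simps)
      ultimately show ?thesis using p3 unfolding U_def P fl'' by (simp add: mult_ac del: fact_Suc)
    qed
    have "U * (a' + b' * c' + e') = U * a' + b' * (U * c') + U * e'" for a' b' c' e' :: 'a
      by (simp add: algebra_simps)
    note a[unfolded conn_rec_rational[OF p0 p2, of "of_nat m" f] this, folded b c d recB_def]
    then show ?thesis using 4 by simp
  qed
qed

text \<open>The sequence w is arbitrary because the lemma serves twice: for the values of the
  polynomials, which gives the expansion of x^m, and for the Beta functionals
  \<open>beta_eval\<close>, which gives moments.\<close>

lemma conn_transpose:
  fixes f s :: "'a::field_char_0" and w :: "nat \<Rightarrow> 'a"
  assumes nz: "\<And>i. i < 2 * Suc m \<Longrightarrow> s + of_nat i \<noteq> 0"
  shows "(\<Sum>j\<le>Suc m. conn f s (Suc m) j * w j) = (\<Sum>j\<le>m. conn f s m j *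
    (recA s j * w (Suc j) + recB f s j * w j + (if j = 0 then 0 else recG f s j * w (j - 1))))"
proof -
  let ?c = "conn f s" and ?A = "recA s" and ?B = "recB f s" and ?G = "recG f s"
  have "(\<Sum>j\<le>m. ?c m j * (?A j * w (Suc j) + ?B j * w j + (if j = 0 then 0 else ?G j * w (j - 1))))
    = (\<Sum>j\<le>m. ?A j * ?c m j * w (Suc j)) + (\<Sum>j\<le>m. ?B j * ?c m j * w j)
      + (\<Sum>j\<le>m. if j = 0 then 0 else ?G j * ?c m j * w (j - 1))"
    unfolding sum.distrib[symmetric] by (intro sum.cong) (auto simp: algebra_simps)
  also have "(\<Sum>j\<le>m. ?A j * ?c m j * w (Suc j)) = (\<Sum>j\<le>Suc m. (if j = 0 then 0 else ?A (j - 1) * ?c m (j - 1)) * w j)"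
    by (simp add: sum.atMost_Suc_shift del: sum.atMost_Suc)
  also have "(\<Sum>j\<le>m. ?B j * ?c m j * w j) = (\<Sum>j\<le>Suc m. ?B j * ?c m j * w j)"
    by simp
  also have "(\<Sum>j\<le>m. if j = 0 then 0 else ?G j * ?c m j * w (j - 1)) = (\<Sum>j\<le>Suc (Suc m). if j = 0 then 0 else ?G j * ?c m j * w (j - 1))"
    by simp
  also have "\<dots> = (\<Sum>j\<le>Suc m. ?G (Suc j) * ?c m (Suc j) * w j)"
    by (subst sum.atMost_Suc_shift) simp
  finally show ?thesis
    unfolding sum.distrib[symmetric] distrib_right[symmetric] by (simp only: conn_rec[OF nz, symmetric])
qed

theorem power_eq_sum_jacobiK:
  fixes f d x :: complex
  assumes nz: "\<And>i. i < 2 * m \<Longrightarrow> f + d + of_nat i \<noteq> 0"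
  shows "x ^ m = (\<Sum>j\<le>m. conn f (f + d) m j * jacobiK j x f d)"
  using nz
proof (induction m)
  case 0
  then show ?case by (simp add: conn_0_left)
next
  case (Suc m)
  have "x ^ Suc m = (\<Sum>j\<le>m. conn f (f + d) m j * (x * jacobiK j x f d))"
    using Suc by (simp add: sum_distrib_left mult_ac)
  also have "\<dots> = (\<Sum>j\<le>m. conn f (f + d) m j * (recA (f + d) j * jacobiK (Suc j) x f d
    + recB f (f + d) j * jacobiK j x f d + (if j = 0 then 0 else recG f (f + d) j * jacobiK (j - 1) x f d)))"
  proof (intro sum.cong refl)
    fix j assume j: "j \<in> {..m}"
    have "f + d + 2 * of_nat j \<noteq> 0" using Suc.prems[of "2 * j"] j by simp
    moreover have "f + d + 2 * of_nat j - 1 \<noteq> 0" "f + d + 2 * of_nat j - 2 \<noteq> 0" if "j > 0"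
      using Suc.prems[of "2 * j - 1"] Suc.prems[of "2 * j - 2"] j that by (auto simp: of_nat_diff algebra_simps)
    ultimately show "conn f (f + d) m j * (x * jacobiK j x f d) = conn f (f + d) m j * (recA (f + d) j * jacobiK (Suc j) x f d
    + recB f (f + d) j * jacobiK j x f d + (if j = 0 then 0 else recG f (f + d) j * jacobiK (j - 1) x f d))"
      by (subst jacobiK_rec) auto
  qed
  finally show ?case by (simp only: conn_transpose[OF Suc.prems])
qed

subsection \<open>The summation theorems of Gauss and Watson\<close>

lemma add_of_nat_notin_nonpos_Ints:
  fixes c :: complex
  assumes "c \<notin> \<int>\<^sub>\<le>\<^sub>0"
  shows "c + of_nat k \<notin> \<int>\<^sub>\<le>\<^sub>0" "c + of_nat k \<noteq> 0" "pochhammer c k \<noteq> 0"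
proof -
  show *: "c + of_nat k \<notin> \<int>\<^sub>\<le>\<^sub>0"
    using assms nonpos_Ints_diff_Nats[of "c + of_nat k" "of_nat k"] by auto
  then show "c + of_nat k \<noteq> 0" by auto
  show "pochhammer c k \<noteq> 0" using assms pochhammer_eq_0_imp_nonpos_Int by blast
qed

lemma Re_pos_notin_nonpos_Ints: "Re c > 0 \<Longrightarrow> c \<notin> \<int>\<^sub>\<le>\<^sub>0"
  by (auto elim!: nonpos_Ints_cases')

lemma pochhammer_asymp:
  fixes z :: complex
  shows "(\<lambda>n. pochhammer z (Suc n) / (fact n * exp (z * of_real (ln (of_nat n))))) \<longlonglongrightarrow> rGamma z"
  using rGamma_series_LIMSEQ[of z] by (simp add: rGamma_series_def[abs_def])

lemma norm_fact_exp: "n > 0 \<Longrightarrow> norm (fact n * exp (z * of_real (ln (of_nat n))) :: complex) = fact n * real n powr Re z"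
  by (simp add: norm_mult powr_def)

lemma pochhammer_upper:
  fixes z :: complex
  obtains K where "K > 0" "\<And>n. n > 0 \<Longrightarrow> norm (pochhammer z (Suc n)) \<le> K * (fact n * real n powr Re z)"
proof -
  have "Bseq (\<lambda>n. pochhammer z (Suc n) / (fact n * exp (z * of_real (ln (of_nat n)))))"
    using pochhammer_asymp convergentI convergent_imp_Bseq by blast
  then obtain K where K: "K > 0" "\<And>n. norm (pochhammer z (Suc n) / (fact n * exp (z * of_real (ln (of_nat n))))) \<le> K"
    by (auto simp: Bseq_def)
  show ?thesis
  proof (rule that[OF K(1)])
    fix n :: nat assume "n > 0"
    then show "norm (pochhammer z (Suc n)) \<le> K * (fact n * real n powr Re z)"
      using K(2)[of n] by (simp only: norm_divide norm_fact_exp) (simp add: divide_simps)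
  qed
qed

text \<open>Away from the nonpositive integers the limit \<open>rGamma z\<close> of the normalised
  Pochhammer symbols is nonzero, so their reciprocals converge as well and are bounded.\<close>

lemma pochhammer_lower:
  fixes z :: complex
  assumes "z \<notin> \<int>\<^sub>\<le>\<^sub>0"
  obtains K where "K > 0" "\<And>n. n > 0 \<Longrightarrow> fact n * real n powr Re z \<le> K * norm (pochhammer z (Suc n))"
proof -
  have "(\<lambda>n. inverse (pochhammer z (Suc n) / (fact n * exp (z * of_real (ln (of_nat n)))))) \<longlonglongrightarrow> inverse (rGamma z)"
    using pochhammer_asymp assms by (intro tendsto_inverse) (auto simp: rGamma_eq_zero_iff)
  then have "Bseq (\<lambda>n. inverse (pochhammer z (Suc n) / (fact n * exp (z * of_real (ln (of_nat n))))))"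
    using convergentI convergent_imp_Bseq by blast
  then obtain K where K: "K > 0" "\<And>n. norm (inverse (pochhammer z (Suc n) / (fact n * exp (z * of_real (ln (of_nat n)))))) \<le> K"
    by (auto simp: Bseq_def)
  show ?thesis
  proof (rule that[OF K(1)])
    fix n :: nat assume "n > 0"
    then show "fact n * real n powr Re z \<le> K * norm (pochhammer z (Suc n))"
      using K(2)[of n] add_of_nat_notin_nonpos_Ints(3)[OF assms, of "Suc n"]
      by (simp only: norm_divide norm_inverse norm_fact_exp) (simp add: divide_simps del: pochhammer_Suc)
  qed
qed

text \<open>The terms of 3F2(a, b, e; c, g; 1). With e = g = 1 they become those of 2F1(a, b; c; 1),
  so one set of estimates serves Gauss's and Watson's series.\<close>

definition hyp3F2_term :: "complex \<Rightarrow> complex \<Rightarrow> complex \<Rightarrow> complex \<Rightarrow> complex \<Rightarrow> nat \<Rightarrow> complex" where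
  "hyp3F2_term a b e c g m = pochhammer a m * pochhammer b m * pochhammer e m
     / (pochhammer c m * pochhammer g m * fact m)"

text \<open>Each Pochhammer symbol of length n + 1 has size n! n^(Re z). Three factorials in the
  numerator meet two in the denominator and (n+1)!, which leaves 1/(n+1) and a power of n given by
  the parametric excess.\<close>

lemma hyp3F2_term_bound:
  assumes "c \<notin> \<int>\<^sub>\<le>\<^sub>0" "g \<notin> \<int>\<^sub>\<le>\<^sub>0"
  obtains K where "K > 0" "\<And>n. n > 0 \<Longrightarrow>
    norm (hyp3F2_term a b e c g (Suc n)) \<le> K * real n powr (- Re (c + g - a - b - e)) / (real n + 1)"
proof -
  obtain Ka where Ka: "Ka > 0" "\<And>n. n > 0 \<Longrightarrow> norm (pochhammer a (Suc n)) \<le> Ka * (fact n * real n powr Re a)"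
    by (rule pochhammer_upper[of a]) blast
  obtain Kb where Kb: "Kb > 0" "\<And>n. n > 0 \<Longrightarrow> norm (pochhammer b (Suc n)) \<le> Kb * (fact n * real n powr Re b)"
    by (rule pochhammer_upper[of b]) blast
  obtain Ke where Ke: "Ke > 0" "\<And>n. n > 0 \<Longrightarrow> norm (pochhammer e (Suc n)) \<le> Ke * (fact n * real n powr Re e)"
    by (rule pochhammer_upper[of e]) blast
  obtain Kc where Kc: "Kc > 0" "\<And>n. n > 0 \<Longrightarrow> fact n * real n powr Re c \<le> Kc * norm (pochhammer c (Suc n))"
    by (rule pochhammer_lower[OF assms(1)]) blast
  obtain Kg where Kg: "Kg > 0" "\<And>n. n > 0 \<Longrightarrow> fact n * real n powr Re g \<le> Kg * norm (pochhammer g (Suc n))"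
    by (rule pochhammer_lower[OF assms(2)]) blast
  show ?thesis
  proof (rule that[of "Ka * Kb * Ke * Kc * Kg"])
    show "Ka * Kb * Ke * Kc * Kg > 0" using Ka Kb Ke Kc Kg by simp
    fix n :: nat assume n: "n > 0"
    let ?p = "\<lambda>z. norm (pochhammer z (Suc n))"
    let ?F = "\<lambda>z. fact n * real n powr Re z :: real"
    have pos: "?F z > 0" for z using n by simp
    have ce: "?p c \<ge> ?F c / Kc" "?p g \<ge> ?F g / Kg"
      using Kc Kg n by (simp_all add: divide_simps mult.commute)
    have "?p a * ?p b * ?p e \<le> (Ka * ?F a) * (Kb * ?F b) * (Ke * ?F e)"
      using Ka Kb Ke n by (intro mult_mono) (auto intro!: mult_nonneg_nonneg)
    moreover have "?p c * ?p g \<ge> (?F c / Kc) * (?F g / Kg)"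
      using ce Kc Kg n by (intro mult_mono) auto
    ultimately have "?p a * ?p b * ?p e / (?p c * ?p g) \<le> (Ka * ?F a) * (Kb * ?F b) * (Ke * ?F e) / ((?F c / Kc) * (?F g / Kg))"
      using Ka Kb Ke Kc Kg n by (intro frac_le) (auto intro!: mult_nonneg_nonneg)
    then have "norm (hyp3F2_term a b e c g (Suc n)) \<le> (Ka * ?F a) * (Kb * ?F b) * (Ke * ?F e) / ((?F c / Kc) * (?F g / Kg)) / fact (Suc n)"
      unfolding hyp3F2_term_def norm_mult norm_divide norm_fact divide_divide_eq_left[symmetric]
      by (intro divide_right_mono) simp_all
    also have "\<dots> = (Ka * Kb * Ke * Kc * Kg) * (real n powr Re a * real n powr Re b * real n powr Re e / (real n powr Re c * real n powr Re g)) / (real n + 1)"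
    proof -
      have "(Ka * (F * A)) * (Kb * (F * B)) * (Ke * (F * E)) / ((F * C / Kc) * (F * G / Kg)) / ((1 + real n) * F)
         = (Ka * Kb * Ke * Kc * Kg) * (A * B * E / (C * G)) / (real n + 1)" if "F \<noteq> 0" for F A B C E G :: real
        using that by (simp add: mult_ac add.commute)
      from this[OF fact_nonzero] show ?thesis unfolding fact_Suc of_nat_Suc .
    qed
    also have "real n powr Re a * real n powr Re b * real n powr Re e / (real n powr Re c * real n powr Re g) = real n powr (- Re (c + g - a - b - e))"
      unfolding powr_add[symmetric] powr_diff[symmetric] by (simp add: algebra_simps)
    finally show "norm (hyp3F2_term a b e c g (Suc n)) \<le> Ka * Kb * Ke * Kc * Kg * real n powr (- Re (c + g - a - b - e)) / (real n + 1)" .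
  qed
qed

text \<open>The second conclusion makes the boundary terms of the telescoping sums below vanish in
  the limit.\<close>

lemma
  assumes "c \<notin> \<int>\<^sub>\<le>\<^sub>0" "g \<notin> \<int>\<^sub>\<le>\<^sub>0" and pos: "Re (c + g - a - b - e) > 0"
  shows summable_norm_hyp3F2_term: "summable (\<lambda>m. norm (hyp3F2_term a b e c g m))"
    and hyp3F2_term_times_of_nat_tendsto_0: "(\<lambda>m. of_nat m * hyp3F2_term a b e c g m) \<longlonglongrightarrow> 0"
proof -
  define s where "s = Re (c + g - a - b - e)"
  have s: "s > 0" using pos by (simp add: s_def)
  obtain K where K: "K > 0" "\<And>n. n > 0 \<Longrightarrow> norm (hyp3F2_term a b e c g (Suc n)) \<le> K * real n powr (- s) / (real n + 1)"
    using hyp3F2_term_bound[OF assms(1,2), of a b e] unfolding s_def by metis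
  have "summable (\<lambda>m. norm (hyp3F2_term a b e c g (Suc m)))"
  proof (rule summable_comparison_test_ev)
    show "summable (\<lambda>n. K * real n powr (- s - 1))"
      using s by (intro summable_mult) (simp add: summable_real_powr_iff)
    show "eventually (\<lambda>n. norm (norm (hyp3F2_term a b e c g (Suc n))) \<le> K * real n powr (- s - 1)) sequentially"
      using eventually_gt_at_top[of 0]
    proof eventually_elim
      case (elim n)
      have "norm (hyp3F2_term a b e c g (Suc n)) \<le> K * real n powr (- s) / (real n + 1)" using K(2) elim by simp
      also have "\<dots> \<le> K * real n powr (- s) / real n" using K(1) elim by (intro divide_left_mono) auto
      also have "\<dots> = K * real n powr (- s - 1)" using elim by (simp add: powr_diff)
      finally show ?case by simp
    qed
  qed
  then show "summable (\<lambda>m. norm (hyp3F2_term a b e c g m))"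
    using summable_Suc_iff[of "\<lambda>m. norm (hyp3F2_term a b e c g m)"] by blast
  have "(\<lambda>m. of_nat (Suc m) * hyp3F2_term a b e c g (Suc m)) \<longlonglongrightarrow> 0"
  proof (rule Lim_null_comparison)
    show "eventually (\<lambda>n. norm (of_nat (Suc n) * hyp3F2_term a b e c g (Suc n)) \<le> K * real n powr (- s)) sequentially"
      using eventually_gt_at_top[of 0]
    proof eventually_elim
      case (elim n)
      have "norm (of_nat (Suc n) * hyp3F2_term a b e c g (Suc n)) = (real n + 1) * norm (hyp3F2_term a b e c g (Suc n))"
        unfolding norm_mult norm_of_nat by simp
      also have "\<dots> \<le> (real n + 1) * (K * real n powr (- s) / (real n + 1))" using K(2) elim by (intro mult_left_mono) auto
      finally show ?case by simp
    qed
    have "(\<lambda>n. real n powr (- s)) \<longlonglongrightarrow> 0"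
      using s by (intro tendsto_neg_powr filterlim_real_sequentially) auto
    then show "(\<lambda>n. K * real n powr (- s)) \<longlonglongrightarrow> 0" by (rule tendsto_mult_right_zero)
  qed
  then show "(\<lambda>m. of_nat m * hyp3F2_term a b e c g m) \<longlonglongrightarrow> 0"
    by (rule LIMSEQ_imp_Suc)
qed

text \<open>The equality of the parameter sums makes the normalising factors n! n^z of Euler's limit
  cancel exactly. Writing \<open>rGamma\<close> for the numerators admits nonpositive integers for
  \<alpha> and \<beta>.\<close>

lemma pochhammer_quotient_limit:
  fixes \<alpha> \<beta> \<gamma> \<delta> :: complex
  assumes "\<gamma> \<notin> \<int>\<^sub>\<le>\<^sub>0" "\<delta> \<notin> \<int>\<^sub>\<le>\<^sub>0" "\<alpha> + \<beta> = \<gamma> + \<delta>"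
  shows "(\<lambda>n. pochhammer \<alpha> n * pochhammer \<beta> n / (pochhammer \<gamma> n * pochhammer \<delta> n))
    \<longlonglongrightarrow> Gamma \<gamma> * Gamma \<delta> * rGamma \<alpha> * rGamma \<beta>"
proof (rule LIMSEQ_imp_Suc)
  let ?E = "\<lambda>z n. (fact n * exp (z * of_real (ln (of_nat n))) :: complex)"
  have "(\<lambda>n. (pochhammer \<alpha> (Suc n) / ?E \<alpha> n) * (pochhammer \<beta> (Suc n) / ?E \<beta> n) / ((pochhammer \<gamma> (Suc n) / ?E \<gamma> n) * (pochhammer \<delta> (Suc n) / ?E \<delta> n)))
     \<longlonglongrightarrow> rGamma \<alpha> * rGamma \<beta> / (rGamma \<gamma> * rGamma \<delta>)"
    using assms by (intro tendsto_intros pochhammer_asymp) (auto simp: rGamma_eq_zero_iff)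
  moreover have "(pochhammer \<alpha> (Suc n) / ?E \<alpha> n) * (pochhammer \<beta> (Suc n) / ?E \<beta> n) / ((pochhammer \<gamma> (Suc n) / ?E \<gamma> n) * (pochhammer \<delta> (Suc n) / ?E \<delta> n))
     = pochhammer \<alpha> (Suc n) * pochhammer \<beta> (Suc n) / (pochhammer \<gamma> (Suc n) * pochhammer \<delta> (Suc n))" for n
  proof -
    have "?E \<alpha> n * ?E \<beta> n = fact n * fact n * exp ((\<alpha> + \<beta>) * of_real (ln (of_nat n)))"
      by (simp add: distrib_right exp_add)
    also have "\<dots> = ?E \<gamma> n * ?E \<delta> n"
      unfolding assms(3) by (simp add: distrib_right exp_add)
    finally have E: "?E \<alpha> n * ?E \<beta> n = ?E \<gamma> n * ?E \<delta> n" .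
    have nz: "?E \<gamma> n * ?E \<delta> n \<noteq> 0" by simp
    have "(a / e1) * (b / e2) / ((c / e3) * (d / e4)) = (a * b / (c * d)) * ((e3 * e4) / (e1 * e2))" for a b c d e1 e2 e3 e4 :: complex
      by (simp add: divide_simps)
    note this[of "pochhammer \<alpha> (Suc n)" "?E \<alpha> n" "pochhammer \<beta> (Suc n)" "?E \<beta> n" "pochhammer \<gamma> (Suc n)" "?E \<gamma> n" "pochhammer \<delta> (Suc n)" "?E \<delta> n"]
    then show ?thesis unfolding E divide_self[OF nz] mult_1_right .
  qed
  moreover have "rGamma \<alpha> * rGamma \<beta> / (rGamma \<gamma> * rGamma \<delta>) = Gamma \<gamma> * Gamma \<delta> * rGamma \<alpha> * rGamma \<beta>"
    by (simp add: Gamma_def divide_simps)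
  ultimately show "(\<lambda>n. pochhammer \<alpha> (Suc n) * pochhammer \<beta> (Suc n) / (pochhammer \<gamma> (Suc n) * pochhammer \<delta> (Suc n)))
     \<longlonglongrightarrow> Gamma \<gamma> * Gamma \<delta> * rGamma \<alpha> * rGamma \<beta>" by (simp only:)
qed

section \<open>Term recurrence and Gauss's theorem, by contiguity in c\<close>

lemma hyp3F2_term_Suc:
  assumes "c \<notin> \<int>\<^sub>\<le>\<^sub>0" "g \<notin> \<int>\<^sub>\<le>\<^sub>0"
  shows "(of_nat m + 1) * (c + of_nat m) * (g + of_nat m) * hyp3F2_term a b e c g (Suc m)
    = (a + of_nat m) * (b + of_nat m) * (e + of_nat m) * hyp3F2_term a b e c g m"
proof -
  have nz: "of_nat m + 1 \<noteq> (0::complex)" using of_nat_neq_0[of m, where 'a=complex] by (simp add: add.commute)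
  have f: "fact (Suc m) = (of_nat m + 1) * (fact m :: complex)" by (simp add: algebra_simps)
  have "x * y * z * (pa * A * (pb * B) * (pe * E) / (pc * y * (pg * z) * (x * f))) = A * B * E * (pa * pb * pe / (pc * pg * f))"
    if "x \<noteq> 0" "y \<noteq> 0" "z \<noteq> 0" for x y z pa A pb B pe E pc pg f :: complex
    using that by (simp add: divide_simps)
  then show ?thesis
    unfolding hyp3F2_term_def pochhammer_Suc f
    using nz assms[THEN add_of_nat_notin_nonpos_Ints(2), of m] by blast
qed

lemma hyp3F2_term_0 [simp]: "hyp3F2_term a b e c g 0 = 1"
  by (simp add: hyp3F2_term_def)

text \<open>The terms of the series with c + 1 are rational multiples of those with c, and the
  combination in question is a difference of consecutive values of c n u_n.\<close>

lemma gauss_contiguous: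
  fixes a b c :: complex
  assumes c: "c \<notin> \<int>\<^sub>\<le>\<^sub>0" and pos: "Re (c - a - b) > 0"
  shows "(c - a) * (c - b) * (\<Sum>m. hyp3F2_term a b 1 (c + 1) 1 m)
    = c * (c - a - b) * (\<Sum>m. hyp3F2_term a b 1 c 1 m)"
proof -
  let ?u = "hyp3F2_term a b 1 c 1" and ?v = "hyp3F2_term a b 1 (c + 1) 1"
  have c1: "c + 1 \<notin> \<int>\<^sub>\<le>\<^sub>0" using add_of_nat_notin_nonpos_Ints(1)[OF c, of 1] by simp
  have one: "(1::complex) \<notin> \<int>\<^sub>\<le>\<^sub>0" by simp
  have v: "(c + of_nat m) * ?v m = c * ?u m" for m
  proof -
    have "c * pochhammer (c + 1) m = pochhammer c m * (c + of_nat m)"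
      by (metis pochhammer_Suc pochhammer_rec)
    moreover have "pochhammer c m \<noteq> 0" "pochhammer (c + 1) m \<noteq> 0" using c c1 add_of_nat_notin_nonpos_Ints(3) by blast+
    ultimately show ?thesis unfolding hyp3F2_term_def by (simp add: divide_simps pochhammer_fact[symmetric])
  qed
  \<comment> \<open>A closed form for the partial sums; it tends to 0 because n times the n-th term
    does.\<close>
  have tele: "(\<Sum>m<n. (c - a) * (c - b) * ?v m - c * (c - a - b) * ?u m) = c * (of_nat n * ?u n)" for n
  proof (induction n)
    case (Suc n)
    have cn: "c + of_nat n \<noteq> 0" using add_of_nat_notin_nonpos_Ints(2)[OF c] .
    have n1: "1 + of_nat n \<noteq> (0::complex)" using of_nat_neq_0[of n, where 'a=complex] by simp
    have u: "(c + of_nat n) * (of_nat (Suc n) * ?u (Suc n)) = (a + of_nat n) * (b + of_nat n) * ?u n"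
      using hyp3F2_term_Suc[OF c one, of n a b 1] n1 by (simp add: add.commute mult_ac)
    have "(c + of_nat n) * (c * (of_nat n * ?u n) + ((c - a) * (c - b) * ?v n - c * (c - a - b) * ?u n))
       = (c + of_nat n) * (c * (of_nat n * ?u n)) + (c - a) * (c - b) * ((c + of_nat n) * ?v n) - (c + of_nat n) * (c * (c - a - b) * ?u n)"
      by (simp add: algebra_simps)
    also have "\<dots> = c * ((a + of_nat n) * (b + of_nat n) * ?u n)"
      unfolding v by (simp add: algebra_simps)
    also have "\<dots> = (c + of_nat n) * (c * (of_nat (Suc n) * ?u (Suc n)))"
      unfolding u[symmetric] by (simp only: mult_ac)
    finally show ?case using cn Suc by (simp del: of_nat_Suc)
  qed simp
  have s1: "summable ?u" and s2: "summable ?v"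
    by (rule summable_norm_cancel[OF summable_norm_hyp3F2_term], use c c1 pos in auto)+
  have "(\<lambda>m. (c - a) * (c - b) * ?v m - c * (c - a - b) * ?u m) sums
      ((c - a) * (c - b) * (\<Sum>m. ?v m) - c * (c - a - b) * (\<Sum>m. ?u m))"
    using s1 s2 by (intro sums_diff sums_mult summable_sums)
  moreover have "(\<lambda>m. (c - a) * (c - b) * ?v m - c * (c - a - b) * ?u m) sums 0"
    unfolding sums_def tele
    by (intro tendsto_mult_right_zero hyp3F2_term_times_of_nat_tendsto_0) (use c pos in auto)
  ultimately show ?thesis using sums_unique2 by fastforce
qed

lemma of_nat_quotient_tendsto_1:
  fixes u v :: "'a::real_normed_field"
  shows "(\<lambda>n. (u + of_nat n) / (v + of_nat n)) \<longlonglongrightarrow> 1"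
proof -
  have inf: "filterlim (\<lambda>n. v + of_nat n) at_infinity sequentially"
    by (intro tendsto_add_filterlim_at_infinity[OF tendsto_const] tendsto_of_nat)
  then have "(\<lambda>n. 1 + (u - v) / (v + of_nat n)) \<longlonglongrightarrow> 1 + 0"
    by (intro tendsto_intros tendsto_divide_0[OF tendsto_const])
  moreover have "eventually (\<lambda>n. 1 + (u - v) / (v + of_nat n) = (u + of_nat n) / (v + of_nat n)) sequentially"
    using filterlim_at_infinity_imp_eventually_ne[OF inf, of 0]
    by eventually_elim (simp add: divide_simps)
  ultimately show ?thesis using Lim_transform_eventually by fastforce
qed

lemma norm_pochhammer_le:
  fixes z :: complex
  assumes "Re z > 0"
  shows "norm (pochhammer z m) \<le> pochhammer (Re z + \<bar>Im z\<bar>) m"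
    "pochhammer (Re z) m \<le> norm (pochhammer z m)"
proof -
  show "norm (pochhammer z m) \<le> pochhammer (Re z + \<bar>Im z\<bar>) m"
  proof (induction m)
    case (Suc m)
    have "norm (z + of_nat m) \<le> Re z + \<bar>Im z\<bar> + real m"
      using cmod_le[of "z + of_nat m"] assms by simp
    then show ?case using Suc assms
      by (simp add: pochhammer_Suc norm_mult) (intro mult_mono, auto intro!: pochhammer_nonneg add_nonneg_nonneg)
  qed simp
  show "pochhammer (Re z) m \<le> norm (pochhammer z m)"
  proof (induction m)
    case (Suc m)
    have "Re z + real m \<le> norm (z + of_nat m)"
      using complex_Re_le_cmod[of "z + of_nat m"] by simp
    then show ?case using Suc assms
      by (simp add: pochhammer_Suc norm_mult) (intro mult_mono, auto intro!: pochhammer_nonneg add_nonneg_nonneg)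
  qed simp
qed

text \<open>All terms with m > 0 have a factor (c+n)_m in the denominator, whose modulus tends to
  infinity. Tannery's theorem applies with the series whose lower parameter is the real number R as
  majorant.\<close>

lemma gauss_limit:
  fixes a b c :: complex
  shows "(\<lambda>n. \<Sum>m. hyp3F2_term a b 1 (c + of_nat n) 1 m) \<longlonglongrightarrow> 1"
proof -
  \<comment> \<open>N is large enough that R > 0 and R > Re a + Re b, which is the convergence
    condition of the majorant.\<close>
  obtain N where N: "real N > \<bar>Re c\<bar> + \<bar>Re a + Re b\<bar> + 1" using reals_Archimedean2 by blast
  define R where "R = Re c + real N"
  have R: "R > 0" "R > Re a + Re b" using N by (auto simp: R_def)
  have "((\<lambda>n. suminf (\<lambda>m. hyp3F2_term a b 1 (c + of_nat n) 1 m)) \<longlongrightarrow> suminf (\<lambda>m::nat. if m = 0 then 1 else 0)) sequentially"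
  proof (rule tannerys_theorem[THEN conjunct2, THEN conjunct2])
    show "summable (\<lambda>m. norm (hyp3F2_term a b 1 (of_real R) 1 m))"
      by (rule summable_norm_hyp3F2_term) (use R in \<open>auto intro!: Re_pos_notin_nonpos_Ints\<close>)
    show "eventually (\<lambda>(m, n). norm (hyp3F2_term a b 1 (c + of_nat n) 1 m) \<le> norm (hyp3F2_term a b 1 (of_real R) 1 m)) (at_top \<times>\<^sub>F sequentially)"
    proof (rule eventually_mono[OF eventually_prodI[of "\<lambda>_. True" at_top "\<lambda>n. n \<ge> N" sequentially]], goal_cases)
      case (3 x)
      obtain m n where x: "x = (m, n)" by (cases x)
      have n: "n \<ge> N" using 3 by (simp add: x)
      have "R \<le> Re (c + of_nat n)" using n by (simp add: R_def)
      then have "pochhammer R m \<le> pochhammer (Re (c + of_nat n)) m"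
        unfolding pochhammer_prod using R by (intro prod_mono) auto
      also have "\<dots> \<le> norm (pochhammer (c + of_nat n) m)"
        by (rule norm_pochhammer_le) (use R \<open>R \<le> _\<close> in linarith)
      finally have "pochhammer R m \<le> norm (pochhammer (c + of_nat n) m)" .
      moreover have "norm (pochhammer (of_real R :: complex) m) = pochhammer R m"
        unfolding pochhammer_of_real using pochhammer_pos[OF R(1), of m] by simp
      moreover have "pochhammer R m > 0" by (rule pochhammer_pos) (rule R)
      moreover have "norm (pochhammer (c + of_nat n) m) > 0" using calculation by linarith
      ultimately show ?case
        unfolding hyp3F2_term_def norm_mult norm_divide prod.case x
        by (intro divide_left_mono mult_right_mono) (auto intro!: mult_nonneg_nonneg simp: mult_pos_pos pochhammer_fact[symmetric])
    qed (auto simp: eventually_ge_at_top)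
    show "((\<lambda>n. hyp3F2_term a b 1 (c + of_nat n) 1 m) \<longlongrightarrow> (if m = 0 then 1 else 0)) sequentially" for m
    proof (cases m)
      case (Suc m')
      have "filterlim (\<lambda>n. pochhammer (c + of_nat n) m) at_infinity sequentially"
      proof -
        have inf: "filterlim (\<lambda>n. c + of_nat n + of_nat k :: complex) at_infinity sequentially" for k
          using tendsto_add_filterlim_at_infinity[OF tendsto_const[of "c + of_nat k"] tendsto_of_nat]
          by (simp add: add_ac)
        have "filterlim (\<lambda>n. pochhammer (c + of_nat n) (Suc m')) at_infinity sequentially"
        proof (induction m')
          case 0
          then show ?case using inf[of 0] by simp
        next
          case (Suc k)
          then show ?case unfolding pochhammer_Suc[of _ "Suc k"]
            by (rule filterlim_at_infinity_times[OF _ inf])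
        qed
        then show ?thesis by (simp add: Suc)
      qed
      then have "(\<lambda>n. (pochhammer a m * pochhammer b m * pochhammer 1 m / (pochhammer 1 m * fact m)) / pochhammer (c + of_nat n) m) \<longlonglongrightarrow> 0"
        by (rule tendsto_divide_0[OF tendsto_const])
      then show ?thesis by (simp add: hyp3F2_term_def Suc mult_ac pochhammer_fact[symmetric] del: fact_Suc)
    qed simp
  qed simp
  also have "suminf (\<lambda>m::nat. if m = 0 then 1 else 0) = (1::complex)"
    using sums_If_finite[of "\<lambda>m. m = 0" "\<lambda>_. 1::complex"] by (simp add: sums_iff)
  finally show ?thesis .
qed

text \<open>Solving the recurrence for \<open>X n\<close> expresses \<open>X 0\<close> by
  \<open>X n\<close> and a Pochhammer quotient with a known limit. Only \<gamma> and \<delta> are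
  divided by, so \<alpha> and \<beta> are unrestricted; in that direction the quotient may well be
  0.\<close>

lemma recurrence_limit:
  fixes X :: "nat \<Rightarrow> complex"
  assumes rec: "\<And>n. (\<alpha> + of_nat n) * (\<beta> + of_nat n) * X (Suc n) = (\<gamma> + of_nat n) * (\<delta> + of_nat n) * X n"
    and \<gamma>: "\<gamma> \<notin> \<int>\<^sub>\<le>\<^sub>0" and \<delta>: "\<delta> \<notin> \<int>\<^sub>\<le>\<^sub>0" and sum: "\<alpha> + \<beta> = \<gamma> + \<delta>" and lim: "X \<longlonglongrightarrow> L"
  shows "X 0 = L * (Gamma \<gamma> * Gamma \<delta> * rGamma \<alpha> * rGamma \<beta>)"
proof -
  have X0: "X 0 = X n * (pochhammer \<alpha> n * pochhammer \<beta> n / (pochhammer \<gamma> n * pochhammer \<delta> n))" for n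
  proof (induction n)
    case (Suc n)
    have nz: "\<gamma> + of_nat n \<noteq> 0" "\<delta> + of_nat n \<noteq> 0"
      using add_of_nat_notin_nonpos_Ints(2)[OF \<gamma>] add_of_nat_notin_nonpos_Ints(2)[OF \<delta>] by blast+
    have "X n = (\<alpha> + of_nat n) * (\<beta> + of_nat n) * X (Suc n) / ((\<gamma> + of_nat n) * (\<delta> + of_nat n))"
      unfolding rec using nz by simp
    then show ?case using Suc by (simp add: pochhammer_Suc mult_ac)
  qed simp
  have "(\<lambda>n. X n * (pochhammer \<alpha> n * pochhammer \<beta> n / (pochhammer \<gamma> n * pochhammer \<delta> n))) \<longlonglongrightarrow> L * (Gamma \<gamma> * Gamma \<delta> * rGamma \<alpha> * rGamma \<beta>)"
    by (intro tendsto_mult lim pochhammer_quotient_limit \<gamma> \<delta> sum)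
  then have "(\<lambda>n::nat. X 0) \<longlonglongrightarrow> L * (Gamma \<gamma> * Gamma \<delta> * rGamma \<alpha> * rGamma \<beta>)"
    by (simp only: X0[symmetric])
  then show ?thesis by (simp add: LIMSEQ_const_iff)
qed

theorem gauss_sum:
  fixes a b c :: complex
  assumes c: "c \<notin> \<int>\<^sub>\<le>\<^sub>0" and pos: "Re (c - a - b) > 0"
  shows "(\<Sum>m. hyp3F2_term a b 1 c 1 m) = Gamma c * Gamma (c - a - b) * rGamma (c - a) * rGamma (c - b)"
proof -
  have "(\<Sum>m. hyp3F2_term a b 1 (c + of_nat 0) 1 m) = 1 * (Gamma c * Gamma (c - a - b) * rGamma (c - a) * rGamma (c - b))"
  proof (rule recurrence_limit[of "c - a" "c - b" "\<lambda>n. \<Sum>m. hyp3F2_term a b 1 (c + of_nat n) 1 m"])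
    fix n
    show "(c - a + of_nat n) * (c - b + of_nat n) * (\<Sum>m. hyp3F2_term a b 1 (c + of_nat (Suc n)) 1 m)
      = (c + of_nat n) * (c - a - b + of_nat n) * (\<Sum>m. hyp3F2_term a b 1 (c + of_nat n) 1 m)"
    proof -
      have e: "c - a + of_nat n = c + of_nat n - a" "c - b + of_nat n = c + of_nat n - b"
        "c - a - b + of_nat n = c + of_nat n - a - b" "c + of_nat (Suc n) = c + of_nat n + 1" by simp_all
      show ?thesis unfolding e
        by (rule gauss_contiguous) (use add_of_nat_notin_nonpos_Ints(1)[OF c] pos in auto)
    qed
  qed (use c pos Re_pos_notin_nonpos_Ints gauss_limit in auto)
  then show ?thesis by simp
qed

section \<open>Watson's theorem, by contiguity in the middle parameter e\<close>

definition watson_sum :: "complex \<Rightarrow> complex \<Rightarrow> complex \<Rightarrow> complex" where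
  "watson_sum a b e = (\<Sum>m. hyp3F2_term a b e ((a + b + 1) / 2) (2 * e) m)"

text \<open>Raising e by 1 raises the lower parameter 2e by 2, so the new terms are rational
  multiples of the old ones. The relation 2c = a + b + 1 is what makes the combination
  telescope.\<close>

lemma watson_contiguous:
  fixes a b e :: complex
  assumes c: "(a + b + 1) / 2 \<notin> \<int>\<^sub>\<le>\<^sub>0" and e: "2 * e \<notin> \<int>\<^sub>\<le>\<^sub>0" and pos: "Re (2 * e - a - b) > - 1"
  shows "(e + (1 - a) / 2) * (e + (1 - b) / 2) * watson_sum a b (e + 1)
    = (e + 1 / 2) * (e + (1 - a - b) / 2) * watson_sum a b e"
proof -
  define c where "c = (a + b + 1) / 2"
  let ?u = "hyp3F2_term a b e c (2 * e)" and ?v = "hyp3F2_term a b (e + 1) c (2 * e + 2)"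
  let ?L = "(e + (1 - a) / 2) * (e + (1 - b) / 2)" and ?R = "(e + 1 / 2) * (e + (1 - a - b) / 2)"
  have cn: "c \<notin> \<int>\<^sub>\<le>\<^sub>0" using c by (simp add: c_def)
  have e2: "2 * e + 2 \<notin> \<int>\<^sub>\<le>\<^sub>0" using add_of_nat_notin_nonpos_Ints(1)[OF e, of 2] by simp
  have e0: "e \<noteq> 0" using e by auto
  have v: "(2 * e + of_nat m) * (2 * e + of_nat m + 1) * ?v m = 2 * (2 * e + 1) * (e + of_nat m) * ?u m" for m
  proof -
    have 1: "e * pochhammer (e + 1) m = pochhammer e m * (e + of_nat m)"
      by (metis pochhammer_Suc pochhammer_rec)
    have 2: "2 * e * (2 * e + 1) * pochhammer (2 * e + 2) m = pochhammer (2 * e) m * (2 * e + of_nat m) * (2 * e + of_nat m + 1)"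
    proof -
      have "2 * e * (2 * e + 1) * pochhammer (2 * e + 2) m = pochhammer (2 * e) (Suc (Suc m))"
        by (simp add: pochhammer_rec add_ac mult_ac)
      then show ?thesis by (simp add: pochhammer_Suc add_ac mult_ac)
    qed
    have p: "pochhammer (2 * e) m \<noteq> 0" "pochhammer (2 * e + 2) m \<noteq> 0"
      using e e2 add_of_nat_notin_nonpos_Ints(3) by blast+
    have "e * (pochhammer (2 * e) m * (2 * e + of_nat m) * (2 * e + of_nat m + 1) * pochhammer (e + 1) m)
        = e * (2 * (2 * e + 1) * (e + of_nat m) * pochhammer e m * pochhammer (2 * e + 2) m)"
    proof -
      have "e * (pochhammer (2 * e) m * (2 * e + of_nat m) * (2 * e + of_nat m + 1) * pochhammer (e + 1) m)
        = (pochhammer (2 * e) m * (2 * e + of_nat m) * (2 * e + of_nat m + 1)) * (e * pochhammer (e + 1) m)" by (simp only: mult_ac)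
      also have "\<dots> = e * (2 * (2 * e + 1) * (e + of_nat m) * pochhammer e m * pochhammer (2 * e + 2) m)"
        unfolding 1 2[symmetric] by (simp only: mult_ac)
      finally show ?thesis .
    qed
    then have K: "pochhammer (2 * e) m * (2 * e + of_nat m) * (2 * e + of_nat m + 1) * pochhammer (e + 1) m
        = 2 * (2 * e + 1) * (e + of_nat m) * pochhammer e m * pochhammer (2 * e + 2) m" using e0 by simp
    have "A * B * (pa * pb * E1 / (pc * G2 * F)) = C * (pa * pb * E0 / (pc * G0 * F))"
      if "G0 * A * B * E1 = C * E0 * G2" "G0 \<noteq> 0" "G2 \<noteq> 0" for A B C pa pb E1 E0 pc G2 G0 F :: complex
    proof -
      have "A * B * E1 / G2 = C * E0 / G0" using that by (simp add: divide_simps mult_ac)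
      then have "(A * B * E1 / G2) * (pa * pb / (pc * F)) = (C * E0 / G0) * (pa * pb / (pc * F))" by simp
      then show ?thesis by (simp add: mult_ac)
    qed
    from this[OF K p] show ?thesis unfolding hyp3F2_term_def .
  qed
  \<comment> \<open>The rational factor (c+n-1)/(2e+n) tends to 1, so convergence of these sums to 0
    again rests on n times the n-th term.\<close>
  have tele: "(\<Sum>m<n. ?L * ?v m - ?R * ?u m) = (2 * e + 1) / 2 * ((c + of_nat n - 1) / (2 * e + of_nat n) * (of_nat n * ?u n))" for n
  proof (induction n)
    case (Suc n)
    define N where "N = (of_nat n :: complex)"
    define U where "U = ?u n"
    have en: "2 * e + N \<noteq> 0" "2 * e + N + 1 \<noteq> 0" "c + N \<noteq> 0" "N + 1 \<noteq> 0"
      using add_of_nat_notin_nonpos_Ints(2)[OF e, of n] add_of_nat_notin_nonpos_Ints(2)[OF e, of "Suc n"] add_of_nat_notin_nonpos_Ints(2)[OF cn, of n]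
        of_nat_neq_0[of n, where 'a=complex]
      by (auto simp: N_def add_ac)
    have u: "(N + 1) * ?u (Suc n) = (a + N) * (b + N) * (e + N) * U / ((c + N) * (2 * e + N))"
      using hyp3F2_term_Suc[OF cn e, of n a b e] en unfolding N_def[symmetric] U_def[symmetric] by (simp add: divide_simps mult_ac)
    have v': "?v n = 2 * (2 * e + 1) * (e + N) * U / ((2 * e + N) * (2 * e + N + 1))"
      using v[of n] en unfolding N_def[symmetric] U_def[symmetric] by (simp add: divide_simps mult_ac)
    have ab: "b = 2 * c - a - 1" by (simp add: c_def field_simps)
    have poly: "(2 * e + 1) * (c + N - 1) * N * (2 * e + N + 1) + (2 * ?L * (2 * (2 * e + 1) * (e + N)) - 2 * ?R * ((2 * e + N) * (2 * e + N + 1)))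
       = (2 * e + 1) * ((a + N) * (b + N) * (e + N))"
      unfolding ab by (simp add: field_simps)
    have "(2 * e + 1) / 2 * ((c + N - 1) / (2 * e + N) * (N * U)) + (?L * ?v n - ?R * U)
      = ((2 * e + 1) * (c + N - 1) * N * (2 * e + N + 1) + (2 * ?L * (2 * (2 * e + 1) * (e + N)) - 2 * ?R * ((2 * e + N) * (2 * e + N + 1)))) * (U / (2 * ((2 * e + N) * (2 * e + N + 1))))"
    proof -
      have "D / 2 * (E / p * (N * U)) + (L * (T * U / (p * q)) - R * U) = (D * E * N * q + (2 * L * T - 2 * R * (p * q))) * (U / (2 * (p * q)))"
        if "p \<noteq> 0" "q \<noteq> 0" for D E L T R p q :: complex using that by (simp add: divide_simps) (simp add: algebra_simps)
      from this[OF en(1,2)] show ?thesis unfolding v' .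
    qed
    also have "\<dots> = (2 * e + 1) / 2 * ((c + N) / (2 * e + N + 1) * ((N + 1) * ?u (Suc n)))"
      unfolding poly u using en by (simp add: divide_simps)
    finally have F: "(2 * e + 1) / 2 * ((c + N - 1) / (2 * e + N) * (N * U)) + (?L * ?v n - ?R * U)
      = (2 * e + 1) / 2 * ((c + N) / (2 * e + N + 1) * ((N + 1) * ?u (Suc n)))" .
    have eqs: "c + of_nat (Suc n) - 1 = c + of_nat n" "2 * e + of_nat (Suc n) = 2 * e + of_nat n + 1" by simp_all
    have eq: "of_nat (Suc n) = of_nat n + (1::complex)" by simp
    show ?case unfolding sum.lessThan_Suc Suc unfolding eqs unfolding eq
      by (fact F[unfolded N_def U_def])
  qed simp
  have p1: "Re (c + 2 * e - a - b - e) > 0" and p2: "Re (c + (2 * e + 2) - a - b - (e + 1)) > 0"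
    using pos by (simp_all add: c_def field_simps)
  have s1: "summable ?u" and s2: "summable ?v"
    using summable_norm_cancel[OF summable_norm_hyp3F2_term[OF cn e p1]] summable_norm_cancel[OF summable_norm_hyp3F2_term[OF cn e2 p2]]
    by blast+
  have "(\<lambda>m. ?L * ?v m - ?R * ?u m) sums (?L * (\<Sum>m. ?v m) - ?R * (\<Sum>m. ?u m))"
    using s1 s2 by (intro sums_diff sums_mult summable_sums)
  moreover have "(\<lambda>m. ?L * ?v m - ?R * ?u m) sums 0"
    unfolding sums_def tele
  proof (intro tendsto_mult_right_zero)
    have "(\<lambda>n. (c - 1 + of_nat n) / (2 * e + of_nat n) * (of_nat n * ?u n)) \<longlonglongrightarrow> 1 * 0"
      by (intro tendsto_mult of_nat_quotient_tendsto_1 hyp3F2_term_times_of_nat_tendsto_0[OF cn e p1])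
    moreover have "c - 1 + of_nat n = c + of_nat n - 1" for n by simp
    ultimately show "(\<lambda>n. (c + of_nat n - 1) / (2 * e + of_nat n) * (of_nat n * ?u n)) \<longlonglongrightarrow> 0"
      by (simp only: mult_zero_right)
  qed
  ultimately have "?L * (\<Sum>m. ?v m) = ?R * (\<Sum>m. ?u m)" using sums_unique2 by fastforce
  moreover have "(a + b + 1) / 2 = c" "2 * (e + 1) = 2 * e + 2" by (simp_all add: c_def)
  ultimately show ?thesis unfolding watson_sum_def by (simp only:)
qed

text \<open>As \<open>e\<close> tends to infinity, Watson's series tends to the series of Gauss's second theorem,
  a \<open>\<^sub>2F\<^sub>1\<close> at \<open>1/2\<close>.\<close>

definition half_term :: "complex \<Rightarrow> complex \<Rightarrow> complex \<Rightarrow> nat \<Rightarrow> complex" where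
  "half_term a b c m = pochhammer a m * pochhammer b m / (pochhammer c m * fact m) * (1 / 2) ^ m"

text \<open>Tannery's theorem in e. The modulus of (e+n)_m / (2(e+n))_m is at most (S+I)_m / (2S)_m,
  where S is the real part and I the modulus of the imaginary part of e+n; this decreases in S, so
  the value at S = R dominates. Summability of the limit series comes with it.\<close>

lemma
  assumes c: "c \<notin> \<int>\<^sub>\<le>\<^sub>0"
  shows watson_limit: "(\<lambda>n. \<Sum>m. hyp3F2_term a b (e + of_nat n) c (2 * (e + of_nat n)) m) \<longlonglongrightarrow> (\<Sum>m. half_term a b c m)"
    and summable_norm_half_term: "summable (\<lambda>m. norm (half_term a b c m))"
proof -
  \<comment> \<open>The size of N makes R positive and gives the majorant, with e replaced by R + I
    and 2e by 2R, a positive parametric excess.\<close>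
  obtain N where N: "real N > \<bar>Re e\<bar> + \<bar>Re c\<bar> + \<bar>Re a + Re b\<bar> + \<bar>Im e\<bar> + 1" using reals_Archimedean2 by blast
  define R where "R = Re e + real N"
  define I where "I = \<bar>Im e\<bar>"
  have I: "I \<ge> 0" by (simp add: I_def)
  have R: "R > 0" "Re c + 2 * R - Re a - Re b - (R + I) > 0" using N by (auto simp: R_def I_def)
  let ?M = "hyp3F2_term a b (of_real (R + I)) c (of_real (2 * R))"
  have *: "eventually (\<lambda>n. summable (\<lambda>m. norm (hyp3F2_term a b (e + of_nat n) c (2 * (e + of_nat n)) m))) sequentially \<and>
     summable (\<lambda>m. norm (half_term a b c m)) \<and>
     (\<lambda>n. suminf (\<lambda>m. hyp3F2_term a b (e + of_nat n) c (2 * (e + of_nat n)) m)) \<longlonglongrightarrow> suminf (half_term a b c)"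
  proof (rule tannerys_theorem)
    show "summable (\<lambda>m. norm (?M m))"
      by (rule summable_norm_hyp3F2_term) (use R c in \<open>auto intro!: Re_pos_notin_nonpos_Ints\<close>)
    show "eventually (\<lambda>(m, n). norm (hyp3F2_term a b (e + of_nat n) c (2 * (e + of_nat n)) m) \<le> norm (?M m)) (at_top \<times>\<^sub>F sequentially)"
    proof (rule eventually_mono[OF eventually_prodI[of "\<lambda>_. True" at_top "\<lambda>n. n \<ge> N" sequentially]], goal_cases)
      case (3 x)
      obtain m n where x: "x = (m, n)" by (cases x)
      have n: "n \<ge> N" using 3 by (simp add: x)
      define S where "S = Re (e + of_nat n)"
      have S: "R \<le> S" using n by (simp add: R_def S_def)
      have Im: "\<bar>Im (e + of_nat n)\<bar> = I" by (simp add: I_def)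
      have 1: "norm (pochhammer (e + of_nat n) m) \<le> pochhammer (S + I) m"
        using norm_pochhammer_le(1)[of "e + of_nat n" m] S R unfolding Im S_def by simp
      have 2: "pochhammer (2 * S) m \<le> norm (pochhammer (2 * (e + of_nat n)) m)"
        using norm_pochhammer_le(2)[of "2 * (e + of_nat n)" m] S R unfolding S_def by simp
      have p2: "pochhammer (2 * S) m > 0" "pochhammer (2 * R) m > 0" "pochhammer (S + I) m > 0" "pochhammer (R + I) m > 0"
        using S R I by (auto intro!: pochhammer_pos)
      \<comment> \<open>Monotonicity in S with denominators cleared; each factor contributes the
        nonnegative difference (S-R)(m+2I).\<close>
      have 3: "pochhammer (S + I) m * pochhammer (2 * R) m \<le> pochhammer (R + I) m * pochhammer (2 * S) m"
      proof (induction m)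
        case (Suc m)
        have "(R + I + real m) * (2 * S + real m) - (S + I + real m) * (2 * R + real m) = (S - R) * (real m + 2 * I)"
          by (simp add: algebra_simps)
        also have "\<dots> \<ge> 0" using S I by simp
        finally have "(S + I + real m) * (2 * R + real m) \<le> (R + I + real m) * (2 * S + real m)" by simp
        then have "(pochhammer (S + I) m * pochhammer (2 * R) m) * ((S + I + real m) * (2 * R + real m))
            \<le> (pochhammer (R + I) m * pochhammer (2 * S) m) * ((R + I + real m) * (2 * S + real m))"
          by (rule mult_mono[OF Suc]) (use S R I in \<open>auto intro!: mult_nonneg_nonneg pochhammer_nonneg\<close>)
        then show ?case by (simp add: pochhammer_Suc mult_ac)
      qed simp
      have "norm (pochhammer (e + of_nat n) m) / norm (pochhammer (2 * (e + of_nat n)) m) \<le> pochhammer (S + I) m / pochhammer (2 * S) m"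
        using 1 2 p2 by (intro frac_le) auto
      also have "\<dots> \<le> pochhammer (R + I) m / pochhammer (2 * R) m"
        using 3 p2 by (simp add: divide_simps mult_ac)
      also have "\<dots> = norm (pochhammer (of_real (R + I) :: complex) m) / norm (pochhammer (of_real (2 * R) :: complex) m)"
        unfolding pochhammer_of_real using p2 by simp
      finally have "norm (pochhammer a m * pochhammer b m / (pochhammer c m * fact m)) * (norm (pochhammer (e + of_nat n) m) / norm (pochhammer (2 * (e + of_nat n)) m))
         \<le> norm (pochhammer a m * pochhammer b m / (pochhammer c m * fact m)) * (norm (pochhammer (of_real (R + I) :: complex) m) / norm (pochhammer (of_real (2 * R) :: complex) m))"
        by (rule mult_left_mono) simp
      then show ?case unfolding hyp3F2_term_def x prod.case by (simp add: norm_mult norm_divide mult_ac)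
    qed (auto simp: eventually_ge_at_top)
    show "(\<lambda>n. hyp3F2_term a b (e + of_nat n) c (2 * (e + of_nat n)) m) \<longlonglongrightarrow> half_term a b c m" for m
    proof -
      have "(\<lambda>n. pochhammer (e + of_nat n) m / pochhammer (2 * (e + of_nat n)) m) \<longlonglongrightarrow> (1 / 2) ^ m"
      proof (induction m)
        case (Suc m)
        have "(\<lambda>n. pochhammer (e + of_nat n) m / pochhammer (2 * (e + of_nat n)) m * (1 / 2 * ((e + of_nat m + of_nat n) / (e + of_nat m / 2 + of_nat n)))) \<longlonglongrightarrow> (1 / 2) ^ m * (1 / 2 * 1)"
          by (intro tendsto_mult Suc tendsto_const of_nat_quotient_tendsto_1)
        moreover have D: "1 / 2 * ((e + of_nat m + of_nat n) / (e + of_nat m / 2 + of_nat n)) = (e + of_nat n + of_nat m) / (2 * (e + of_nat n) + of_nat m)" for n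
        proof -
          have "2 * (e + of_nat n) + of_nat m = 2 * (e + of_nat m / 2 + of_nat n)" by (simp add: algebra_simps)
          then show ?thesis by (simp only: add_ac) simp
        qed
        moreover have "pochhammer (e + of_nat n) (Suc m) / pochhammer (2 * (e + of_nat n)) (Suc m)
           = pochhammer (e + of_nat n) m / pochhammer (2 * (e + of_nat n)) m * ((e + of_nat n + of_nat m) / (2 * (e + of_nat n) + of_nat m))" for n
          unfolding pochhammer_Suc by simp
        ultimately show ?case by (simp only: D power_Suc2) simp
      qed simp
      then have "(\<lambda>n. pochhammer a m * pochhammer b m / (pochhammer c m * fact m) * (pochhammer (e + of_nat n) m / pochhammer (2 * (e + of_nat n)) m)) \<longlonglongrightarrow> half_term a b c m"
        unfolding half_term_def by (intro tendsto_mult tendsto_const)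
      then show ?thesis by (simp add: hyp3F2_term_def mult_ac)
    qed
  qed simp
  show "(\<lambda>n. \<Sum>m. hyp3F2_term a b (e + of_nat n) c (2 * (e + of_nat n)) m) \<longlonglongrightarrow> (\<Sum>m. half_term a b c m)"
    and "summable (\<lambda>m. norm (half_term a b c m))" using * by blast+
qed

text \<open>Iterating the contiguous relation carries e to infinity, where Watson's series becomes
  the series at 1/2. Thus its dependence on e is explicit, and only the value at 1/2 remains
  unknown.\<close>

lemma watson_sum_half:
  assumes c: "(a + b + 1) / 2 \<notin> \<int>\<^sub>\<le>\<^sub>0" and e: "2 * e \<notin> \<int>\<^sub>\<le>\<^sub>0" and pos: "Re (2 * e - a - b) > - 1"
  shows "watson_sum a b e = (\<Sum>m. half_term a b ((a + b + 1) / 2) m) *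
    (Gamma (e + 1 / 2) * Gamma (e + (1 - a - b) / 2) * rGamma (e + (1 - a) / 2) * rGamma (e + (1 - b) / 2))"
proof -
  have "watson_sum a b (e + of_nat 0) = (\<Sum>m. half_term a b ((a + b + 1) / 2) m) *
    (Gamma (e + 1 / 2) * Gamma (e + (1 - a - b) / 2) * rGamma (e + (1 - a) / 2) * rGamma (e + (1 - b) / 2))"
  proof (rule recurrence_limit)
    fix n
    have e2: "2 * (e + of_nat n) \<notin> \<int>\<^sub>\<le>\<^sub>0" using add_of_nat_notin_nonpos_Ints(1)[OF e, of "2 * n"] by (simp add: distrib_left)
    have eqs: "e + (1 - a) / 2 + of_nat n = e + of_nat n + (1 - a) / 2" "e + (1 - b) / 2 + of_nat n = e + of_nat n + (1 - b) / 2"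
      "e + 1 / 2 + of_nat n = e + of_nat n + 1 / 2" "e + (1 - a - b) / 2 + of_nat n = e + of_nat n + (1 - a - b) / 2"
      "e + of_nat (Suc n) = e + of_nat n + 1" by simp_all
    show "(e + (1 - a) / 2 + of_nat n) * (e + (1 - b) / 2 + of_nat n) * watson_sum a b (e + of_nat (Suc n))
      = (e + 1 / 2 + of_nat n) * (e + (1 - a - b) / 2 + of_nat n) * watson_sum a b (e + of_nat n)"
      unfolding eqs by (rule watson_contiguous[OF c e2]) (use pos in auto)
  next
    show "e + 1 / 2 \<notin> \<int>\<^sub>\<le>\<^sub>0"
    proof
      assume "e + 1 / 2 \<in> \<int>\<^sub>\<le>\<^sub>0"
      then obtain k where "e + 1 / 2 = - of_nat k" by (auto elim!: nonpos_Ints_cases')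
      then have "e = - of_nat k - 1 / 2" by (simp add: eq_diff_eq)
      then have "2 * e = - of_nat (2 * k + 1)" by simp
      then show False using e by (metis minus_of_nat_in_nonpos_Ints)
    qed
    show "e + (1 - a - b) / 2 \<notin> \<int>\<^sub>\<le>\<^sub>0"
      using pos by (intro Re_pos_notin_nonpos_Ints) (simp add: field_simps)
    show "e + (1 - a) / 2 + (e + (1 - b) / 2) = e + 1 / 2 + (e + (1 - a - b) / 2)"
      by (simp add: field_simps)
    show "(\<lambda>n. watson_sum a b (e + of_nat n)) \<longlonglongrightarrow> (\<Sum>m. half_term a b ((a + b + 1) / 2) m)"
      unfolding watson_sum_def by (rule watson_limit[OF c])
  qed
  then show ?thesis by simp
qed

text \<open>Raising a by 2 raises c = (a+b+1)/2 by 1. The intermediate series with a + 1 and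
  unchanged c links both: its terms express those of either series and furnish the telescoping
  boundary term.\<close>

lemma half_sum_contiguous:
  assumes c: "(a + b + 1) / 2 \<notin> \<int>\<^sub>\<le>\<^sub>0"
  shows "(a + 1) * (\<Sum>m. half_term (a + 2) b ((a + b + 1) / 2 + 1) m) = (a + b + 1) * (\<Sum>m. half_term a b ((a + b + 1) / 2) m)"
proof -
  define c where "c = (a + b + 1) / 2"
  have cn: "c \<notin> \<int>\<^sub>\<le>\<^sub>0" using assms by (simp add: c_def)
  have c1: "c + 1 \<notin> \<int>\<^sub>\<le>\<^sub>0" using add_of_nat_notin_nonpos_Ints(1)[OF cn, of 1] by simp
  let ?v = "half_term (a + 2) b (c + 1)" and ?u = "half_term a b c" and ?e = "half_term (a + 1) b c"
  have nz: "c + of_nat m \<noteq> 0" "pochhammer c m \<noteq> 0" "pochhammer (c + 1) m \<noteq> 0" "of_nat m + 1 \<noteq> (0::complex)" for m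
    using add_of_nat_notin_nonpos_Ints[OF cn] add_of_nat_notin_nonpos_Ints[OF c1] of_nat_neq_0[of m, where 'a=complex] by (auto simp: add.commute)
  have v: "(a + 1) * ?v m = (a + 1 + of_nat m) * c * ?e m / (c + of_nat m)" for m
  proof -
    have p: "(a + 1) * pochhammer (a + 2) m = pochhammer (a + 1) m * (a + 1 + of_nat m)"
      using pochhammer_Suc[of "a + 1" m] pochhammer_rec[of "a + 1" m] by (simp add: add_ac)
    have q: "c / pochhammer c m = (c + of_nat m) / pochhammer (c + 1) m"
      using pochhammer_Suc[of c m] pochhammer_rec[of c m] nz[of m] by (simp add: frac_eq_eq mult_ac)
    have q': "1 / pochhammer (c + 1) m = c / pochhammer c m / (c + of_nat m)"
      unfolding q using nz[of m] by simp
    have "(a + 1) * ?v m = ((a + 1) * pochhammer (a + 2) m) * pochhammer b m * (1 / pochhammer (c + 1) m) / fact m * (1 / 2) ^ m"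
      unfolding half_term_def by simp
    also have "\<dots> = (a + 1 + of_nat m) * c * ?e m / (c + of_nat m)"
      unfolding p q' half_term_def by (simp add: mult_ac)
    finally show ?thesis .
  qed
  have u: "?u (Suc m) = ?e m * a * (b + of_nat m) / (2 * (c + of_nat m) * (of_nat m + 1))" for m
    unfolding half_term_def pochhammer_rec[of a] pochhammer_Suc[of b] pochhammer_Suc[of c] fact_Suc
    by (simp add: mult_ac add.commute)
  have e: "?e (Suc m) = ?e m * (a + 1 + of_nat m) * (b + of_nat m) / (2 * (c + of_nat m) * (of_nat m + 1))" for m
    unfolding half_term_def pochhammer_Suc fact_Suc
    by (simp add: mult_ac add.commute)
  have ab: "a = 2 * c - b - 1" by (simp add: c_def field_simps)
  \<comment> \<open>The sum has n + 1 terms because the terms of the second series are expressed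
    through the intermediate ones with index lowered by 1.\<close>
  have tele: "(\<Sum>m<Suc n. (a + 1) * ?v m - (a + b + 1) * ?u m) = - c * (?e n * ((b + of_nat n) / (c + of_nat n)))" for n
  proof (induction n)
    case 0
    have c0: "c \<noteq> 0" using nz(1)[of 0] by simp
    show ?case using c0 by (simp add: half_term_def)
  next
    case (Suc n)
    define N where "N = (of_nat n :: complex)"
    define E where "E = ?e n"
    have n0: "c + N \<noteq> 0" "c + N + 1 \<noteq> 0" "N + 1 \<noteq> 0" using nz(1)[of n] nz(1)[of "Suc n"] nz(4)[of n] by (auto simp: N_def add_ac)
    have sN: "of_nat (Suc n) = N + 1" by (simp add: N_def)
    have abc: "a + b + 1 = 2 * c" by (simp add: c_def)
    have "- c * (E * ((b + N) / (c + N))) + ((a + 1 + (N + 1)) * c * (E * (a + 1 + N) * (b + N) / (2 * (c + N) * (N + 1))) / (c + (N + 1)) - 2 * c * (E * a * (b + N) / (2 * (c + N) * (N + 1))))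
        = - c * (E * (a + 1 + N) * (b + N) / (2 * (c + N) * (N + 1)) * ((b + (N + 1)) / (c + (N + 1))))"
    proof -
      define X where "X = c * E * (b + N) / (2 * (c + N) * (N + 1) * (c + N + 1))"
      have "- c * (E * ((b + N) / (c + N))) = X * (- 2 * (N + 1) * (c + N + 1))"
      proof -
        have "- c * (E * (B / p)) = c * E * B / (2 * p * q * r) * (- 2 * q * r)" if "p \<noteq> 0" "q \<noteq> 0" "r \<noteq> 0" for B p q r
          using that by (simp add: divide_simps)
        from this[OF n0(1,3,2)] show ?thesis unfolding X_def .
      qed
      moreover have "(a + 1 + (N + 1)) * c * (E * (a + 1 + N) * (b + N) / (2 * (c + N) * (N + 1))) / (c + (N + 1)) = X * ((a + 2 + N) * (a + 1 + N))"
        unfolding X_def by (simp add: add_ac mult_ac)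
      moreover have "2 * c * (E * a * (b + N) / (2 * (c + N) * (N + 1))) = X * (2 * a * (c + N + 1))"
        unfolding X_def using n0 by simp
      moreover have "- c * (E * (a + 1 + N) * (b + N) / (2 * (c + N) * (N + 1)) * ((b + (N + 1)) / (c + (N + 1)))) = X * (- (a + 1 + N) * (b + N + 1))"
      proof -
        have "- c * (E * A * B / (2 * p * q) * (C / r)) = c * E * B / (2 * p * q * r) * (- A * C)" for A B C p q r
          by simp
        then show ?thesis unfolding X_def add.assoc[symmetric] .
      qed
      moreover have "X * (- 2 * (N + 1) * (c + N + 1)) + (X * ((a + 2 + N) * (a + 1 + N)) - X * (2 * a * (c + N + 1))) = X * (- (a + 1 + N) * (b + N + 1))"
        unfolding ab by algebra
      ultimately show ?thesis by (simp only:)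
    qed
    then show ?case
      unfolding sum.lessThan_Suc[of _ "Suc n"] Suc unfolding v u e sN N_def[symmetric] E_def[symmetric] abc .
  qed
  have s1: "summable ?u" and s2: "summable ?v"
    by (rule summable_norm_cancel[OF summable_norm_half_term], fact)+
  have "(\<lambda>m. (a + 1) * ?v m - (a + b + 1) * ?u m) sums ((a + 1) * (\<Sum>m. ?v m) - (a + b + 1) * (\<Sum>m. ?u m))"
    using s1 s2 by (intro sums_diff sums_mult summable_sums)
  moreover have "(\<lambda>m. (a + 1) * ?v m - (a + b + 1) * ?u m) sums 0"
    unfolding sums_def
  proof (rule LIMSEQ_imp_Suc, unfold tele, intro tendsto_mult_right_zero)
    have "(\<lambda>n. ?e n * ((b + of_nat n) / (c + of_nat n))) \<longlonglongrightarrow> 0 * 1"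
      by (intro tendsto_mult of_nat_quotient_tendsto_1 summable_LIMSEQ_zero summable_norm_cancel[OF summable_norm_half_term] cn)
    then show "(\<lambda>n. ?e n * ((b + of_nat n) / (c + of_nat n))) \<longlonglongrightarrow> 0" by simp
  qed
  ultimately show ?thesis using sums_unique2 unfolding c_def by fastforce
qed

lemma half_term_commute: "half_term a b c = half_term b a c"
  by (simp add: half_term_def fun_eq_iff mult_ac)

lemma rGamma_plus1': "(a + 1) * rGamma ((a + 2 + 1) / 2) = 2 * rGamma ((a + 1) / 2 :: complex)"
proof -
  have "(a + 2 + 1) / 2 = (a + 1) / 2 + 1" by (simp add: field_simps)
  then show ?thesis using rGamma_plus1[of "(a + 1) / 2"] by (simp add: field_simps)
qed

text \<open>Watson's series at e = c is evaluated twice. By \<open>watson_sum_half\<close> it is a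
  Gamma quotient times the unknown sum at 1/2; directly, the parameters e and c cancel and Gauss's
  theorem with lower parameter a + b + 1 applies. Legendre's duplication formula then removes the
  Gamma values at arguments shifted by 1/2.\<close>

lemma gauss_second_sum_pos:
  assumes "Re a > 0" "Re b > 0"
  shows "(\<Sum>m. half_term a b ((a + b + 1) / 2) m) =
    Gamma (1 / 2) * Gamma ((a + b + 1) / 2) * rGamma ((a + 1) / 2) * rGamma ((b + 1) / 2)"
proof -
  define c where "c = (a + b + 1) / 2"
  let ?\<Phi> = "\<Sum>m. half_term a b c m"
  have Rc: "Re c > 0" using assms by (simp add: c_def)
  have c: "c \<notin> \<int>\<^sub>\<le>\<^sub>0" using Rc by (rule Re_pos_notin_nonpos_Ints)
  have c2: "2 * c = a + b + 1" by (simp add: c_def)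
  have "watson_sum a b c = ?\<Phi> * (Gamma (c + 1 / 2) * Gamma (c + (1 - a - b) / 2) * rGamma (c + (1 - a) / 2) * rGamma (c + (1 - b) / 2))"
  proof (rule watson_sum_half[of a b c, folded c_def])
    show "c \<notin> \<int>\<^sub>\<le>\<^sub>0" by (fact c)
    show "2 * c \<notin> \<int>\<^sub>\<le>\<^sub>0" using Rc by (intro Re_pos_notin_nonpos_Ints) simp
    show "Re (2 * c - a - b) > - 1" unfolding c2 by simp
  qed
  also have "c + (1 - a - b) / 2 = 1" by (simp add: c_def field_simps)
  also have "c + (1 - a) / 2 = (b + 1) / 2 + 1 / 2" by (simp add: c_def field_simps)
  also have "c + (1 - b) / 2 = (a + 1) / 2 + 1 / 2" by (simp add: c_def field_simps)
  finally have 1: "watson_sum a b c = ?\<Phi> * (Gamma (c + 1 / 2) * rGamma ((b + 1) / 2 + 1 / 2) * rGamma ((a + 1) / 2 + 1 / 2))"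
    by simp
  have "hyp3F2_term a b c c (a + b + 1) m = hyp3F2_term a b 1 (a + b + 1) 1 m" for m
    unfolding hyp3F2_term_def using add_of_nat_notin_nonpos_Ints(3)[OF c, of m] by (simp add: pochhammer_fact[symmetric])
  then have "watson_sum a b c = (\<Sum>m. hyp3F2_term a b 1 (a + b + 1) 1 m)"
    unfolding watson_sum_def c_def[symmetric] c2 by (rule suminf_cong)
  also have "\<dots> = Gamma (a + b + 1) * Gamma (a + b + 1 - a - b) * rGamma (a + b + 1 - a) * rGamma (a + b + 1 - b)"
    by (rule gauss_sum) (use assms in \<open>auto intro!: Re_pos_notin_nonpos_Ints\<close>)
  finally have 2: "watson_sum a b c = Gamma (a + b + 1) * rGamma (b + 1) * rGamma (a + 1)"
    by (simp add: algebra_simps)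
  let ?E = "\<lambda>z. exp ((1 - 2 * z) * of_real (ln 2)) * of_real (sqrt pi)"
  have dup: "Gamma z * Gamma (z + 1 / 2) = ?E z * Gamma (2 * z)" if "Re z > 0" for z :: complex
    by (rule Gamma_legendre_duplication) (use that in \<open>auto intro!: Re_pos_notin_nonpos_Ints\<close>)
  have e: "2 * ((z + 1) / 2) = z + 1" for z :: complex by (simp add: field_simps)
  have da: "Gamma ((a + 1) / 2) * Gamma ((a + 1) / 2 + 1 / 2) = ?E ((a + 1) / 2) * Gamma (a + 1)"
    using dup[of "(a + 1) / 2"] assms unfolding e by simp
  have db: "Gamma ((b + 1) / 2) * Gamma ((b + 1) / 2 + 1 / 2) = ?E ((b + 1) / 2) * Gamma (b + 1)"
    using dup[of "(b + 1) / 2"] assms unfolding e by simp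
  have dc: "Gamma c * Gamma (c + 1 / 2) = ?E c * Gamma (a + b + 1)"
    using dup[of c] Rc c2 by simp
  have EE: "?E ((a + 1) / 2) * ?E ((b + 1) / 2) = ?E c * of_real (sqrt pi)"
  proof -
    have "exp ((1 - 2 * ((a + 1) / 2)) * of_real (ln 2)) * exp ((1 - 2 * ((b + 1) / 2)) * of_real (ln 2)) = exp ((1 - 2 * c) * complex_of_real (ln 2))"
    proof -
      have E: "(1 - 2 * ((a + 1) / 2)) + (1 - 2 * ((b + 1) / 2)) = 1 - 2 * c" by (simp add: c_def field_simps)
      show ?thesis unfolding exp_add[symmetric] distrib_right[symmetric] E ..
    qed
    moreover have "(x * p) * (y * p) = (x * y) * p * p" for x y p :: complex by (simp only: mult_ac)
    ultimately show ?thesis by (simp only:)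
  qed
  have G: "Gamma z \<noteq> 0" if "Re z > 0" for z :: complex
    using Re_pos_notin_nonpos_Ints[OF that] by (simp add: Gamma_eq_zero_iff)
  have nz: "Gamma ((a + 1) / 2) \<noteq> 0" "Gamma ((a + 1) / 2 + 1 / 2) \<noteq> 0" "Gamma ((b + 1) / 2) \<noteq> 0" "Gamma ((b + 1) / 2 + 1 / 2) \<noteq> 0"
    "Gamma c \<noteq> 0" "Gamma (c + 1 / 2) \<noteq> 0" "Gamma (a + 1) \<noteq> 0" "Gamma (b + 1) \<noteq> 0" "?E c \<noteq> 0"
    by (rule G, use assms Rc in \<open>simp add: add_pos_pos\<close>)+ simp
  \<comment> \<open>The elimination over plain complex numbers: ga, gb, gc are the Gamma values at
    (a+1)/2, (b+1)/2 and c, a prime marks the shift by 1/2, ga1, gb1, gab are the doubled arguments,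
    and ea, eb, ec the exponential factors of the duplication formula.\<close>
  have key: "\<Phi> = sp * gc * inverse ga * inverse gb"
    if "\<Phi> * (gc' * inverse gb' * inverse ga') = gab * inverse gb1 * inverse ga1" "ga * ga' = ea * ga1" "gb * gb' = eb * gb1" "gc * gc' = ec * gab"
      "ea * eb = ec * sp" "ga \<noteq> 0" "ga' \<noteq> 0" "gb \<noteq> 0" "gb' \<noteq> 0" "gc \<noteq> 0" "gc' \<noteq> 0" "ga1 \<noteq> 0" "gb1 \<noteq> 0" "ec \<noteq> 0"
    for \<Phi> sp gc gc' ga ga' gb gb' gab ga1 gb1 ea eb ec :: complex
  proof -
    have "\<Phi> * gc' * ga1 * gb1 = (\<Phi> * (gc' * inverse gb' * inverse ga')) * (ga1 * gb1 * ga' * gb')"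
      using that(7,9) by (simp add: divide_simps)
    also have "\<dots> = gab * ga' * gb'"
      unfolding that(1) using that(12,13) by (simp add: divide_simps)
    finally have "\<Phi> * gc' * ga1 * gb1 = gab * ga' * gb'" .
    then have F: "(ea * eb * gc) * (\<Phi> * gc' * ga1 * gb1) = (ea * eb * gc) * (gab * ga' * gb')" by simp
    have "\<Phi> * gc' * (ea * ga1) * (eb * gb1) * gc = (ea * eb * gc) * (\<Phi> * gc' * ga1 * gb1)" by (simp only: mult_ac)
    also have "\<dots> = (ea * eb) * gc * gab * ga' * gb'" unfolding F by (simp only: mult_ac)
    also have "\<dots> = sp * (ec * gab) * gc * ga' * gb'" unfolding that(5) by (simp only: mult_ac)
    finally have "\<Phi> * gc' * (ga * ga') * (gb * gb') * gc = sp * (gc * gc') * gc * ga' * gb'"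
      unfolding that(2,3,4)[symmetric] .
    then have "(\<Phi> * ga * gb) * (gc' * ga' * gb' * gc) = (sp * gc) * (gc' * ga' * gb' * gc)" by (simp add: mult_ac)
    then have "\<Phi> * ga * gb = sp * gc" using that(7,9,10,11) by simp
    then have "sp * gc * inverse ga * inverse gb = (\<Phi> * ga * gb) * inverse ga * inverse gb" by simp
    then show ?thesis using that(6,8) by (simp add: divide_simps)
  qed
  show ?thesis unfolding c_def[symmetric] Gamma_one_half_complex rGamma_inverse_Gamma
    by (rule key[OF trans[OF 1[symmetric] 2, unfolded rGamma_inverse_Gamma] da db dc EE nz])
qed

text \<open>Raising \<open>a\<close> and \<open>b\<close> by even numbers leads to positive real parts, where Watson's series with
  \<open>e = (a + b + 1) / 2\<close> is a Gauss series.\<close>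

theorem gauss_second_sum:
  assumes c: "(a + b + 1) / 2 \<notin> \<int>\<^sub>\<le>\<^sub>0"
  shows "(\<Sum>m. half_term a b ((a + b + 1) / 2) m) =
    Gamma (1 / 2) * Gamma ((a + b + 1) / 2) * rGamma ((a + 1) / 2) * rGamma ((b + 1) / 2)"
proof -
  let ?P = "\<lambda>a b. (\<Sum>m. half_term a b ((a + b + 1) / 2) m) =
    Gamma (1 / 2) * Gamma ((a + b + 1) / 2) * rGamma ((a + 1) / 2) * rGamma ((b + 1) / 2)"
  have step: "?P a b" if c: "(a + b + 1) / 2 \<notin> \<int>\<^sub>\<le>\<^sub>0" and P: "?P (a + 2) b" for a b
  proof -
    have c': "(a + 2 + b + 1) / 2 = (a + b + 1) / 2 + 1" by (simp add: field_simps)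
    have nz: "a + b + 1 \<noteq> 0" using c by auto
    have "(a + b + 1) * (\<Sum>m. half_term a b ((a + b + 1) / 2) m) = (a + 1) * (\<Sum>m. half_term (a + 2) b ((a + b + 1) / 2 + 1) m)"
      using half_sum_contiguous[OF c] by simp
    also have "\<dots> = Gamma (1 / 2) * Gamma ((a + b + 1) / 2 + 1) * ((a + 1) * rGamma ((a + 2 + 1) / 2)) * rGamma ((b + 1) / 2)"
      using P unfolding c' by simp
    also have "\<dots> = (a + b + 1) * (Gamma (1 / 2) * Gamma ((a + b + 1) / 2) * rGamma ((a + 1) / 2) * rGamma ((b + 1) / 2))"
      unfolding rGamma_plus1' Gamma_plus1[OF c] by simp
    finally show ?thesis using nz by simp
  qed
  have step_n: "?P a b" if c: "(a + b + 1) / 2 \<notin> \<int>\<^sub>\<le>\<^sub>0" and P: "?P (a + 2 * of_nat n) b" for n a b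
    using that
  proof (induction n arbitrary: a)
    case (Suc n)
    have "(a + b + 1) / 2 + 1 \<notin> \<int>\<^sub>\<le>\<^sub>0" using add_of_nat_notin_nonpos_Ints(1)[OF Suc.prems(1), of 1] by simp
    then have "(a + 2 + b + 1) / 2 \<notin> \<int>\<^sub>\<le>\<^sub>0" by (simp add: add_divide_distrib add_ac)
    moreover have e: "a + 2 * of_nat (Suc n) = a + 2 + 2 * of_nat n" by simp
    ultimately have "?P (a + 2) b" using Suc.IH[OF _ Suc.prems(2)[unfolded e]] by blast
    then show ?case by (rule step[OF Suc.prems(1)])
  qed simp
  have swap: "?P a b" if "?P b a" for a b
    using that unfolding half_term_commute[of a b] add.commute[of a b] by (simp only: mult_ac)
  obtain n where n: "real n > \<bar>Re a\<bar> + \<bar>Re b\<bar>" using reals_Archimedean2 by blast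
  have c1: "(a + 2 * of_nat n + b + 1) / 2 \<notin> \<int>\<^sub>\<le>\<^sub>0"
    using add_of_nat_notin_nonpos_Ints(1)[OF c, of n] by (simp add: add_divide_distrib add_ac)
  show ?thesis
  proof (rule step_n[OF c, of n], rule swap, rule step_n[of _ _ n])
    show "(b + (a + 2 * of_nat n) + 1) / 2 \<notin> \<int>\<^sub>\<le>\<^sub>0" using c1 by (simp add: add_ac)
    show "?P (b + 2 * of_nat n) (a + 2 * of_nat n)"
      by (rule gauss_second_sum_pos) (use n in auto)
  qed
qed

theorem watson_sum:
  assumes c: "(a + b + 1) / 2 \<notin> \<int>\<^sub>\<le>\<^sub>0" and e: "2 * e \<notin> \<int>\<^sub>\<le>\<^sub>0" and pos: "Re (2 * e - a - b) > - 1"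
  shows "(\<Sum>m. hyp3F2_term a b e ((a + b + 1) / 2) (2 * e) m) =
    Gamma (1 / 2) * Gamma (e + 1 / 2) * Gamma ((a + b + 1) / 2) * Gamma (e + (1 - a - b) / 2)
    * rGamma ((a + 1) / 2) * rGamma ((b + 1) / 2) * rGamma (e + (1 - a) / 2) * rGamma (e + (1 - b) / 2)"
  using watson_sum_half[OF assms] unfolding watson_sum_def gauss_second_sum[OF c] by (simp add: mult_ac)

subsection \<open>Terminating expansions\<close>

text \<open>Saalschuetz's theorem multiplied by all its denominators, so that no parameter value is
  excluded. The balance condition is built into \<tau> - n = 1 + b + f - c - n, the second lower
  parameter.\<close>

lemma saalschuetz:
  fixes b f c :: "'a::field_char_0"
  defines "\<tau> \<equiv> 1 + b + f - c"
  shows "(\<Sum>k\<le>n. (- 1) ^ k * of_nat (n choose k) * pochhammer b k * pochhammer f k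
      * pochhammer (c + of_nat k) (n - k) * pochhammer (\<tau> - of_nat n + of_nat k) (n - k))
    = (- 1) ^ n * pochhammer (c - b) n * pochhammer (c - f) n"
proof -
  define T where "T = (\<lambda>n k. (- 1) ^ k * of_nat (n choose k) * pochhammer b k * pochhammer f k
      * pochhammer (c + of_nat k) (n - k) * pochhammer (\<tau> - of_nat n + of_nat k) (n - k))"
  \<comment> \<open>Creative telescoping: the first-order recurrence in n, applied to the summand,
    is a difference in k with certificate (b+k)(f+k) T n k.\<close>
  have tele: "(\<Sum>i\<le>k. T (Suc n) i + (c - b + of_nat n) * (c - f + of_nat n) * T n i) = (b + of_nat k) * (f + of_nat k) * T n k"
    if "k \<le> n" for n k
    using that
  proof (induction k)
    case 0
    have 1: "pochhammer (\<tau> - of_nat (Suc n)) (Suc n) = (\<tau> - of_nat n - 1) * pochhammer (\<tau> - of_nat n) n"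
      by (subst pochhammer_rec) (simp add: algebra_simps)
    have poly: "(c + of_nat n) * (\<tau> - of_nat n - 1) + (c - b + of_nat n) * (c - f + of_nat n) = b * f"
      unfolding \<tau>_def by algebra
    define X where "X = pochhammer c n * pochhammer (\<tau> - of_nat n) n"
    have "T (Suc n) 0 = X * ((c + of_nat n) * (\<tau> - of_nat n - 1))"
      unfolding T_def X_def using 1 by (simp add: pochhammer_Suc[of c] mult_ac)
    moreover have "T n 0 = X" by (simp add: T_def X_def)
    ultimately have "T (Suc n) 0 + (c - b + of_nat n) * (c - f + of_nat n) * T n 0
      = X * ((c + of_nat n) * (\<tau> - of_nat n - 1) + (c - b + of_nat n) * (c - f + of_nat n))"
      by (simp add: algebra_simps)
    then show ?case unfolding poly by (simp add: \<open>T n 0 = X\<close> mult_ac)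
  next
    case (Suc k)
    define l where "l = n - Suc k"
    have n: "n = Suc (k + l)" using Suc.prems by (simp add: l_def)
    define V where "V = (- 1) ^ k * pochhammer b k * pochhammer f k * pochhammer (c + of_nat (Suc k)) l * pochhammer (\<tau> - of_nat n + of_nat (Suc k)) l"
    define bk bk1 :: 'a where "bk = of_nat (n choose k)" and "bk1 = of_nat (n choose Suc k)"
    have bin: "bk * (of_nat n - of_nat k) = bk1 * (of_nat k + 1)"
    proof -
      have "Suc k * (n choose Suc k) = (n - k) * (n choose k)"
        using binomial_absorb_comp[of n k] Suc_times_binomial_eq[of "n - 1" k] n by (simp add: mult_ac)
      then have "of_nat (Suc k) * bk1 = of_nat (n - k) * bk"
        unfolding bk_def bk1_def of_nat_mult[symmetric] by simp
      then show ?thesis using n by (simp add: of_nat_diff mult_ac add.commute)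
    qed
    have 1: "T n (Suc k) = - bk1 * V * (b + of_nat k) * (f + of_nat k)"
      unfolding T_def V_def bk1_def l_def[symmetric] pochhammer_Suc[of b] pochhammer_Suc[of f] by simp
    have 2: "T n k = bk * V * (c + of_nat k) * (\<tau> - of_nat n + of_nat k)"
    proof -
      have "n - k = Suc l" using n by simp
      then show ?thesis
        unfolding T_def V_def bk_def by (simp add: pochhammer_rec[of _ l] add_ac mult_ac)
    qed
    have 3: "T (Suc n) (Suc k) = - ((bk + bk1) * V * (b + of_nat k) * (f + of_nat k) * (c + of_nat n) * (\<tau> - of_nat n + of_nat k))"
    proof -
      have a: "Suc n - Suc k = Suc l" using n by simp
      have p: "pochhammer (c + of_nat (Suc k)) (Suc l) = pochhammer (c + of_nat (Suc k)) l * (c + of_nat n)"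
        unfolding pochhammer_Suc by (simp add: n add_ac)
      have q: "pochhammer (\<tau> - of_nat (Suc n) + of_nat (Suc k)) (Suc l) = (\<tau> - of_nat n + of_nat k) * pochhammer (\<tau> - of_nat n + of_nat (Suc k)) l"
        unfolding pochhammer_rec by (simp add: add_ac)
      have r: "of_nat (Suc n choose Suc k) = bk + bk1" by (simp add: bk_def bk1_def)
      show ?thesis unfolding T_def V_def a p q r pochhammer_Suc[of b] pochhammer_Suc[of f] by (simp add: mult_ac)
    qed
    have "bk * (c + of_nat k) * (\<tau> - of_nat n + of_nat k) - (bk + bk1) * (c + of_nat n) * (\<tau> - of_nat n + of_nat k)
        - (c - b + of_nat n) * (c - f + of_nat n) * bk1 + (b + of_nat (Suc k)) * (f + of_nat (Suc k)) * bk1 = 0"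
    proof -
      have "bk * (c + of_nat k) * (\<tau> - of_nat n + of_nat k) - (bk + bk1) * (c + of_nat n) * (\<tau> - of_nat n + of_nat k)
        = - (bk * (of_nat n - of_nat k)) * (\<tau> - of_nat n + of_nat k) - bk1 * (c + of_nat n) * (\<tau> - of_nat n + of_nat k)"
        by algebra
      also have "\<dots> = (c - b + of_nat n) * (c - f + of_nat n) * bk1 - (b + (of_nat k + 1)) * (f + (of_nat k + 1)) * bk1"
        unfolding bin \<tau>_def by algebra
      finally show ?thesis by (simp add: add_ac)
    qed
    then have "V * (b + of_nat k) * (f + of_nat k) * (bk * (c + of_nat k) * (\<tau> - of_nat n + of_nat k) - (bk + bk1) * (c + of_nat n) * (\<tau> - of_nat n + of_nat k)
        - (c - b + of_nat n) * (c - f + of_nat n) * bk1) = V * (b + of_nat k) * (f + of_nat k) * (- ((b + of_nat (Suc k)) * (f + of_nat (Suc k)) * bk1))"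
      by (simp only: eq_neg_iff_add_eq_0[symmetric])
    moreover have "(b + of_nat k) * (f + of_nat k) * T n k + (T (Suc n) (Suc k) + (c - b + of_nat n) * (c - f + of_nat n) * T n (Suc k))
       = V * (b + of_nat k) * (f + of_nat k) * (bk * (c + of_nat k) * (\<tau> - of_nat n + of_nat k) - (bk + bk1) * (c + of_nat n) * (\<tau> - of_nat n + of_nat k)
        - (c - b + of_nat n) * (c - f + of_nat n) * bk1)"
      unfolding 1 2 3 by algebra
    moreover have "V * (b + of_nat k) * (f + of_nat k) * (- ((b + of_nat (Suc k)) * (f + of_nat (Suc k)) * bk1)) = (b + of_nat (Suc k)) * (f + of_nat (Suc k)) * T n (Suc k)"
      unfolding 1 by algebra
    ultimately show ?case using Suc by (simp only: sum.atMost_Suc Suc_leD)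
  qed
  have "(\<Sum>k\<le>n. T n k) = (- 1) ^ n * pochhammer (c - b) n * pochhammer (c - f) n"
  proof (induction n)
    case (Suc n)
    have z: "T n (Suc n) = 0" by (simp add: T_def)
    have "(\<Sum>i\<le>Suc n. T (Suc n) i + (c - b + of_nat n) * (c - f + of_nat n) * T n i) = (b + of_nat n) * (f + of_nat n) * T n n + T (Suc n) (Suc n)"
      by (simp add: tele z)
    also have "\<dots> = 0" by (simp add: T_def pochhammer_Suc mult_ac)
    finally have "(\<Sum>i\<le>Suc n. T (Suc n) i) = - ((c - b + of_nat n) * (c - f + of_nat n) * (\<Sum>i\<le>n. T n i))"
      by (simp add: sum.distrib sum_distrib_left z eq_neg_iff_add_eq_0)
    then show ?case unfolding Suc by (simp add: pochhammer_Suc mult_ac)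
  qed (simp add: T_def)
  then show ?thesis by (simp add: T_def)
qed

lemma hyp2F1_minus_of_nat:
  "hyp2F1 (- of_nat n) b c x = (\<Sum>j\<le>n. (- 1) ^ j * of_nat (n choose j) * (pochhammer b j * x ^ j) / pochhammer c j)"
proof -
  have "hyp2F1 (- of_nat n) b c x = (\<Sum>j\<le>n. pochhammer (- of_nat n) j * pochhammer b j / pochhammer c j * (x ^ j / fact j))"
    unfolding hyp2F1_def by (rule suminf_finite) (auto simp: pochhammer_of_nat_eq_0_iff)
  also have "\<dots> = (\<Sum>j\<le>n. (- 1) ^ j * of_nat (n choose j) * (pochhammer b j * x ^ j) / pochhammer c j)"
  proof (intro sum.cong refl)
    fix j assume "j \<in> {..n}"
    have "pochhammer (- of_nat n) j = (- 1) ^ j * of_nat (n choose j) * (fact j :: complex)"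
      by (simp add: binomial_gbinomial gbinomial_pochhammer)
    then show "pochhammer (- of_nat n) j * pochhammer b j / pochhammer c j * (x ^ j / fact j)
      = (- 1) ^ j * of_nat (n choose j) * (pochhammer b j * x ^ j) / pochhammer c j" by simp
  qed
  finally show ?thesis .
qed

text \<open>After the powers are expanded and the finite sums exchanged, the coefficient of K_j is a
  terminating 3F2 of unit argument in the index m - j. The prescribed value of d makes it
  balanced.\<close>

lemma terminating_expansion:
  fixes b c d f x :: complex
  assumes c: "c \<notin> \<int>\<^sub>\<le>\<^sub>0" and d: "d = b - c + 1 - of_nat n"
    and nz: "\<And>j. j \<le> n \<Longrightarrow> pochhammer (d + f + of_nat j - 1) (n + 1) \<noteq> 0"
  shows "pochhammer c n * (\<Sum>j\<le>n. (- 1) ^ j * of_nat (n choose j) * (pochhammer b j * x ^ j) / pochhammer c j) =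
    (- 1) ^ n * (\<Sum>j\<le>n. fact n / fact (n - j) * jacobiK j x f d *
      (pochhammer b j * pochhammer (c - b) (n - j) * pochhammer (c - f) (n - j) * (d + f + 2 * of_nat j - 1)) /
      pochhammer (d + f + of_nat j - 1) (n + 1))"
proof -
  define s where "s = f + d"
  have nz': "s + of_nat i - 1 \<noteq> 0" if "i \<le> 2 * n" for i
  proof -
    \<comment> \<open>The Pochhammer symbols in the hypothesis, taken for all j <= n together,
      contain every factor s + i - 1 with i <= 2n; this j is one whose symbol contains the given
      factor.\<close>
    define j where "j = min i n"
    have j: "j \<le> n" "i - j < n + 1" "j \<le> i" using that by (auto simp: j_def)
    have "s + of_nat j - 1 + of_nat (i - j) \<noteq> 0"
      using nz[OF j(1)] j(2) by (auto simp: pochhammer_eq_0_iff s_def add_ac eq_neg_iff_add_eq_0)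
    then show ?thesis using j by (simp add: of_nat_diff algebra_simps)
  qed
  have nz0: "s + of_nat i \<noteq> 0" if "i < 2 * n" for i
    using nz'[of "Suc i"] that by simp
  let ?w = "\<lambda>m. pochhammer c n * ((- 1) ^ m * of_nat (n choose m) * pochhammer b m / pochhammer c m)"
  have "pochhammer c n * (\<Sum>m\<le>n. (- 1) ^ m * of_nat (n choose m) * (pochhammer b m * x ^ m) / pochhammer c m)
     = (\<Sum>m\<le>n. ?w m * (\<Sum>j\<le>m. conn f s m j * jacobiK j x f d))"
    unfolding sum_distrib_left[of "pochhammer c n"]
  proof (intro sum.cong refl)
    fix m assume m: "m \<in> {..n}"
    have "x ^ m = (\<Sum>j\<le>m. conn f s m j * jacobiK j x f d)"
      unfolding s_def by (rule power_eq_sum_jacobiK) (use nz0 m in \<open>auto simp: s_def\<close>)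
    then show "pochhammer c n * ((- 1) ^ m * of_nat (n choose m) * (pochhammer b m * x ^ m) / pochhammer c m) =
      ?w m * (\<Sum>j\<le>m. conn f s m j * jacobiK j x f d)" by simp
  qed
  also have "\<dots> = (\<Sum>m\<le>n. \<Sum>j\<le>n. ?w m * (conn f s m j * jacobiK j x f d))"
  proof (intro sum.cong refl)
    fix m assume "m \<in> {..n}"
    then have "(\<Sum>j\<le>m. conn f s m j * jacobiK j x f d) = (\<Sum>j\<le>n. conn f s m j * jacobiK j x f d)"
      by (intro sum.mono_neutral_left) auto
    then show "?w m * (\<Sum>j\<le>m. conn f s m j * jacobiK j x f d) = (\<Sum>j\<le>n. ?w m * (conn f s m j * jacobiK j x f d))"
      by (simp only: sum_distrib_left)
  qed
  also have "\<dots> = (\<Sum>j\<le>n. (\<Sum>m\<le>n. ?w m * conn f s m j) * jacobiK j x f d)"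
    by (subst sum.swap) (simp only: sum_distrib_right mult.assoc)
  also have "\<dots> = (\<Sum>j\<le>n. (- 1) ^ n * (fact n / fact (n - j) * jacobiK j x f d *
      (pochhammer b j * pochhammer (c - b) (n - j) * pochhammer (c - f) (n - j) * (d + f + 2 * of_nat j - 1)) /
      pochhammer (d + f + of_nat j - 1) (n + 1)))"
  proof (intro sum.cong refl)
    fix j assume "j \<in> {..n}"
    then have j: "j \<le> n" by simp
    define N where "N = n - j"
    have n: "n = j + N" using j by (simp add: N_def)
    have ne: "s + 2 * of_nat j - 1 \<noteq> 0" using nz'[of "2 * j"] j by simp
    have P: "pochhammer (s + of_nat j - 1) (n + 1) = pochhammer (s + of_nat j - 1) j * ((s + 2 * of_nat j - 1) * pochhammer (s + 2 * of_nat j) N)"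
    proof -
      have "n + 1 = j + Suc N" using n by simp
      moreover have "pochhammer (s + of_nat j - 1 + of_nat j) (Suc N) = (s + 2 * of_nat j - 1) * pochhammer (s + 2 * of_nat j) N"
        unfolding pochhammer_rec by (simp add: algebra_simps)
      ultimately show ?thesis by (simp only: pochhammer_product')
    qed
    have "pochhammer (s + of_nat j - 1) (n + 1) \<noteq> 0" using nz[OF j] by (simp add: s_def add_ac)
    then have Pn: "pochhammer (s + of_nat j - 1) j \<noteq> 0" "pochhammer (s + 2 * of_nat j) N \<noteq> 0" unfolding P by auto
    \<comment> \<open>The balance condition for the parameters shifted by j; here the choice of d
      enters.\<close>
    have \<tau>: "s + 2 * of_nat j = 1 + (b + of_nat j) + (f + of_nat j) - (c + of_nat j) - of_nat N"
      by (simp add: s_def d n)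
    define W where "W = (- 1) ^ j * (fact n / fact N) * pochhammer b j / (pochhammer (s + of_nat j - 1) j * pochhammer (s + 2 * of_nat j) N)"
    have "(\<Sum>m\<le>n. ?w m * conn f s m j) = (\<Sum>m\<in>{j..n}. ?w m * conn f s m j)"
      by (intro sum.mono_neutral_right) auto
    also have "\<dots> = (\<Sum>k\<le>N. ?w (k + j) * conn f s (k + j) j)"
      unfolding atMost_atLeast0 using sum.shift_bounds_cl_nat_ivl[of "\<lambda>m. ?w m * conn f s m j" 0 j N] n by (simp add: add.commute)
    also have "\<dots> = (\<Sum>k\<le>N. W * ((- 1) ^ k * of_nat (N choose k) * pochhammer (b + of_nat j) k * pochhammer (f + of_nat j) k
      * pochhammer (c + of_nat j + of_nat k) (N - k) * pochhammer (s + 2 * of_nat j + of_nat k) (N - k)))"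
    proof (intro sum.cong refl)
      fix k assume "k \<in> {..N}"
      then have k: "k \<le> N" by simp
      have c1: "pochhammer c n = pochhammer c (k + j) * pochhammer (c + of_nat j + of_nat k) (N - k)"
        using pochhammer_product[of "k + j" n c] k n by (simp add: add_ac)
      have c0: "pochhammer c (k + j) \<noteq> 0" using add_of_nat_notin_nonpos_Ints(3)[OF c] .
      have b1: "pochhammer b (k + j) = pochhammer b j * pochhammer (b + of_nat j) k"
        using pochhammer_product'[of b j k] by (simp add: add.commute)
      have s1: "pochhammer (s + 2 * of_nat j) N = pochhammer (s + 2 * of_nat j) k * pochhammer (s + 2 * of_nat j + of_nat k) (N - k)"
        using pochhammer_product[OF k] .
      have s0: "pochhammer (s + 2 * of_nat j) k \<noteq> 0" "pochhammer (s + 2 * of_nat j + of_nat k) (N - k) \<noteq> 0" using Pn(2) unfolding s1 by auto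
      have cmb: "of_nat (n choose (k + j)) * (of_nat ((k + j) choose j) * fact j) = fact n / fact N * (of_nat (N choose k) :: complex)"
      proof -
        have e: "n - (k + j) = N - k" "k + j - j = k" and le: "k + j \<le> n" "j \<le> k + j" using n k by simp_all
        show ?thesis
          unfolding binomial_fact[OF le(1)] binomial_fact[OF le(2)] binomial_fact[OF k] e by simp
      qed
      have "?w (k + j) * conn f s (k + j) j = (of_nat (n choose (k + j)) * (of_nat ((k + j) choose j) * fact j)) * (pochhammer c n / pochhammer c (k + j)) * (- 1) ^ (k + j)
         * pochhammer b j * pochhammer (b + of_nat j) k * pochhammer (f + of_nat j) k / (pochhammer (s + of_nat j - 1) j * pochhammer (s + 2 * of_nat j) k)"
        unfolding conn_def b1 by (simp add: mult_ac)
      then have "?w (k + j) * conn f s (k + j) j = (fact n / fact N * of_nat (N choose k)) * (pochhammer c n / pochhammer c (k + j)) * (- 1) ^ (k + j)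
         * pochhammer b j * pochhammer (b + of_nat j) k * pochhammer (f + of_nat j) k / (pochhammer (s + of_nat j - 1) j * pochhammer (s + 2 * of_nat j) k)"
        unfolding cmb .
      also have "\<dots> = W * ((- 1) ^ k * of_nat (N choose k) * pochhammer (b + of_nat j) k * pochhammer (f + of_nat j) k
        * pochhammer (c + of_nat j + of_nat k) (N - k) * pochhammer (s + 2 * of_nat j + of_nat k) (N - k))"
        unfolding W_def c1 s1 using c0 s0 Pn(1) by (simp add: power_add mult_ac)
      finally show "?w (k + j) * conn f s (k + j) j = W * ((- 1) ^ k * of_nat (N choose k) * pochhammer (b + of_nat j) k * pochhammer (f + of_nat j) k
        * pochhammer (c + of_nat j + of_nat k) (N - k) * pochhammer (s + 2 * of_nat j + of_nat k) (N - k))" .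
    qed
    also have "\<dots> = W * ((- 1) ^ N * pochhammer (c - b) N * pochhammer (c - f) N)"
      using saalschuetz[of N "b + of_nat j" "f + of_nat j" "c + of_nat j"]
      unfolding sum_distrib_left[symmetric] \<tau> by simp
    also have "\<dots> = (- 1) ^ n * (fact n / fact (n - j) *
      (pochhammer b j * pochhammer (c - b) (n - j) * pochhammer (c - f) (n - j) * (s + 2 * of_nat j - 1)) /
      pochhammer (s + of_nat j - 1) (n + 1))"
      unfolding P N_def[symmetric] W_def using ne Pn by (simp add: n power_add mult_ac)
    finally show "(\<Sum>m\<le>n. ?w m * conn f s m j) * jacobiK j x f d = (- 1) ^ n * (fact n / fact (n - j) * jacobiK j x f d *
      (pochhammer b j * pochhammer (c - b) (n - j) * pochhammer (c - f) (n - j) * (d + f + 2 * of_nat j - 1)) /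
      pochhammer (d + f + of_nat j - 1) (n + 1))"
      by (simp only: s_def add.commute[of d f]) (simp only: mult_ac times_divide_eq_left times_divide_eq_right)
  qed
  finally show ?thesis by (simp only: sum_distrib_left)
qed

subsection \<open>Bounded variation and regular summation\<close>

text \<open>Convergence with bounded variation is what the discrete Sonin argument demands of
  recurrence coefficients. Closure under sums and products yields it for the rational functions of n
  that occur.\<close>

definition bv_tendsto :: "(nat \<Rightarrow> real) \<Rightarrow> real \<Rightarrow> bool" where
  "bv_tendsto u L \<longleftrightarrow> u \<longlonglongrightarrow> L \<and> summable (\<lambda>n. \<bar>u (Suc n) - u n\<bar>)"

lemma bv_tendsto_const: "bv_tendsto (\<lambda>_. c) c"
  by (simp add: bv_tendsto_def)

lemma bv_tendsto_add:
  assumes "bv_tendsto u K" "bv_tendsto v L"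
  shows "bv_tendsto (\<lambda>n. u n + v n) (K + L)"
proof -
  have "summable (\<lambda>n. \<bar>u (Suc n) - u n\<bar> + \<bar>v (Suc n) - v n\<bar>)"
    using assms by (intro summable_add) (auto simp: bv_tendsto_def)
  then have "summable (\<lambda>n. \<bar>u (Suc n) + v (Suc n) - (u n + v n)\<bar>)"
    by (rule summable_comparison_test[rotated]) auto
  then show ?thesis using assms by (auto simp: bv_tendsto_def intro: tendsto_add)
qed

lemma bv_tendsto_mult:
  assumes "bv_tendsto u K" "bv_tendsto v L"
  shows "bv_tendsto (\<lambda>n. u n * v n) (K * L)"
proof -
  have "Bseq u" "Bseq v" using assms by (auto simp: bv_tendsto_def intro: convergent_imp_Bseq convergentI)
  then obtain M N where M: "M > 0" "\<And>n. \<bar>u n\<bar> \<le> M" and N: "N > 0" "\<And>n. \<bar>v n\<bar> \<le> N"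
    by (auto simp: Bseq_def)
  have "summable (\<lambda>n. M * \<bar>v (Suc n) - v n\<bar> + N * \<bar>u (Suc n) - u n\<bar>)"
    using assms by (intro summable_add summable_mult) (auto simp: bv_tendsto_def)
  then have "summable (\<lambda>n. \<bar>u (Suc n) * v (Suc n) - u n * v n\<bar>)"
  proof (rule summable_comparison_test[rotated], intro exI allI impI)
    fix n
    have "u (Suc n) * v (Suc n) - u n * v n = u (Suc n) * (v (Suc n) - v n) + v n * (u (Suc n) - u n)"
      by (simp add: algebra_simps)
    also have "\<bar>\<dots>\<bar> \<le> \<bar>u (Suc n)\<bar> * \<bar>v (Suc n) - v n\<bar> + \<bar>v n\<bar> * \<bar>u (Suc n) - u n\<bar>"
      by (metis abs_mult abs_triangle_ineq)
    also have "\<dots> \<le> M * \<bar>v (Suc n) - v n\<bar> + N * \<bar>u (Suc n) - u n\<bar>"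
      using M N by (intro add_mono mult_right_mono) auto
    finally show "norm \<bar>u (Suc n) * v (Suc n) - u n * v n\<bar> \<le> M * \<bar>v (Suc n) - v n\<bar> + N * \<bar>u (Suc n) - u n\<bar>" by simp
  qed
  then show ?thesis using assms by (auto simp: bv_tendsto_def intro: tendsto_mult)
qed

lemma bv_tendsto_inverse:
  assumes "v > 0"
  shows "bv_tendsto (\<lambda>n. 1 / (real n + v)) 0"
proof -
  have lim: "(\<lambda>n. 1 / (real n + v)) \<longlonglongrightarrow> 0"
  proof -
    have "filterlim (\<lambda>n. v + real n) at_top sequentially"
      by (rule filterlim_tendsto_add_at_top[OF tendsto_const filterlim_real_sequentially])
    then show ?thesis
      by (intro tendsto_divide_0[OF tendsto_const] filterlim_at_top_imp_at_infinity) (simp add: add.commute)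
  qed
  have "summable (\<lambda>n. 1 / (real n + v) - 1 / (real (Suc n) + v))"
    using telescope_summable'[OF lim] by simp
  moreover have "1 / (real n + v) - 1 / (real (Suc n) + v) = \<bar>1 / (real (Suc n) + v) - 1 / (real n + v)\<bar>" for n
    using assms by (simp add: abs_if divide_simps)
  ultimately show ?thesis using lim by (simp add: bv_tendsto_def)
qed

lemma bv_tendsto_quotient:
  assumes "v > 0"
  shows "bv_tendsto (\<lambda>n. (real n + u) / (real n + v)) 1"
proof -
  have "bv_tendsto (\<lambda>n. 1 + (u - v) * (1 / (real n + v))) (1 + (u - v) * 0)"
    by (intro bv_tendsto_add bv_tendsto_mult bv_tendsto_const bv_tendsto_inverse assms)
  moreover have "1 + (u - v) * (1 / (real n + v)) = (real n + u) / (real n + v)" for n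
    using assms by (simp add: field_simps)
  ultimately show ?thesis by simp
qed

text \<open>The quadratic form \<open>E\<close> is a discrete Sonin function: it is positive definite for
  \<open>\<bar>x - b\<bar> < 2 a\<close>, and only the variation of the coefficients changes it from one step to the next.\<close>

lemma three_term_bounded:
  fixes \<alpha> \<beta> p :: "nat \<Rightarrow> real"
  assumes rec: "\<And>n. x * p (Suc n) = \<alpha> (Suc n) * p (Suc (Suc n)) + \<beta> (Suc n) * p (Suc n) + \<alpha> n * p n"
    and \<alpha>: "\<And>n. \<alpha> n > 0" "bv_tendsto (\<lambda>n. (\<alpha> n)\<^sup>2) (a\<^sup>2)" and \<beta>: "bv_tendsto \<beta> b"
    and a: "a > 0" and x: "\<bar>x - b\<bar> < 2 * a"
  shows "Bseq p"
proof -
  have "(\<lambda>n. sqrt ((\<alpha> n)\<^sup>2)) \<longlonglongrightarrow> sqrt (a\<^sup>2)"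
    using \<alpha>(2) by (intro tendsto_real_sqrt) (simp add: bv_tendsto_def)
  then have lim\<alpha>: "\<alpha> \<longlonglongrightarrow> a" using \<alpha>(1) a by (simp add: less_imp_le)
  then obtain M where M: "M > 0" "\<And>n. \<bar>\<alpha> n\<bar> \<le> M"
    using convergent_imp_Bseq[OF convergentI[OF lim\<alpha>]] by (auto simp: Bseq_def)
  define E where "E = (\<lambda>n. (\<alpha> n)\<^sup>2 * ((p (Suc n))\<^sup>2 + (p n)\<^sup>2) - (x - \<beta> n) * \<alpha> n * p n * p (Suc n))"
  define D where "D = (\<lambda>n. (p (Suc n))\<^sup>2 + (p n)\<^sup>2)"
  have D0: "D n \<ge> 0" for n by (simp add: D_def)
  have am: "\<bar>u * v\<bar> \<le> (v\<^sup>2 + u\<^sup>2) / 2" for u v :: real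
    using sum_squares_bound[of "\<bar>u\<bar>" "\<bar>v\<bar>"] by (simp add: abs_mult)
  \<comment> \<open>Half the limit of \<alpha>(\<alpha> - |x-\<beta>|/2), which is the smaller
    eigenvalue of the quadratic form \<open>E n\<close> in p_n and p_(n+1).\<close>
  define \<kappa> where "\<kappa> = a * (a - \<bar>x - b\<bar> / 2) / 2"
  have \<kappa>: "\<kappa> > 0" using a x by (simp add: \<kappa>_def)
  have "(\<lambda>n. \<alpha> n * (\<alpha> n - \<bar>x - \<beta> n\<bar> / 2)) \<longlonglongrightarrow> a * (a - \<bar>x - b\<bar> / 2)"
    using lim\<alpha> \<beta> by (intro tendsto_intros) (auto simp: bv_tendsto_def)
  moreover have "\<kappa> < a * (a - \<bar>x - b\<bar> / 2)" using \<kappa> by (simp add: \<kappa>_def)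
  ultimately have "eventually (\<lambda>n. \<alpha> n * (\<alpha> n - \<bar>x - \<beta> n\<bar> / 2) > \<kappa>) sequentially"
    by (rule order_tendstoD)
  then obtain N where N: "\<And>n. n \<ge> N \<Longrightarrow> \<alpha> n * (\<alpha> n - \<bar>x - \<beta> n\<bar> / 2) > \<kappa>"
    by (auto simp: eventually_sequentially)
  have lower: "\<kappa> * D n \<le> E n" if "n \<ge> N" for n
  proof -
    have "\<kappa> * D n \<le> \<alpha> n * (\<alpha> n - \<bar>x - \<beta> n\<bar> / 2) * D n"
      using N[OF that] D0 by (intro mult_right_mono) auto
    also have "\<dots> = (\<alpha> n)\<^sup>2 * D n - \<bar>x - \<beta> n\<bar> * \<alpha> n * (D n / 2)"
      by (simp add: algebra_simps power2_eq_square)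
    also have "\<dots> \<le> (\<alpha> n)\<^sup>2 * D n - \<bar>x - \<beta> n\<bar> * \<alpha> n * \<bar>p n * p (Suc n)\<bar>"
      using am[of "p n" "p (Suc n)"] \<alpha>(1)[of n] by (intro diff_left_mono mult_left_mono) (auto simp: D_def)
    also have "\<bar>x - \<beta> n\<bar> * \<alpha> n * \<bar>p n * p (Suc n)\<bar> = \<bar>(x - \<beta> n) * \<alpha> n * (p n * p (Suc n))\<bar>"
      using \<alpha>(1)[of n] by (simp add: abs_mult)
    also have "(\<alpha> n)\<^sup>2 * D n - \<bar>(x - \<beta> n) * \<alpha> n * (p n * p (Suc n))\<bar> \<le> E n"
      unfolding E_def D_def by (simp add: mult.assoc)
    finally show ?thesis .
  qed
  \<comment> \<open>A bound for the relative increase of \<open>E\<close> in one step. Its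
    summability is the bounded variation of the coefficients, so the product of the factors 1 +
    \<epsilon> n stays bounded.\<close>
  define \<epsilon> where "\<epsilon> = (\<lambda>n. (\<bar>(\<alpha> (Suc n))\<^sup>2 - (\<alpha> n)\<^sup>2\<bar> + M * \<bar>\<beta> (Suc n) - \<beta> n\<bar>) / \<kappa>)"
  have \<epsilon>0: "\<epsilon> n \<ge> 0" for n using M \<kappa> by (simp add: \<epsilon>_def)
  have sum\<epsilon>: "summable \<epsilon>"
    unfolding \<epsilon>_def using \<alpha>(2) \<beta> by (intro summable_divide summable_add summable_mult) (auto simp: bv_tendsto_def)
  have step: "E (Suc n) \<le> E n * (1 + \<epsilon> n)" if n: "n \<ge> N" for n
  proof -
    \<comment> \<open>By the recurrence u + v equals (x - \<beta>) p at index n+1. Substituted into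
      both forms this leaves -uv in each, which cancels in the difference.\<close>
    define u v where "u = \<alpha> (Suc n) * p (Suc (Suc n))" and "v = \<alpha> n * p n"
    have uv: "(x - \<beta> (Suc n)) * p (Suc n) = u + v" using rec[of n] by (simp add: u_def v_def algebra_simps)
    have "E (Suc n) = u\<^sup>2 + (\<alpha> (Suc n))\<^sup>2 * (p (Suc n))\<^sup>2 - ((x - \<beta> (Suc n)) * p (Suc n)) * u"
      unfolding E_def u_def power2_eq_square by (simp add: algebra_simps)
    note e1 = this[unfolded uv]
    have "E n = v\<^sup>2 + (\<alpha> n)\<^sup>2 * (p (Suc n))\<^sup>2 - ((x - \<beta> (Suc n)) * p (Suc n)) * v - (\<beta> (Suc n) - \<beta> n) * v * p (Suc n)"
      unfolding E_def v_def power2_eq_square by (simp add: algebra_simps)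
    note e2 = this[unfolded uv]
    have "E (Suc n) - E n = ((\<alpha> (Suc n))\<^sup>2 - (\<alpha> n)\<^sup>2) * (p (Suc n))\<^sup>2 + (\<beta> (Suc n) - \<beta> n) * (v * p (Suc n))"
      unfolding e1 e2 by algebra
    also have "v * p (Suc n) = \<alpha> n * (p n * p (Suc n))" by (simp add: v_def)
    also have "((\<alpha> (Suc n))\<^sup>2 - (\<alpha> n)\<^sup>2) * (p (Suc n))\<^sup>2 + (\<beta> (Suc n) - \<beta> n) * (\<alpha> n * (p n * p (Suc n)))
      \<le> \<bar>(\<alpha> (Suc n))\<^sup>2 - (\<alpha> n)\<^sup>2\<bar> * D n + \<bar>\<beta> (Suc n) - \<beta> n\<bar> * (M * D n)"
    proof (rule add_mono)
      show "((\<alpha> (Suc n))\<^sup>2 - (\<alpha> n)\<^sup>2) * (p (Suc n))\<^sup>2 \<le> \<bar>(\<alpha> (Suc n))\<^sup>2 - (\<alpha> n)\<^sup>2\<bar> * D n"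
        by (intro mult_mono) (auto simp: D_def)
      have "\<bar>\<alpha> n * (p n * p (Suc n))\<bar> \<le> M * D n"
        unfolding abs_mult[of "\<alpha> n"] using M(1) M(2)[of n] am[of "p n" "p (Suc n)"] D0[of n]
        by (intro mult_mono) (auto simp: D_def)
      then show "(\<beta> (Suc n) - \<beta> n) * (\<alpha> n * (p n * p (Suc n))) \<le> \<bar>\<beta> (Suc n) - \<beta> n\<bar> * (M * D n)"
        using mult_left_mono[of "\<bar>\<alpha> n * (p n * p (Suc n))\<bar>" "M * D n" "\<bar>\<beta> (Suc n) - \<beta> n\<bar>"]
          abs_ge_self[of "(\<beta> (Suc n) - \<beta> n) * (\<alpha> n * (p n * p (Suc n)))"]
        unfolding abs_mult[of "\<beta> (Suc n) - \<beta> n"] by linarith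
    qed
    also have "\<dots> = \<epsilon> n * (\<kappa> * D n)" using \<kappa> by (simp add: \<epsilon>_def field_simps)
    also have "\<dots> \<le> \<epsilon> n * E n" using lower[OF n] \<epsilon>0[of n] by (intro mult_left_mono)
    finally show ?thesis by (simp add: algebra_simps)
  qed
  have E0: "E n \<ge> 0" if "n \<ge> N" for n
    using lower[OF that] mult_nonneg_nonneg[OF less_imp_le[OF \<kappa>] D0[of n]] by linarith
  have bound: "E (N + k) \<le> E N * exp (\<Sum>i<k. \<epsilon> (N + i))" for k
  proof (induction k)
    case (Suc k)
    have "E (N + Suc k) \<le> E (N + k) * (1 + \<epsilon> (N + k))" using step[of "N + k"] by simp
    also have "\<dots> \<le> (E N * exp (\<Sum>i<k. \<epsilon> (N + i))) * exp (\<epsilon> (N + k))"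
      using Suc E0[of N] \<epsilon>0 exp_ge_add_one_self[of "\<epsilon> (N + k)"] by (intro mult_mono) auto
    finally show ?case by (simp add: exp_add)
  qed simp
  have "(p (N + k))\<^sup>2 \<le> E N * exp (\<Sum>i. \<epsilon> (N + i)) / \<kappa>" for k
  proof -
    have "summable (\<lambda>i. \<epsilon> (N + i))" using sum\<epsilon> by (simp add: summable_iff_shift add.commute[of N])
    then have "(\<Sum>i<k. \<epsilon> (N + i)) \<le> (\<Sum>i. \<epsilon> (N + i))" using \<epsilon>0 by (intro sum_le_suminf) auto
    then have "E (N + k) \<le> E N * exp (\<Sum>i. \<epsilon> (N + i))"
      using E0[of N] by (intro order_trans[OF bound] mult_left_mono) auto
    moreover have "\<kappa> * (p (N + k))\<^sup>2 \<le> \<kappa> * D (N + k)" using \<kappa> by (intro mult_left_mono) (auto simp: D_def)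
    ultimately have "\<kappa> * (p (N + k))\<^sup>2 \<le> E N * exp (\<Sum>i. \<epsilon> (N + i))" using lower[of "N + k"] by simp
    then show ?thesis using \<kappa> by (simp add: field_simps)
  qed
  then have "\<bar>p (N + k)\<bar> \<le> sqrt (E N * exp (\<Sum>i. \<epsilon> (N + i)) / \<kappa>)" for k
    by (metis real_sqrt_abs real_sqrt_le_mono)
  then have "Bseq (\<lambda>k. p (k + N))" by (intro BseqI') (simp add: add.commute)
  then show ?thesis by (simp add: Bseq_offset)
qed

text \<open>Abel summation turns the deviation from T into a mean of the remainders of the series,
  with nonnegative weights w_j - w_(j+1) of total mass 1. Every fixed block of these weights tends
  to 0, and the remainders are small beyond it.\<close>

lemma regular_summation:
  fixes t :: "nat \<Rightarrow> complex" and w :: "nat \<Rightarrow> nat \<Rightarrow> real"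
  assumes t: "t sums T" and w0: "\<And>n. w n 0 = 1" and mono: "\<And>n j. w n (Suc j) \<le> w n j" and w_zero: "\<And>n j. j > n \<Longrightarrow> w n j = 0"
    and lim: "\<And>j. (\<lambda>n. w n j) \<longlonglongrightarrow> 1"
  shows "(\<lambda>n. \<Sum>j\<le>n. of_real (w n j) * t j) \<longlonglongrightarrow> T"
proof -
  define r where "r = (\<lambda>j. T - (\<Sum>i<j. t i))"
  have r: "r \<longlonglongrightarrow> 0" unfolding r_def using tendsto_diff[OF tendsto_const[of T] t[unfolded sums_def]] by simp
  have abel: "(\<Sum>j\<le>k. of_real (w n j) * t j) = of_real (w n 0) * r 0 - (\<Sum>j<k. of_real (w n j - w n (Suc j)) * r (Suc j)) - of_real (w n k) * r (Suc k)" for n k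
  proof (induction k)
    case (Suc k)
    have tk: "t (Suc k) = r (Suc k) - r (Suc (Suc k))" by (simp add: r_def)
    show ?case unfolding sum.atMost_Suc Suc sum.lessThan_Suc tk by (simp add: algebra_simps)
  qed (simp add: r_def algebra_simps)
  have eq: "(\<Sum>j\<le>n. of_real (w n j) * t j) = T - (\<Sum>j\<le>n. of_real (w n j - w n (Suc j)) * r (Suc j))" for n
    unfolding abel[of n n] using w_zero[of n "Suc n"] by (simp add: w0 r_def lessThan_Suc_atMost[symmetric] del: sum.lessThan_Suc) (simp add: r_def)
  have "(\<lambda>n. \<Sum>j\<le>n. of_real (w n j - w n (Suc j)) * r (Suc j)) \<longlonglongrightarrow> 0"
  proof (rule LIMSEQ_I)
    fix e :: real assume e: "e > 0"
    obtain J where J: "\<And>j. j \<ge> J \<Longrightarrow> norm (r j) < e / 3" using LIMSEQ_D[OF r, of "e / 3"] e by auto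
    have "(\<lambda>n. \<Sum>j<J. (w n j - w n (Suc j)) * norm (r (Suc j))) \<longlonglongrightarrow> (\<Sum>j<J. (1 - 1) * norm (r (Suc j)))"
      by (intro tendsto_intros lim)
    then have lim0: "(\<lambda>n. \<Sum>j<J. (w n j - w n (Suc j)) * norm (r (Suc j))) \<longlonglongrightarrow> 0" by simp
    obtain N where N: "\<And>n. n \<ge> N \<Longrightarrow> norm (\<Sum>j<J. (w n j - w n (Suc j)) * norm (r (Suc j))) < e / 3"
      using LIMSEQ_D[OF lim0, of "e / 3"] e by auto
    have "norm (\<Sum>j\<le>n. of_real (w n j - w n (Suc j)) * r (Suc j)) < e" if n: "n \<ge> max N J" for n
    proof -
      have "norm (\<Sum>j\<le>n. of_real (w n j - w n (Suc j)) * r (Suc j)) \<le> (\<Sum>j\<le>n. (w n j - w n (Suc j)) * norm (r (Suc j)))"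
        using mono[of n] by (intro sum_norm_le) (simp add: norm_mult flip: of_real_diff)
      also have "\<dots> = (\<Sum>j\<in>{..<J} \<union> {J..n}. (w n j - w n (Suc j)) * norm (r (Suc j)))"
        using n by (intro sum.cong) auto
      also have "\<dots> = (\<Sum>j<J. (w n j - w n (Suc j)) * norm (r (Suc j))) + (\<Sum>j\<in>{J..n}. (w n j - w n (Suc j)) * norm (r (Suc j)))"
        by (rule sum.union_disjoint) auto
      also have "(\<Sum>j\<in>{J..n}. (w n j - w n (Suc j)) * norm (r (Suc j))) \<le> (\<Sum>j\<in>{J..n}. (w n j - w n (Suc j)) * (e / 3))"
        using J mono[of n] by (intro sum_mono mult_left_mono) (auto simp: less_imp_le)
      also have "\<dots> \<le> (\<Sum>j\<le>n. (w n j - w n (Suc j)) * (e / 3))"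
        using mono[of n] e by (intro sum_mono2) auto
      also have "\<dots> = (w n 0 - w n (Suc n)) * (e / 3)"
        unfolding sum_distrib_right[symmetric] using sum_telescope[of "w n" n] by simp
      also have "\<dots> = e / 3" using w0 w_zero by simp
      finally show ?thesis using N[of n] n e by simp
    qed
    then show "\<exists>no. \<forall>n\<ge>no. norm ((\<Sum>j\<le>n. of_real (w n j - w n (Suc j)) * r (Suc j)) - 0) < e"
      by (intro exI[of _ "max N J"]) simp
  qed
  then show ?thesis unfolding eq using tendsto_diff[OF tendsto_const[of T]] by fastforce
qed

text \<open>Eventually u n \<rho>^n increases along steps of two, so the smaller of two neighbouring
  starting values bounds it from below. Steps of two suit the Watson coefficients, whose Gamma
  arguments move by 1/2 per index.\<close>

lemma subexponential_lower_bound: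
  fixes u :: "nat \<Rightarrow> real"
  assumes pos: "eventually (\<lambda>n. u n > 0) sequentially" and lim: "(\<lambda>n. u (n + 2) / u n) \<longlonglongrightarrow> 1" and \<rho>: "\<rho> > 1"
  obtains \<kappa> J where "\<kappa> > 0" "\<And>n. n \<ge> J \<Longrightarrow> \<kappa> \<le> u n * \<rho> ^ n"
proof -
  have "1 / \<rho>\<^sup>2 < 1" using \<rho> by simp
  then have "eventually (\<lambda>n. u (n + 2) / u n > 1 / \<rho>\<^sup>2) sequentially" using lim order_tendstoD by blast
  with pos have "eventually (\<lambda>n. u n > 0 \<and> u (n + 2) / u n > 1 / \<rho>\<^sup>2) sequentially" by eventually_elim auto
  then obtain J where J: "\<And>n. n \<ge> J \<Longrightarrow> u n > 0" "\<And>n. n \<ge> J \<Longrightarrow> u (n + 2) / u n > 1 / \<rho>\<^sup>2"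
    by (auto simp: eventually_sequentially)
  have step: "u n * \<rho> ^ n \<le> u (n + 2) * \<rho> ^ (n + 2)" if "n \<ge> J" for n
  proof -
    have "u n \<le> u (n + 2) * \<rho>\<^sup>2" using J[OF that] \<rho> by (simp add: field_simps)
    then have "u n * \<rho> ^ n \<le> u (n + 2) * \<rho>\<^sup>2 * \<rho> ^ n" using \<rho> by (intro mult_right_mono) auto
    then show ?thesis by (simp add: power2_eq_square mult_ac)
  qed
  define \<kappa> where "\<kappa> = min (u J * \<rho> ^ J) (u (Suc J) * \<rho> ^ Suc J)"
  have "\<kappa> > 0" using J(1)[of J] J(1)[of "Suc J"] \<rho> by (simp add: \<kappa>_def)
  moreover have "\<kappa> \<le> u (J + k) * \<rho> ^ (J + k)" for k
  proof (induction k rule: less_induct)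
    case (less k)
    consider "k = 0" | "k = 1" | i where "k = i + 2" using le_Suc_ex[of 2 k] by (metis One_nat_def add.commute leI less_2_cases)
    then show ?case
    proof cases
      case 3
      then show ?thesis using less[of i] step[of "J + i"] by (simp add: add.assoc)
    qed (auto simp: \<kappa>_def)
  qed
  ultimately show ?thesis using that[of \<kappa> J] by (metis le_Suc_ex)
qed

subsection \<open>Orthonormal Jacobi polynomials\<close>

lemma of_real_rec:
  "of_real (recA s n) = recA (of_real s :: complex) n"
  "of_real (recB f s n) = recB (of_real f) (of_real s :: complex) n"
  "of_real (recG f s n) = recG (of_real f) (of_real s :: complex) n"
  "of_real (conn f s m n) = conn (of_real f) (of_real s :: complex) m n"
proof -
  have p: "pochhammer (of_real x + of_nat j - 1 :: complex) m = of_real (pochhammer (x + of_nat j - 1) m)"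
    "pochhammer (of_real x + of_nat j :: complex) m = of_real (pochhammer (x + of_nat j) m)"
    "pochhammer (of_real x + 2 * of_nat j :: complex) m = of_real (pochhammer (x + 2 * of_nat j) m)" for x j m
    by (simp_all flip: pochhammer_of_real)
  show "of_real (recA s n) = recA (of_real s :: complex) n"
    "of_real (recB f s n) = recB (of_real f) (of_real s :: complex) n"
    "of_real (recG f s n) = recG (of_real f) (of_real s :: complex) n"
    by (simp_all add: recA_def recB_def recG_def)
  show "of_real (conn f s m n) = conn (of_real f) (of_real s :: complex) m n"
    by (simp add: conn_def p)
qed

locale jacobi_params =
  fixes f d :: real
  assumes f: "f > 0" and d: "d > 0"
begin

definition s :: real where "s = f + d"

lemma s: "s > 0" using f d by (simp add: s_def)

text \<open>The squared norm of K_n for the normalised Beta weight: comparing the inner products of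
  x K_n with K_(n+1) and of K_n with x K_(n+1) gives these quotients.\<close>

definition h :: "nat \<Rightarrow> real" where "h n = (\<Prod>i<n. recG f s (Suc i) / recA s i)"

text \<open>The off-diagonal entries of the symmetric Jacobi matrix obtained after normalisation;
  the diagonal entries remain \<open>recB\<close>.\<close>

definition \<alpha> :: "nat \<Rightarrow> real" where "\<alpha> n = sqrt (recA s n * recG f s (Suc n))"

abbreviation \<beta> :: "nat \<Rightarrow> real" where "\<beta> \<equiv> recB f s"

abbreviation K :: "nat \<Rightarrow> complex \<Rightarrow> complex" where "K n x \<equiv> jacobiK n x (of_real f) (of_real d)"

definition p :: "nat \<Rightarrow> complex \<Rightarrow> complex" where "p n x = K n x / of_real (sqrt (h n))"

text \<open>The coefficient of the orthonormal polynomial p_j in x^m, that is, the inner product of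
  the two.\<close>

definition q :: "nat \<Rightarrow> nat \<Rightarrow> real" where "q m j = conn f s m j * sqrt (h j)"

lemma s_nz: "s + of_nat i \<noteq> 0" using s by (metis add_pos_nonneg of_nat_0_le_iff less_irrefl)

lemma s_nz_complex: "complex_of_real f + of_real d + of_nat i \<noteq> 0"
proof -
  have "complex_of_real f + of_real d + of_nat i = of_real (s + of_nat i)" by (simp add: s_def)
  then show ?thesis using s_nz[of i] of_real_eq_0_iff by metis
qed

lemma recA_pos: "recA s n > 0"
proof (cases n)
  case (Suc m)
  then show ?thesis using s by (simp add: recA_def)
qed (use s in \<open>simp add: recA_def\<close>)

lemma recG_pos: "recG f s (Suc n) > 0"
  using f d by (simp add: recG_def s_def)

lemma h_pos: "h n > 0"
  unfolding h_def using recA_pos recG_pos by (intro prod_pos) auto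

lemma h_0 [simp]: "h 0 = 1" by (simp add: h_def)

lemma h_Suc: "h (Suc n) * recA s n = h n * recG f s (Suc n)"
  using recA_pos[of n] by (simp add: h_def)

lemma \<alpha>_pos: "\<alpha> n > 0"
  unfolding \<alpha>_def using recA_pos recG_pos by simp

lemma \<alpha>_sq: "(\<alpha> n)\<^sup>2 = recA s n * recG f s (Suc n)"
  unfolding \<alpha>_def using recA_pos[of n] recG_pos[of n] by (simp add: less_imp_le)

lemma sqrt_h_Suc: "sqrt (h (Suc n)) * recA s n = sqrt (h n) * \<alpha> n"
proof (rule power2_eq_imp_eq)
  have "h (Suc n) * (recA s n)\<^sup>2 = (h (Suc n) * recA s n) * recA s n" by (simp add: power2_eq_square)
  also have "\<dots> = h n * (recA s n * recG f s (Suc n))" unfolding h_Suc by simp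
  finally show "(sqrt (h (Suc n)) * recA s n)\<^sup>2 = (sqrt (h n) * \<alpha> n)\<^sup>2"
    using h_pos[of n] h_pos[of "Suc n"] by (simp add: power_mult_distrib \<alpha>_sq less_imp_le)
qed (use recA_pos[of n] \<alpha>_pos[of n] h_pos in \<open>auto simp: less_imp_le\<close>)

lemma sqrt_h_Suc': "sqrt (h n) * recG f s (Suc n) = sqrt (h (Suc n)) * \<alpha> n"
proof -
  have "recA s n * (sqrt (h n) * recG f s (Suc n)) = sqrt (h n) * (\<alpha> n)\<^sup>2" by (simp add: \<alpha>_sq)
  also have "\<dots> = recA s n * (sqrt (h (Suc n)) * \<alpha> n)"
    using sqrt_h_Suc[of n] by (simp add: power2_eq_square mult_ac)
  finally show ?thesis using recA_pos[of n] by simp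
qed

lemma sqrt_h_pos: "sqrt (h n) > 0" using h_pos by simp

lemma p_0 [simp]: "p 0 x = 1" by (simp add: p_def)

lemma K_eq: "K n x = of_real (sqrt (h n)) * p n x"
  using h_pos[of n] by (simp add: p_def)

lemma p_rec: "x * p n x = of_real (\<alpha> n) * p (Suc n) x + of_real (\<beta> n) * p n x + (if n = 0 then 0 else of_real (\<alpha> (n - 1)) * p (n - 1) x)"
proof -
  let ?r = "\<lambda>n. complex_of_real (sqrt (h n))"
  have nz: "complex_of_real f + of_real d + 2 * of_nat n \<noteq> 0" using s_nz_complex[of "2 * n"] by simp
  have nz': "complex_of_real f + of_real d + 2 * of_nat n - 1 \<noteq> 0" "complex_of_real f + of_real d + 2 * of_nat n - 2 \<noteq> 0" if "n > 0"
    using s_nz_complex[of "2 * n - 1"] s_nz_complex[of "2 * n - 2"] that by (simp_all add: of_nat_diff algebra_simps)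
  have sc: "complex_of_real f + of_real d = of_real s" by (simp add: s_def)
  have "x * K n x = of_real (recA s n) * K (Suc n) x + of_real (\<beta> n) * K n x
    + (if n = 0 then 0 else of_real (recG f s n) * K (n - 1) x)"
    using jacobiK_rec[OF nz nz', of x] unfolding sc of_real_rec by blast
  then have "?r n * (x * p n x) = of_real (recA s n * sqrt (h (Suc n))) * p (Suc n) x + of_real (\<beta> n) * (?r n * p n x)
    + (if n = 0 then 0 else of_real (recG f s n * sqrt (h (n - 1))) * p (n - 1) x)"
    unfolding K_eq by (simp add: mult_ac)
  also have "recA s n * sqrt (h (Suc n)) = sqrt (h n) * \<alpha> n" using sqrt_h_Suc[of n] by (simp add: mult_ac)
  also have "(if n = 0 then 0 else of_real (recG f s n * sqrt (h (n - 1))) * p (n - 1) x) = ?r n * (if n = 0 then 0 else of_real (\<alpha> (n - 1)) * p (n - 1) x)"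
  proof (cases n)
    case (Suc m)
    have "recG f s (Suc m) * sqrt (h m) = sqrt (h (Suc m)) * \<alpha> m" using sqrt_h_Suc'[of m] by (simp add: mult_ac)
    then show ?thesis by (simp add: Suc flip: of_real_mult)
  qed simp
  finally have "?r n * (x * p n x) = ?r n * (of_real (\<alpha> n) * p (Suc n) x + of_real (\<beta> n) * p n x + (if n = 0 then 0 else of_real (\<alpha> (n - 1)) * p (n - 1) x))"
    by (simp add: algebra_simps)
  then show ?thesis using sqrt_h_pos[of n] by (simp only: mult_cancel_left) auto
qed

lemma q_eq_0 [simp]: "m < j \<Longrightarrow> q m j = 0" by (simp add: q_def)

lemma q_0_left: "q 0 j = (if j = 0 then 1 else 0)" by (simp add: q_def conn_0_left)

lemma q_rec: "q (Suc m) j = (if j = 0 then 0 else \<alpha> (j - 1) * q m (j - 1)) + \<beta> j * q m j + \<alpha> j * q m (Suc j)"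
proof -
  have "q (Suc m) j = sqrt (h j) * ((if j = 0 then 0 else recA s (j - 1) * conn f s m (j - 1))
    + \<beta> j * conn f s m j + recG f s (Suc j) * conn f s m (Suc j))"
    unfolding q_def by (subst conn_rec) (use s_nz in auto)
  also have "\<dots> = (if j = 0 then 0 else (sqrt (h j) * recA s (j - 1)) * conn f s m (j - 1))
    + \<beta> j * q m j + (sqrt (h j) * recG f s (Suc j)) * conn f s m (Suc j)"
    by (simp add: q_def algebra_simps)
  also have "(if j = 0 then 0 else (sqrt (h j) * recA s (j - 1)) * conn f s m (j - 1)) = (if j = 0 then 0 else \<alpha> (j - 1) * q m (j - 1))"
    using sqrt_h_Suc[of "j - 1"] by (cases j) (simp_all add: q_def)
  also have "(sqrt (h j) * recG f s (Suc j)) * conn f s m (Suc j) = \<alpha> j * q m (Suc j)"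
    unfolding sqrt_h_Suc' by (simp add: q_def)
  finally show ?thesis .
qed

lemma power_eq_sum_p: "m \<le> N \<Longrightarrow> x ^ m = (\<Sum>j\<le>N. of_real (q m j) * p j x)"
proof -
  assume N: "m \<le> N"
  have sc: "complex_of_real f + of_real d = of_real s" by (simp add: s_def)
  have "x ^ m = (\<Sum>j\<le>m. conn (of_real f) (of_real f + of_real d) m j * K j x)"
    by (rule power_eq_sum_jacobiK) (rule s_nz_complex)
  also have "\<dots> = (\<Sum>j\<le>m. of_real (q m j) * p j x)"
    unfolding sc of_real_rec[symmetric] by (intro sum.cong) (simp_all add: q_def K_eq)
  also have "\<dots> = (\<Sum>j\<le>N. of_real (q m j) * p j x)"
    using N by (intro sum.mono_neutral_left) auto
  finally show ?thesis .
qed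

text \<open>The matrix of multiplication by $x$ in the orthonormal basis \<^term>\<open>p\<close> is symmetric, so
  \<open>\<langle>x\<^sup>m, x\<^sup>m\<rangle> = \<langle>x\<^bsup>2m\<^esup>, 1\<rangle>\<close>, which is a moment of the Beta distribution.\<close>

lemma q_symmetric:
  assumes "m < M" "n < M"
  shows "(\<Sum>j\<le>M. q (Suc m) j * q n j) = (\<Sum>j\<le>M. q m j * q (Suc n) j)"
proof -
  obtain M' where M: "M = Suc M'" using assms by (cases M) auto
  have shift: "(\<Sum>j\<le>M. (if j = 0 then 0 else \<alpha> (j - 1) * q k (j - 1)) * q l j) = (\<Sum>j\<le>M. \<alpha> j * q l (Suc j) * q k j)" if "l < M" for k l
  proof -
    have "(\<Sum>j\<le>M. (if j = 0 then 0 else \<alpha> (j - 1) * q k (j - 1)) * q l j) = (\<Sum>j\<le>M'. \<alpha> j * q k j * q l (Suc j))"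
      unfolding M sum.atMost_Suc_shift by simp
    also have "\<dots> = (\<Sum>j\<le>M. \<alpha> j * q l (Suc j) * q k j)"
      unfolding M using that by (simp add: M mult_ac)
    finally show ?thesis .
  qed
  have "(\<Sum>j\<le>M. q (Suc m) j * q n j) = (\<Sum>j\<le>M. (if j = 0 then 0 else \<alpha> (j - 1) * q m (j - 1)) * q n j) + (\<Sum>j\<le>M. \<beta> j * q m j * q n j) + (\<Sum>j\<le>M. \<alpha> j * q m (Suc j) * q n j)"
    unfolding q_rec[of m] by (simp only: distrib_right sum.distrib)
  also have "\<dots> = (\<Sum>j\<le>M. \<alpha> j * q n (Suc j) * q m j) + (\<Sum>j\<le>M. \<beta> j * q m j * q n j) + (\<Sum>j\<le>M. (if j = 0 then 0 else \<alpha> (j - 1) * q n (j - 1)) * q m j)"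
    using shift[OF assms(2)] shift[OF assms(1)] by simp
  also have "\<dots> = (\<Sum>j\<le>M. q m j * ((if j = 0 then 0 else \<alpha> (j - 1) * q n (j - 1)) + \<beta> j * q n j + \<alpha> j * q n (Suc j)))"
    by (simp only: distrib_left sum.distrib) (simp only: mult_ac add_ac)
  finally show ?thesis unfolding q_rec[of n] .
qed

lemma sum_q_square_le_1: "(\<Sum>j\<le>m. (q m j)\<^sup>2) \<le> 1"
proof -
  \<comment> \<open>One factor x is moved at a time. The range up to 2m + 1 exceeds every degree
    involved, so symmetry holds without boundary terms.\<close>
  have move: "(\<Sum>j\<le>2 * m + 1. q (m + k) j * q (m - k) j) = (\<Sum>j\<le>2 * m + 1. q m j * q m j)" if "k \<le> m" for k
    using that
  proof (induction k)
    case (Suc k)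
    then have "m - k = Suc (m - Suc k)" by simp
    then show ?case using Suc q_symmetric[of "m + k" "2 * m + 1" "m - Suc k"] by simp
  qed simp
  have "(\<Sum>j\<le>m. (q m j)\<^sup>2) = (\<Sum>j\<le>2 * m + 1. q m j * q m j)"
    unfolding power2_eq_square by (intro sum.mono_neutral_left) auto
  also have "\<dots> = (\<Sum>j\<le>2 * m + 1. q (2 * m) j * q 0 j)"
    using move[of m] by (simp add: mult_2)
  also have "\<dots> = q (2 * m) 0"
    by (simp add: q_0_left if_distrib[of "\<lambda>x. _ * x"] sum.delta cong: if_cong del: sum.atMost_Suc)
  also have "\<dots> = pochhammer f (2 * m) / pochhammer s (2 * m)" by (simp add: q_def conn_0_right)
  also have "\<dots> \<le> 1"
    using f d pochhammer_pos[OF s, of "2 * m"] by (auto simp: s_def pochhammer_prod intro!: prod_mono)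
  finally show ?thesis .
qed

text \<open>Bessel's inequality for x^m, whose norm is at most 1 for a probability measure on [0,1].
  This bound, uniform in m and j, dominates the series in m below.\<close>

lemma abs_q_le_1: "\<bar>q m j\<bar> \<le> 1"
proof (cases "j \<le> m")
  case True
  then have "(q m j)\<^sup>2 \<le> (\<Sum>j\<le>m. (q m j)\<^sup>2)" by (intro member_le_sum) auto
  also have "\<dots> \<le> 1" by (rule sum_q_square_le_1)
  finally show ?thesis by (simp add: abs_square_le_1)
qed simp

text \<open>With the limits 1/4 here and 1/2 for \<open>recB\<close>, the condition |x - 1/2| < 2
  (1/4) of the boundedness theorem describes exactly the open unit interval. The shift to n + 1
  avoids the exceptional index 0 and the denominator s - 1.\<close>

lemma bv_\<alpha>: "bv_tendsto (\<lambda>n. (\<alpha> (Suc n))\<^sup>2) ((1 / 4)\<^sup>2)"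
proof -
  have "bv_tendsto (\<lambda>n. 1 / 16 * ((real n + 2) / (real n + (s + 1) / 2) * ((real n + s) / (real n + (s + 2) / 2)) * ((real n + (f + 1)) / (real n + (s + 3) / 2) * ((real n + (d + 1)) / (real n + (s + 2) / 2)))))
     (1 / 16 * (1 * 1 * (1 * 1)))"
    using s by (intro bv_tendsto_mult bv_tendsto_const bv_tendsto_quotient) auto
  moreover have "1 / 16 * ((real n + 2) / (real n + (s + 1) / 2) * ((real n + s) / (real n + (s + 2) / 2)) * ((real n + (f + 1)) / (real n + (s + 3) / 2) * ((real n + (d + 1)) / (real n + (s + 2) / 2)))) = (\<alpha> (Suc n))\<^sup>2" for n
  proof -
    have e: "real n + (s + 1) / 2 = (s + 2 * real (Suc n) - 1) / 2" "real n + (s + 2) / 2 = (s + 2 * real (Suc n)) / 2" "real n + (s + 3) / 2 = (s + 2 * real (Suc (Suc n)) - 1) / 2"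
       "s + 2 * real (Suc n) = s + 2 * real (Suc (Suc n)) - 2"
      by (simp_all add: field_simps)
    have sf: "s - f = d" by (simp add: s_def)
    have "(\<alpha> (Suc n))\<^sup>2 = (real n + 2) * (real n + s) / ((s + 2 * real (Suc n) - 1) * (s + 2 * real (Suc n))) * ((real n + (f + 1)) * (real n + (d + 1)) / ((s + 2 * real (Suc (Suc n)) - 1) * (s + 2 * real (Suc n))))"
      unfolding \<alpha>_sq recA_def recG_def sf e(4) by (simp add: algebra_simps)
    moreover have "1 / 16 * (a / (A / 2) * (b / (B / 2)) * (c / (C / 2) * (e / (B / 2)))) = a * b / (A * B) * (c * e / (C * B))" for a b c e A B C :: real
      by simp
    ultimately show ?thesis unfolding e(1-3) by (simp only:)
  qed
  ultimately show ?thesis by (simp add: power2_eq_square)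
qed

text \<open>Rests on the closed form 1/2 + (f-d)(s-2) / (2(s+2j-2)(s+2j)) of \<open>recB\<close> for
  j = n + 1.\<close>

lemma bv_\<beta>: "bv_tendsto (\<lambda>n. \<beta> (Suc n)) (1 / 2)"
proof -
  have "bv_tendsto (\<lambda>n. 1 / 2 + (f - d) * (s - 2) / 8 * (1 / (real n + s / 2) * (1 / (real n + (s + 2) / 2)))) (1 / 2 + (f - d) * (s - 2) / 8 * (0 * 0))"
    using s by (intro bv_tendsto_add bv_tendsto_mult bv_tendsto_const bv_tendsto_inverse) auto
  moreover have "1 / 2 + (f - d) * (s - 2) / 8 * (1 / (real n + s / 2) * (1 / (real n + (s + 2) / 2))) = \<beta> (Suc n)" for n
  proof -
    define r where "r = s + 2 * real n"
    have r: "r > 0" using s by (simp add: r_def)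
    have e: "real n + s / 2 = r / 2" "real n + (s + 2) / 2 = (r + 2) / 2" "s + 2 * real (Suc n) = r + 2" "s + 2 * real (Suc n) - 2 = r"
      by (simp_all add: r_def field_simps)
    have "8 * (r * (r + 2)) * (1 / 2 + (f - d) * (s - 2) / 8 * (1 / (r / 2) * (1 / ((r + 2) / 2)))) = 4 * r * (r + 2) + 4 * (f - d) * (s - 2)"
    proof -
      have "8 * R * (1 / 2 + (f - d) * (s - 2) / 8 * (4 / R)) = 4 * R + 4 * (f - d) * (s - 2)" if "R \<noteq> 0" for R
        using that by (simp add: field_simps)
      from this[of "r * (r + 2)"] show ?thesis using r by simp
    qed
    also have "\<dots> = 8 * ((real (Suc n) + 1) * (f + real (Suc n)) * r - real (Suc n) * (f + real (Suc n) - 1) * (r + 2))"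
      unfolding r_def s_def by (simp add: algebra_simps)
    also have "\<dots> = 8 * (r * (r + 2)) * \<beta> (Suc n)"
    proof -
      have "8 * (X * r - Y * (r + 2)) = 8 * (r * (r + 2)) * (X / (r + 2) - Y / r)" for X Y
        using r by (simp add: divide_simps)
      moreover have "r + 2 - 2 = r" by simp
      ultimately show ?thesis unfolding recB_def e by (simp only:)
    qed
    finally show ?thesis unfolding e using r by simp
  qed
  ultimately show ?thesis by simp
qed

lemma p_bounded:
  assumes "0 < x" "x < 1"
  shows "Bseq (\<lambda>n. p n (of_real x))"
proof -
  have rec: "of_real x * p (Suc (Suc n)) (of_real x) = of_real (\<alpha> (Suc (Suc n))) * p (Suc (Suc (Suc n))) (of_real x) + of_real (\<beta> (Suc (Suc n))) * p (Suc (Suc n)) (of_real x) + of_real (\<alpha> (Suc n)) * p (Suc n) (of_real x)" for n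
    using p_rec[of "of_real x" "Suc (Suc n)"] by simp
  have "Bseq (\<lambda>n. Re (p (Suc n) (of_real x)))"
  proof (rule three_term_bounded[OF _ _ bv_\<alpha> bv_\<beta>])
    show "x * Re (p (Suc (Suc n)) (of_real x)) = \<alpha> (Suc (Suc n)) * Re (p (Suc (Suc (Suc n))) (of_real x)) + \<beta> (Suc (Suc n)) * Re (p (Suc (Suc n)) (of_real x)) + \<alpha> (Suc n) * Re (p (Suc n) (of_real x))" for n
      using arg_cong[OF rec[of n], of Re] by simp
  qed (use assms \<alpha>_pos in \<open>auto simp: abs_if\<close>)
  moreover have "Bseq (\<lambda>n. Im (p (Suc n) (of_real x)))"
  proof (rule three_term_bounded[OF _ _ bv_\<alpha> bv_\<beta>])
    show "x * Im (p (Suc (Suc n)) (of_real x)) = \<alpha> (Suc (Suc n)) * Im (p (Suc (Suc (Suc n))) (of_real x)) + \<beta> (Suc (Suc n)) * Im (p (Suc (Suc n)) (of_real x)) + \<alpha> (Suc n) * Im (p (Suc n) (of_real x))" for n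
      using arg_cong[OF rec[of n], of Im] by simp
  qed (use assms \<alpha>_pos in \<open>auto simp: abs_if\<close>)
  ultimately obtain M N where "\<And>n. \<bar>Re (p (Suc n) (of_real x))\<bar> \<le> M" "\<And>n. \<bar>Im (p (Suc n) (of_real x))\<bar> \<le> N"
    by (auto simp: Bseq_def)
  then have "norm (p (Suc n) (of_real x)) \<le> M + N" for n
    using cmod_le[of "p (Suc n) (of_real x)"] by (meson add_mono order_trans)
  then have "Bseq (\<lambda>n. p (Suc n) (of_real x))" by (rule BseqI')
  then show ?thesis using Bseq_Suc_iff by blast
qed

lemma \<alpha>_bounded: "Bseq \<alpha>"
proof -
  have "(\<lambda>n. sqrt ((\<alpha> (Suc n))\<^sup>2)) \<longlonglongrightarrow> sqrt ((1 / 4)\<^sup>2)"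
    using bv_\<alpha> by (intro tendsto_real_sqrt) (simp add: bv_tendsto_def)
  then have "(\<lambda>n. \<alpha> (Suc n)) \<longlonglongrightarrow> 1 / 4" using \<alpha>_pos by (simp add: less_imp_le)
  then show ?thesis using Bseq_Suc_iff convergentI convergent_imp_Bseq by blast
qed

end

subsection \<open>Convergence on the unit interval\<close>

context jacobi_params
begin

text \<open>The Fourier coefficients, in the orthonormal basis, of the function with power series
  coefficients c.\<close>

definition C :: "(nat \<Rightarrow> complex) \<Rightarrow> nat \<Rightarrow> complex" where
  "C c j = (\<Sum>m. c m * of_real (q m j))"

lemma summable_C:
  fixes c :: "nat \<Rightarrow> complex"
  assumes "summable (\<lambda>m. norm (c m))"
  shows "summable (\<lambda>m. c m * of_real (q m j))"
proof (rule summable_comparison_test[OF _ assms])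
  show "\<exists>N. \<forall>m\<ge>N. norm (c m * of_real (q m j)) \<le> norm (c m)"
    by (auto simp: norm_mult intro!: mult_left_le abs_q_le_1)
qed

text \<open>For fixed m only the indices j <= m contribute, and |q| <= 1 supplies the majorant |c
  m|.\<close>

lemma C_tendsto_0:
  assumes "summable (\<lambda>m. norm (c m))"
  shows "C c \<longlonglongrightarrow> 0"
proof -
  have "(\<lambda>j. suminf (\<lambda>m. c m * of_real (q m j))) \<longlonglongrightarrow> suminf (\<lambda>m::nat. 0 :: complex)"
  proof (rule tannerys_theorem[THEN conjunct2, THEN conjunct2])
    show "(\<lambda>j. c m * of_real (q m j)) \<longlonglongrightarrow> 0" for m
    proof (rule tendsto_eventually)
      show "eventually (\<lambda>j. c m * of_real (q m j) = 0) sequentially"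
        using eventually_gt_at_top[of m] by eventually_elim simp
    qed
    show "eventually (\<lambda>(m, j). norm (c m * of_real (q m j)) \<le> norm (c m)) (at_top \<times>\<^sub>F sequentially)"
      by (intro always_eventually) (auto simp: norm_mult intro!: mult_left_le abs_q_le_1)
  qed (use assms in simp_all)
  then show ?thesis by (simp add: C_def[abs_def])
qed

lemma sum_C_p:
  assumes "summable (\<lambda>m. norm (c m))"
  shows "(\<Sum>j\<in>J. C c j * z j) = (\<Sum>m. c m * (\<Sum>j\<in>J. of_real (q m j) * z j))"
proof -
  have "(\<Sum>j\<in>J. C c j * z j) = (\<Sum>j\<in>J. \<Sum>m. c m * of_real (q m j) * z j)"
    unfolding C_def by (intro sum.cong refl suminf_mult2 summable_C assms)
  also have "\<dots> = (\<Sum>m. \<Sum>j\<in>J. c m * of_real (q m j) * z j)"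
    by (intro suminf_sum[symmetric] summable_mult2 summable_C assms)
  also have "\<dots> = (\<Sum>m. c m * (\<Sum>j\<in>J. of_real (q m j) * z j))"
    by (simp only: sum_distrib_left mult.assoc)
  finally show ?thesis .
qed

lemma sums_at_1:
  assumes c: "summable (\<lambda>m. norm (c m))"
  shows "(\<lambda>j. C c j * p j 1) sums (\<Sum>m. c m)"
proof -
  \<comment> \<open>The partial sums of the expansion of 1^m at x = 1. Their terms are nonnegative
    and add up to 1, so they stay in [0,1] and equal 1 once N > m.\<close>
  define r where "r = (\<lambda>N m. \<Sum>j<N. q m j * (pochhammer d j / fact j / sqrt (h j)))"
  have p1: "p j 1 = of_real (pochhammer d j / fact j / sqrt (h j))" for j
    by (simp add: p_def jacobiK_at_1 pochhammer_of_real)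
  have q0: "q m j \<ge> 0" for m j
    unfolding q_def conn_def using s f h_pos[of j]
    by (cases j) (auto intro!: mult_nonneg_nonneg divide_nonneg_nonneg pochhammer_nonneg simp: add_pos_nonneg less_imp_le)
  have nn: "q m j * (pochhammer d j / fact j / sqrt (h j)) \<ge> 0" for m j
    using q0[of m j] d h_pos[of j] by (intro mult_nonneg_nonneg divide_nonneg_nonneg pochhammer_nonneg) auto
  have r1: "r N m = 1" if "N > m" for N m
  proof -
    obtain N' where N': "N = Suc N'" using \<open>N > m\<close> by (cases N) auto
    then have N: "N = Suc N'" "m \<le> N'" using \<open>N > m\<close> by auto
    have "complex_of_real (r N m) = (\<Sum>j\<le>N'. of_real (q m j) * p j 1)"
      by (simp add: r_def N p1 lessThan_Suc_atMost)
    also have "\<dots> = 1" using power_eq_sum_p[OF N(2), of 1] by simp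
    finally show ?thesis by simp
  qed
  have r_le: "\<bar>r N m\<bar> \<le> 1" for N m
  proof -
    have "r N m \<le> r (N + Suc m) m" unfolding r_def using nn by (intro sum_mono2) auto
    moreover have "r N m \<ge> 0" unfolding r_def using nn by (intro sum_nonneg) auto
    ultimately show ?thesis using r1[of m "N + Suc m"] by simp
  qed
  have "(\<lambda>N. suminf (\<lambda>m. c m * of_real (r N m))) \<longlonglongrightarrow> suminf c"
  proof (rule tannerys_theorem[THEN conjunct2, THEN conjunct2])
    show "(\<lambda>N. c m * of_real (r N m)) \<longlonglongrightarrow> c m" for m
    proof (rule tendsto_eventually)
      show "eventually (\<lambda>N. c m * of_real (r N m) = c m) sequentially"
        using eventually_gt_at_top[of m] by eventually_elim (simp add: r1)
    qed
    show "eventually (\<lambda>(m, N). norm (c m * of_real (r N m)) \<le> norm (c m)) (at_top \<times>\<^sub>F sequentially)"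
      by (intro always_eventually) (auto simp: norm_mult intro!: mult_left_le r_le)
  qed (use c in simp_all)
  moreover have "(\<Sum>j<N. C c j * p j 1) = suminf (\<lambda>m. c m * of_real (r N m))" for N
    unfolding sum_C_p[OF c] by (simp add: r_def p1)
  ultimately show ?thesis by (simp add: sums_def)
qed

text \<open>A Christoffel--Darboux argument: writing \<open>F(y) = F(x) + (y - x) g(y)\<close>, the partial sums of
  the expansion of \<open>F\<close> at \<open>x\<close> telescope in terms of the coefficients of \<open>g\<close>.\<close>

lemma sums_interior:
  assumes c: "summable (\<lambda>m. norm (c m))" and x: "0 < x" "x < 1"
  shows "(\<lambda>j. C c j * p j (of_real x)) sums (\<Sum>m. c m * of_real x ^ m)"
proof -
  define y where "y = complex_of_real x"
  have ny: "norm y = x" using x by (simp add: y_def)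
  have sum_shift: "summable (\<lambda>k. norm (c (i + k) * y ^ k))" for i
  proof (rule summable_comparison_test)
    show "\<exists>N. \<forall>n\<ge>N. norm (norm (c (i + n) * y ^ n)) \<le> norm (c (n + i))"
      using x by (intro exI[of _ 0]) (auto simp: norm_mult norm_power ny add.commute intro!: mult_left_le power_le_one)
    show "summable (\<lambda>n. norm (c (n + i)))" using c by (simp add: summable_iff_shift[of "\<lambda>n. norm (c n)" i])
  qed
  \<comment> \<open>The power series coefficients of the divided difference of F at the fixed point
    y.\<close>
  define g where "g = (\<lambda>i. \<Sum>k. c (Suc i + k) * y ^ k)"
  have tail: "(\<Sum>k. c (i + k) * y ^ k) = c i + y * g i" for i
  proof -
    have "(\<Sum>k. c (i + k) * y ^ k) = (\<Sum>k. c (i + Suc k) * y ^ Suc k) + c i"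
      using suminf_split_head[OF summable_norm_cancel[OF sum_shift[of i]]] by simp
    also have "(\<Sum>k. c (i + Suc k) * y ^ Suc k) = (\<Sum>k. y * (c (Suc i + k) * y ^ k))"
      by (simp add: mult_ac)
    also have "\<dots> = y * g i"
      unfolding g_def by (rule suminf_mult) (rule summable_norm_cancel[OF sum_shift])
    finally show ?thesis by simp
  qed
  have c0: "(\<Sum>m. c m * y ^ m) = c 0 + y * g 0" using tail[of 0] by simp
  have c_Suc: "c (Suc i) = g i - y * g (Suc i)" for i using tail[of "Suc i"] by (simp add: g_def)
  have g_le: "norm (g i) \<le> (\<Sum>m. norm (c m))" for i
  proof -
    have "norm (g i) \<le> (\<Sum>k. norm (c (Suc i + k) * y ^ k))" unfolding g_def by (rule summable_norm) (rule sum_shift)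
    also have "\<dots> \<le> (\<Sum>k. norm (c (k + Suc i)))"
    proof (rule suminf_le)
      show "norm (c (Suc i + n) * y ^ n) \<le> norm (c (n + Suc i))" for n
        using x by (auto simp: norm_mult norm_power ny add.commute intro!: mult_left_le power_le_one)
      show "summable (\<lambda>n. norm (c (n + Suc i)))" using c by (simp only: summable_iff_shift[of "\<lambda>n. norm (c n)" "Suc i"])
    qed (rule sum_shift)
    also have "\<dots> \<le> (\<Sum>m. norm (c m))"
      using suminf_split_initial_segment[OF c, of "Suc i"] sum_nonneg[of "{..<Suc i}" "\<lambda>m. norm (c m)"] by simp
    finally show ?thesis .
  qed
  let ?S = "\<Sum>m. norm (c m)"
  have S0: "?S \<ge> 0" using c by (intro suminf_nonneg) auto
  \<comment> \<open>The sum bounds itself with a factor less than 1: from g_i = c_(i+1) + y g_(i+1)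
    the partial sum A satisfies A <= S + x (A + S), S being the sum of the |c m|.\<close>
  have sum_g: "summable (\<lambda>i. norm (g i))"
  proof (rule summableI_nonneg_bounded)
    fix N
    have "(\<Sum>i<N. norm (g i)) \<le> (\<Sum>i<N. norm (c (Suc i)) + x * norm (g (Suc i)))"
    proof (rule sum_mono)
      fix i
      have "g i = c (Suc i) + y * g (Suc i)" by (simp add: c_Suc)
      then show "norm (g i) \<le> norm (c (Suc i)) + x * norm (g (Suc i))"
        using norm_triangle_ineq[of "c (Suc i)" "y * g (Suc i)"] by (simp add: norm_mult ny)
    qed
    also have "\<dots> = (\<Sum>i<N. norm (c (Suc i))) + x * (\<Sum>i<N. norm (g (Suc i)))"
      by (simp add: sum.distrib sum_distrib_left)
    also have "(\<Sum>i<N. norm (c (Suc i))) \<le> (\<Sum>i<Suc N. norm (c i))"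
      unfolding sum.lessThan_Suc_shift by simp
    also have "\<dots> \<le> ?S" by (rule sum_le_suminf[OF c]) auto
    also have "(\<Sum>i<N. norm (g (Suc i))) \<le> (\<Sum>i<Suc N. norm (g i))"
      unfolding sum.lessThan_Suc_shift by simp
    also have "\<dots> \<le> (\<Sum>i<N. norm (g i)) + ?S" using g_le by simp
    finally have "(\<Sum>i<N. norm (g i)) \<le> ?S + x * ((\<Sum>i<N. norm (g i)) + ?S)" using x by simp
    then have "(1 - x) * (\<Sum>i<N. norm (g i)) \<le> ?S + x * ?S" by (simp add: algebra_simps)
    then show "(\<Sum>i<N. norm (g i)) \<le> (?S + x * ?S) / (1 - x)" using x by (simp add: field_simps)
  qed simp
  have gq: "summable (\<lambda>m. g m * of_real (q m j))" "summable (\<lambda>m. g m * of_real (q (Suc m) j))" "summable (\<lambda>m. g (Suc m) * of_real (q (Suc m) j))" for j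
  proof -
    show 1: "summable (\<lambda>m. g m * of_real (q m j))" for j by (rule summable_C[OF sum_g])
    show "summable (\<lambda>m. g (Suc m) * of_real (q (Suc m) j))" using 1[of j] summable_Suc_iff[of "\<lambda>m. g m * of_real (q m j)"] by simp
    show "summable (\<lambda>m. g m * of_real (q (Suc m) j))"
    proof (rule summable_comparison_test[OF _ sum_g])
      show "\<exists>N. \<forall>m\<ge>N. norm (g m * of_real (q (Suc m) j)) \<le> norm (g m)"
        by (auto simp: norm_mult intro!: mult_left_le abs_q_le_1)
    qed
  qed
  let ?D = "C g"
  \<comment> \<open>The Fourier coefficients of F(y) + (Y - y) g(Y), Y being the variable:
    multiplication by Y acts on the coefficients of g through the symmetric three-term
    recurrence.\<close>
  have C_eq: "C c j = (if j = 0 then (\<Sum>m. c m * y ^ m) else 0)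
     + ((if j = 0 then 0 else of_real (\<alpha> (j - 1)) * ?D (j - 1)) + of_real (\<beta> j) * ?D j + of_real (\<alpha> j) * ?D (Suc j)) - y * ?D j" for j
  proof -
    have "C c j = (\<Sum>m. c (Suc m) * of_real (q (Suc m) j)) + c 0 * of_real (q 0 j)"
      unfolding C_def using suminf_split_head[OF summable_C[OF c, of j]] by simp
    also have "(\<Sum>m. c (Suc m) * of_real (q (Suc m) j)) = (\<Sum>m. g m * of_real (q (Suc m) j) - y * (g (Suc m) * of_real (q (Suc m) j)))"
      unfolding c_Suc by (simp add: algebra_simps)
    also have "\<dots> = (\<Sum>m. g m * of_real (q (Suc m) j)) - y * (\<Sum>m. g (Suc m) * of_real (q (Suc m) j))"
      using gq by (subst suminf_diff[symmetric]) (auto intro!: summable_mult simp: suminf_mult)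
    also have "(\<Sum>m. g (Suc m) * of_real (q (Suc m) j)) = ?D j - g 0 * of_real (q 0 j)"
      unfolding C_def using suminf_split_head[OF gq(1)] by simp
    also have "(\<Sum>m. g m * of_real (q (Suc m) j)) = (\<Sum>m. of_real (if j = 0 then 0 else \<alpha> (j - 1)) * (g m * of_real (q m (j - 1))) + of_real (\<beta> j) * (g m * of_real (q m j)) + of_real (\<alpha> j) * (g m * of_real (q m (Suc j))))"
      unfolding q_rec by (intro suminf_cong) (simp add: algebra_simps)
    also have "\<dots> = of_real (if j = 0 then 0 else \<alpha> (j - 1)) * ?D (j - 1) + of_real (\<beta> j) * ?D j + of_real (\<alpha> j) * ?D (Suc j)"
      unfolding C_def by (intro sums_unique[symmetric] sums_add sums_mult summable_sums gq)
    finally show ?thesis unfolding c0 by (simp add: q_0_left algebra_simps)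
  qed
  have tele: "(\<Sum>j<Suc N. C c j * p j y) = (\<Sum>m. c m * y ^ m) + of_real (\<alpha> N) * ?D (Suc N) * p N y - of_real (\<alpha> N) * ?D N * p (Suc N) y" for N
  proof (induction N)
    case 0
    have "y = of_real (\<alpha> 0) * p (Suc 0) y + of_real (\<beta> 0)" using p_rec[of y 0] by simp
    then have "y * ?D 0 = (of_real (\<alpha> 0) * p (Suc 0) y + of_real (\<beta> 0)) * ?D 0" by simp
    then show ?case using C_eq[of 0] by (simp add: algebra_simps)
  next
    case (Suc N)
    have "?D (Suc N) * (y * p (Suc N) y) = ?D (Suc N) * (of_real (\<alpha> (Suc N)) * p (Suc (Suc N)) y + of_real (\<beta> (Suc N)) * p (Suc N) y + of_real (\<alpha> N) * p N y)"
      using p_rec[of y "Suc N"] by simp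
    moreover have "C c (Suc N) * p (Suc N) y = (of_real (\<alpha> N) * ?D N + of_real (\<beta> (Suc N)) * ?D (Suc N) + of_real (\<alpha> (Suc N)) * ?D (Suc (Suc N))) * p (Suc N) y - ?D (Suc N) * (y * p (Suc N) y)"
      unfolding C_eq[of "Suc N"] by (simp add: algebra_simps)
    ultimately show ?case unfolding sum.lessThan_Suc[of _ "Suc N"] Suc by (simp add: algebra_simps)
  qed
  have D0: "?D \<longlonglongrightarrow> 0" by (rule C_tendsto_0[OF sum_g])
  have Ba: "Bseq (\<lambda>n. complex_of_real (\<alpha> n))" using \<alpha>_bounded by (simp add: Bseq_def)
  have Bp: "Bseq (\<lambda>n. p n y)" unfolding y_def by (rule p_bounded[OF x])
  have Bp': "Bseq (\<lambda>n. p (Suc n) y)" using Bp Bseq_Suc_iff[of "\<lambda>n. p n y"] by blast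
  have z: "(\<lambda>n. u n * D n * v n) \<longlonglongrightarrow> 0" if "Bseq u" "Bseq v" "D \<longlonglongrightarrow> 0" for u v D :: "nat \<Rightarrow> complex"
  proof -
    obtain M where M: "M > 0" "\<And>n. norm (u n) \<le> M" using \<open>Bseq u\<close> by (auto simp: Bseq_def)
    obtain N where N: "N > 0" "\<And>n. norm (v n) \<le> N" using \<open>Bseq v\<close> by (auto simp: Bseq_def)
    show ?thesis
    proof (rule Lim_null_comparison)
      show "eventually (\<lambda>n. norm (u n * D n * v n) \<le> M * norm (D n) * N) sequentially"
        unfolding norm_mult using M N by (intro always_eventually allI mult_mono) auto
      show "(\<lambda>n. M * norm (D n) * N) \<longlonglongrightarrow> 0"
        using tendsto_mult[OF tendsto_mult[OF tendsto_const[of M] tendsto_norm_zero[OF \<open>D \<longlonglongrightarrow> 0\<close>]] tendsto_const[of N]] by simp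
    qed
  qed
  have "(\<lambda>N. (\<Sum>m. c m * y ^ m) + of_real (\<alpha> N) * ?D (Suc N) * p N y - of_real (\<alpha> N) * ?D N * p (Suc N) y) \<longlonglongrightarrow> (\<Sum>m. c m * y ^ m) + 0 - 0"
    by (intro tendsto_intros z Ba Bp Bp' D0 LIMSEQ_Suc[OF D0])
  then have "(\<lambda>N. \<Sum>j<Suc N. C c j * p j y) \<longlonglongrightarrow> (\<Sum>m. c m * y ^ m)" unfolding tele by simp
  then show ?thesis unfolding sums_def y_def by (rule LIMSEQ_imp_Suc)
qed

end

subsection \<open>The origin and points outside the unit interval\<close>

text \<open>The recurrence of the Beta functionals with the common factor removed; p stands for s +
  2j.\<close>

lemma beta_eval_rational:
  fixes p j \<nu> f :: real
  assumes "p \<noteq> 0" "p - 1 \<noteq> 0" "p - 2 \<noteq> 0"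
  shows "(p-j-1)*((f+j)*(j-1-\<nu>)*(j-\<nu>))/((p-1)*p) + ((j+1)*(f+j)/p - j*(f+j-1)/(p-2))*((j-1-\<nu>)*(\<nu>+p-j))
    + (p-j-f-1)*(j*(\<nu>+p-j-1)*(\<nu>+p-j))/((p-1)*(p-2)) = (j-1-\<nu>)*(\<nu>+p-j) + (\<nu>+p-2*j-f)*(\<nu>+1)"
proof -
  have E: "p * (p-1) * (p-2) * ((j-1-\<nu>)*(\<nu>+p-j) + (\<nu>+p-2*j-f)*(\<nu>+1)) =
      (p-j-1)*((f+j)*(j-1-\<nu>)*(j-\<nu>))*(p-2) + ((j+1)*(f+j)*(p-1)*(p-2) - j*(f+j-1)*p*(p-1))*((j-1-\<nu>)*(\<nu>+p-j))
      + p*((p-j-f-1)*(j*(\<nu>+p-j-1)*(\<nu>+p-j)))"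
    by algebra
  have "X/((p-1)*p) + (Y/p - Z/(p-2))*T + W/((p-1)*(p-2)) = (X * (p-2) + (Y*(p-1)*(p-2) - Z*p*(p-1))*T + p*W) / (p * (p-1) * (p-2))" for X Y Z T W
    using assms by (simp add: divide_simps) (simp add: algebra_simps)
  note this[of "(p-j-1)*((f+j)*(j-1-\<nu>)*(j-\<nu>))" "(j+1)*(f+j)" "j*(f+j-1)" "(j-1-\<nu>)*(\<nu>+p-j)" "(p-j-f-1)*(j*(\<nu>+p-j-1)*(\<nu>+p-j))"]
  also note E[symmetric]
  finally show ?thesis using assms by simp
qed

context jacobi_params
begin

text \<open>Up to normalisation, \<open>beta_eval \<nu> j\<close> is the integral of \<^term>\<open>K j\<close> against the weight
  \<open>y\<^bsup>f-1\<^esup> (1 - y)\<^bsup>d+\<nu>-1\<^esup>\<close>. These weights concentrate at \<open>0\<close> as \<open>\<nu> \<rightarrow> \<infinity>\<close>, and multiplication by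
  \<open>1 - y\<close> replaces \<open>\<nu>\<close> by \<open>\<nu> + 1\<close>.\<close>

definition beta_eval :: "real \<Rightarrow> nat \<Rightarrow> real" where
  "beta_eval \<nu> j = pochhammer f j * pochhammer (- \<nu>) j / (fact j * pochhammer (\<nu> + s) j)"

text \<open>The left-hand side is the functional applied to y K_j(y), and y = 1 - (1-y). The factor
  (\<nu>+d)/(\<nu>+s) is the quotient of the Beta integrals that normalise the functionals for
  \<nu>+1 and \<nu>.\<close>

lemma beta_eval_rec:
  assumes \<nu>: "\<nu> \<ge> 0"
  shows "recA s j * beta_eval \<nu> (Suc j) + recB f s j * beta_eval \<nu> j + (if j = 0 then 0 else recG f s j * beta_eval \<nu> (j - 1))
    = beta_eval \<nu> j - (\<nu> + d) / (\<nu> + s) * beta_eval (\<nu> + 1) j"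
proof (cases j)
  case 0
  have n: "s \<noteq> 0" "\<nu> + s \<noteq> 0" using s \<nu> by auto
  have "1 - \<nu> / (\<nu> + s) = s / (\<nu> + s)" using n by (simp add: field_simps)
  moreover have "1 / s * (f * - \<nu> / (\<nu> + s)) + f / s = f / s * (1 - \<nu> / (\<nu> + s))" by (simp add: algebra_simps)
  ultimately have "1 / s * (f * - \<nu> / (\<nu> + s)) + f / s = f / (\<nu> + s)" using n by simp
  moreover have "1 - (\<nu> + d) / (\<nu> + s) = f / (\<nu> + s)" using n by (simp add: field_simps s_def)
  ultimately show ?thesis by (simp add: 0 beta_eval_def recA_def recB_def)
next
  case (Suc i)
  define t where "t = real j"
  have ti: "real i = t - 1" by (simp add: t_def Suc)
  have t: "t \<ge> 1" by (simp add: t_def Suc)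
  define P where "P = s + 2 * t"
  have nz: "P \<noteq> 0" "P - 1 \<noteq> 0" "P - 2 \<noteq> 0" using s t by (auto simp: P_def)
  define N1 N2 where "N1 = \<nu> + s + t - 1" and "N2 = \<nu> + s + t"
  have N: "N1 > 0" "N2 > 0" using s t \<nu> by (auto simp: N1_def N2_def)
  define V where "V = pochhammer f i * pochhammer (- \<nu>) i / (fact i * pochhammer (\<nu> + s) i)"
  define U where "U = V * (f + t - 1) / (t * (N1 * N2))"
  have vs: "\<nu> + s \<noteq> 0" using s \<nu> by auto
  have v0: "(f + t - 1) * beta_eval \<nu> (j - 1) = U * (t * (N1 * N2))"
    using t N by (simp add: beta_eval_def U_def V_def Suc)
  have v1: "beta_eval \<nu> j = U * ((t - 1 - \<nu>) * N2)"
  proof -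
    have "beta_eval \<nu> j = V * (f + t - 1) * (t - 1 - \<nu>) / (t * N1)"
      unfolding beta_eval_def V_def N1_def Suc pochhammer_Suc fact_Suc ti using t by (simp add: t_def Suc mult_ac add_ac)
    then show ?thesis unfolding U_def using N by simp
  qed
  have v2: "(t + 1) * beta_eval \<nu> (Suc j) = U * ((f + t) * (t - 1 - \<nu>) * (t - \<nu>))"
  proof -
    have "beta_eval \<nu> (Suc j) = beta_eval \<nu> j * ((f + t) * (t - \<nu>)) / ((t + 1) * N2)"
      unfolding beta_eval_def pochhammer_Suc fact_Suc N2_def by (simp add: t_def mult_ac add_ac)
    then show ?thesis unfolding v1 using N t by simp
  qed
  have v3: "(\<nu> + d) / (\<nu> + s) * beta_eval (\<nu> + 1) j = - (U * ((\<nu> + d) * (\<nu> + 1)))"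
  proof -
    have a: "pochhammer (- (\<nu> + 1)) j = - ((\<nu> + 1) * pochhammer (- \<nu>) i)"
      unfolding Suc pochhammer_rec by (simp add: algebra_simps)
    have b: "(\<nu> + s) * pochhammer (\<nu> + 1 + s) j = pochhammer (\<nu> + s) i * N1 * N2"
    proof -
      have "(\<nu> + s) * pochhammer (\<nu> + 1 + s) j = pochhammer (\<nu> + s) (Suc j)"
        unfolding pochhammer_rec[of "\<nu> + s"] by (simp add: add_ac)
      also have "\<dots> = pochhammer (\<nu> + s) i * N1 * N2"
        unfolding N1_def N2_def by (simp add: pochhammer_Suc Suc t_def add_ac)
      finally show ?thesis .
    qed
    have "(\<nu> + d) / (\<nu> + s) * beta_eval (\<nu> + 1) j = (\<nu> + d) * (pochhammer f j * pochhammer (- (\<nu> + 1)) j) / (fact j * ((\<nu> + s) * pochhammer (\<nu> + 1 + s) j))"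
      unfolding beta_eval_def by (simp add: mult_ac)
    also have "\<dots> = - (U * ((\<nu> + d) * (\<nu> + 1)))"
    proof -
      have "pochhammer f j = pochhammer f i * (f + t - 1)" "fact j = t * fact i"
        by (simp_all add: Suc pochhammer_Suc t_def)
      then show ?thesis unfolding a b U_def V_def by (simp add: mult_ac)
    qed
    finally show ?thesis .
  qed
  have j0: "j \<noteq> 0" using Suc by simp
  have e: "\<nu> + P - t = N2" "N2 - 1 = N1" "P - t - 1 = s + t - 1" "P - t - f - 1 = s - f + t - 1" "\<nu> + P - 2 * t - f = \<nu> + d"
    by (simp_all add: P_def N1_def N2_def s_def)
  have "recA s j * beta_eval \<nu> (Suc j) = ((t + 1) * beta_eval \<nu> (Suc j)) * (s + t - 1) / ((P - 1) * P)"
    using j0 by (simp add: recA_def t_def P_def)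
  also have "\<dots> = U * ((s + t - 1) * ((f + t) * (t - 1 - \<nu>) * (t - \<nu>)) / ((P - 1) * P))"
    unfolding v2 by simp
  finally have A: "recA s j * beta_eval \<nu> (Suc j) = \<dots>" .
  have "recG f s j * beta_eval \<nu> (j - 1) = ((f + t - 1) * beta_eval \<nu> (j - 1)) * (s - f + t - 1) / ((P - 1) * (P - 2))"
    by (simp add: recG_def t_def P_def)
  also have "\<dots> = U * ((s - f + t - 1) * (t * N1 * N2) / ((P - 1) * (P - 2)))"
    unfolding v0 by (simp add: mult_ac)
  finally have G: "recG f s j * beta_eval \<nu> (j - 1) = \<dots>" .
  have B: "recB f s j = (t + 1) * (f + t) / P - t * (f + t - 1) / (P - 2)" by (simp add: recB_def t_def P_def)
  have "recA s j * beta_eval \<nu> (Suc j) + recB f s j * beta_eval \<nu> j + recG f s j * beta_eval \<nu> (j - 1)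
    = U * ((s + t - 1) * ((f + t) * (t - 1 - \<nu>) * (t - \<nu>)) / ((P - 1) * P) + ((t + 1) * (f + t) / P - t * (f + t - 1) / (P - 2)) * ((t - 1 - \<nu>) * N2)
     + (s - f + t - 1) * (t * N1 * N2) / ((P - 1) * (P - 2)))"
    unfolding A G v1 B[symmetric] by (simp only: distrib_left mult.left_commute[of _ U])
  also have "\<dots> = U * ((t - 1 - \<nu>) * N2 + (\<nu> + d) * (\<nu> + 1))"
    unfolding beta_eval_rational[OF nz, of t f \<nu>, unfolded e] ..
  also have "\<dots> = beta_eval \<nu> j - (\<nu> + d) / (\<nu> + s) * beta_eval (\<nu> + 1) j"
    unfolding v3 v1 by (simp add: algebra_simps)
  finally show ?thesis using j0 by simp
qed

text \<open>The functional applied to the expansion of y^m; the result is the m-th moment of the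
  Beta distribution with parameters f and d + \<nu>.\<close>

lemma sum_conn_beta_eval:
  assumes "\<nu> \<ge> 0"
  shows "(\<Sum>j\<le>m. conn f s m j * beta_eval \<nu> j) = pochhammer f m / pochhammer (\<nu> + s) m"
  using assms
proof (induction m arbitrary: \<nu>)
  case 0
  then show ?case by (simp add: conn_0_left beta_eval_def)
next
  case (Suc m)
  have n: "\<nu> + s > 0" "pochhammer (\<nu> + s) (Suc m) > 0" "pochhammer (\<nu> + s) m > 0" "\<nu> + s + real m > 0" 
    using Suc.prems s pochhammer_pos[of "\<nu> + s"] by (simp_all add: add_nonneg_pos add_pos_nonneg)
  have "(\<Sum>j\<le>Suc m. conn f s (Suc m) j * beta_eval \<nu> j) = (\<Sum>j\<le>m. conn f s m j * (beta_eval \<nu> j - (\<nu> + d) / (\<nu> + s) * beta_eval (\<nu> + 1) j))"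
    by (subst conn_transpose[OF s_nz]) (simp only: beta_eval_rec[OF Suc.prems])
  also have "\<dots> = (\<Sum>j\<le>m. conn f s m j * beta_eval \<nu> j) - (\<nu> + d) / (\<nu> + s) * (\<Sum>j\<le>m. conn f s m j * beta_eval (\<nu> + 1) j)"
    by (simp add: right_diff_distrib sum_subtractf sum_distrib_left mult_ac)
  also have "\<dots> = pochhammer f m / pochhammer (\<nu> + s) m - (\<nu> + d) / (\<nu> + s) * (pochhammer f m / pochhammer (\<nu> + 1 + s) m)"
    using Suc by simp
  also have "(\<nu> + d) / (\<nu> + s) * (pochhammer f m / pochhammer (\<nu> + 1 + s) m) = (\<nu> + d) * pochhammer f m / pochhammer (\<nu> + s) (Suc m)"
    unfolding pochhammer_rec by (simp add: add_ac)
  also have "pochhammer f m / pochhammer (\<nu> + s) m = (\<nu> + s + real m) * pochhammer f m / pochhammer (\<nu> + s) (Suc m)"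
    unfolding pochhammer_Suc using n by simp
  also have "(\<nu> + s + real m) * pochhammer f m / pochhammer (\<nu> + s) (Suc m) - (\<nu> + d) * pochhammer f m / pochhammer (\<nu> + s) (Suc m)
    = pochhammer f (Suc m) / pochhammer (\<nu> + s) (Suc m)"
    unfolding diff_divide_distrib[symmetric] by (simp add: pochhammer_Suc[of f] s_def algebra_simps)
  finally show ?case .
qed

section \<open>Identification of the sum at the origin\<close>

lemma K_0: "K j 0 = of_real ((- 1) ^ j * pochhammer f j / fact j)"
proof -
  have "jacobiK j 1 (of_real d) (of_real f) = (- 1) ^ j * K j 0"
    using jacobiK_reflect[OF s_nz_complex, of j 0] by simp
  then have "(- 1) ^ j * ((- 1) ^ j * K j 0) = (- 1) ^ j * (of_real (pochhammer f j) / fact j)"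
    by (simp add: jacobiK_at_1 pochhammer_of_real)
  then show ?thesis by (simp flip: mult.assoc power_mult_distrib)
qed

text \<open>The Beta functional with \<nu> = n is computed in two ways. Applied to the polynomials
  it is a regular mean of the terms at 0 and tends to T; applied to the powers it is the sum of the
  c_m (f)_m / (n+s)_m, which tends to c_0 by Tannery's theorem.\<close>

lemma sums_at_0_unique:
  assumes c: "summable (\<lambda>m. norm (c m))" and sm: "(\<lambda>j. C c j * p j 0) sums T"
  shows "T = c 0"
proof -
  \<comment> \<open>The quotient of \<open>beta_eval n j\<close> and K_j(0). Integral \<nu> = n
    makes it vanish for j > n, so the means are finite sums.\<close>
  define w where "w = (\<lambda>n j. fact j * real (n choose j) / pochhammer (real n + s) j)"
  have ns: "real n + s > 0" for n using s by (simp add: add_nonneg_pos)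
  have w_Suc: "w n (Suc j) = w n j * (real (n - j) / (real n + s + real j))" for n j
  proof -
    have "Suc j * (n choose Suc j) = (n choose j) * (n - j)"
      using binomial_absorb_comp[of n j] binomial_absorption[of j n] by (simp add: mult_ac)
    then have "real (Suc j) * real (n choose Suc j) = real (n choose j) * real (n - j)"
      by (metis of_nat_mult)
    then show ?thesis by (simp add: w_def pochhammer_Suc mult_ac)
  qed
  have w_nonneg: "w n j \<ge> 0" for n j
    unfolding w_def using pochhammer_pos[OF ns[of n], of j] by simp
  have fr: "real (n - j) / (real n + s + real j) \<le> 1" for n j
    using s by (simp add: divide_simps)
  have lim_T: "(\<lambda>n. \<Sum>j\<le>n. of_real (w n j) * (C c j * p j 0)) \<longlonglongrightarrow> T"
  proof (rule regular_summation[OF sm])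
    show "w n (Suc j) \<le> w n j" for n j
      unfolding w_Suc using w_nonneg fr by (intro mult_left_le) auto
    show "(\<lambda>n. w n j) \<longlonglongrightarrow> 1" for j
    proof (induction j)
      case (Suc j)
      have "(\<lambda>n. (- real j + real n) / (s + real j + real n)) \<longlonglongrightarrow> 1"
        by (rule of_nat_quotient_tendsto_1)
      moreover have "eventually (\<lambda>n. (- real j + real n) / (s + real j + real n) = real (n - j) / (real n + s + real j)) sequentially"
        using eventually_ge_at_top[of j] by eventually_elim (simp add: of_nat_diff add_ac)
      ultimately have "(\<lambda>n. real (n - j) / (real n + s + real j)) \<longlonglongrightarrow> 1" by (rule Lim_transform_eventually)
      then have "(\<lambda>n. w n j * (real (n - j) / (real n + s + real j))) \<longlonglongrightarrow> 1 * 1" by (intro tendsto_mult Suc)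
      then show ?case by (simp add: w_Suc)
    qed (simp add: w_def)
  qed (simp_all add: w_def)
  have eq: "(\<Sum>j\<le>n. of_real (w n j) * (C c j * p j 0)) = (\<Sum>m. c m * of_real (pochhammer f m / pochhammer (real n + s) m))" for n
  proof -
    have "(\<Sum>j\<le>n. of_real (w n j) * (C c j * p j 0)) = (\<Sum>j\<le>n. C c j * (of_real (w n j) * p j 0))"
      by (simp only: mult_ac)
    also have "\<dots> = (\<Sum>m. c m * (\<Sum>j\<le>n. of_real (q m j) * (of_real (w n j) * p j 0)))"
      by (rule sum_C_p[OF c])
    also have "\<dots> = (\<Sum>m. c m * of_real (pochhammer f m / pochhammer (real n + s) m))"
    proof (rule suminf_cong)
      fix m
      have b: "beta_eval (real n) j = (- 1) ^ j * pochhammer f j / fact j * w n j" for j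
      proof -
        have "pochhammer (- real n) j = (- 1) ^ j * real (n choose j) * fact j"
          by (simp add: binomial_gbinomial gbinomial_pochhammer)
        then show ?thesis by (simp add: beta_eval_def w_def mult_ac)
      qed
      have "of_real (q m j) * (of_real (w n j) * p j 0) = complex_of_real (conn f s m j * beta_eval (real n) j)" for j
        unfolding p_def K_0 b q_def using h_pos[of j] by simp
      then have "(\<Sum>j\<le>n. of_real (q m j) * (of_real (w n j) * p j 0)) = complex_of_real (\<Sum>j\<le>n. conn f s m j * beta_eval (real n) j)"
        by simp
      also have "(\<Sum>j\<le>n. conn f s m j * beta_eval (real n) j) = (\<Sum>j\<le>max m n. conn f s m j * beta_eval (real n) j)"
        by (intro sum.mono_neutral_left) (auto simp: b w_def)
      also have "\<dots> = (\<Sum>j\<le>m. conn f s m j * beta_eval (real n) j)"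
        by (intro sum.mono_neutral_right) auto
      also have "\<dots> = pochhammer f m / pochhammer (real n + s) m" by (rule sum_conn_beta_eval) simp
      finally show "c m * (\<Sum>j\<le>n. of_real (q m j) * (of_real (w n j) * p j 0)) = c m * of_real (pochhammer f m / pochhammer (real n + s) m)"
        by simp
    qed
    finally show ?thesis .
  qed
  have lim_c: "(\<lambda>n. \<Sum>m. c m * of_real (pochhammer f m / pochhammer (real n + s) m)) \<longlonglongrightarrow> (\<Sum>m. if m = 0 then c 0 else 0)"
  proof (rule tannerys_theorem[THEN conjunct2, THEN conjunct2])
    have le: "\<bar>pochhammer f m / pochhammer (real n + s) m\<bar> \<le> 1" for m n
    proof -
      have "pochhammer f m \<le> pochhammer (real n + s) m"
        unfolding pochhammer_prod using f d by (intro prod_mono) (auto simp: s_def)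
      then show ?thesis using pochhammer_pos[OF f, of m] pochhammer_pos[OF ns[of n], of m] by simp
    qed
    show "eventually (\<lambda>(m, n). norm (c m * of_real (pochhammer f m / pochhammer (real n + s) m)) \<le> norm (c m)) (at_top \<times>\<^sub>F sequentially)"
      unfolding norm_mult norm_of_real
      by (intro always_eventually allI) (simp only: split_beta, intro mult_left_le le norm_ge_zero)
    show "(\<lambda>n. c m * of_real (pochhammer f m / pochhammer (real n + s) m)) \<longlonglongrightarrow> (if m = 0 then c 0 else 0)" for m
    proof -
      have "(\<lambda>n. pochhammer f m / pochhammer (real n + s) m) \<longlonglongrightarrow> (if m = 0 then 1 else 0)"
      proof (induction m)
        case (Suc m)
        have "(\<lambda>n. 1 / (real n + (s + real m))) \<longlonglongrightarrow> 0"
          using bv_tendsto_inverse[of "s + real m"] s by (simp add: bv_tendsto_def add_pos_nonneg)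
        then have "(\<lambda>n. pochhammer f m / pochhammer (real n + s) m * ((f + real m) * (1 / (real n + (s + real m))))) \<longlonglongrightarrow> (if m = 0 then 1 else 0) * ((f + real m) * 0)"
          by (intro tendsto_mult Suc tendsto_const)
        then show ?case by (simp add: pochhammer_Suc add_ac mult_ac)
      qed simp
      then have "(\<lambda>n. c m * of_real (pochhammer f m / pochhammer (real n + s) m)) \<longlonglongrightarrow> c m * of_real (if m = 0 then 1 else 0)"
        by (intro tendsto_intros)
      then show ?thesis by (cases "m = 0") simp_all
    qed
  qed (use c in simp_all)
  have "(\<Sum>m. if m = 0 then c 0 else 0) = c 0"
    using sums_If_finite[of "\<lambda>m. m = 0" "\<lambda>_. c 0"] by (simp add: sums_iff)
  then show ?thesis using LIMSEQ_unique[OF lim_T[unfolded eq] lim_c] by simp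
qed

text \<open>A Christoffel--Darboux identity at x and its conjugate: after multiplication of the
  recurrence by the conjugate of p_n the imaginary part loses the real diagonal term, and the rest
  telescopes.\<close>

lemma sum_norm_p_square:
  "Im x * (\<Sum>n\<le>N. (norm (p n x))\<^sup>2) = \<alpha> N * Im (p (Suc N) x * cnj (p N x))"
proof (induction N)
  case 0
  have "Im x = Im (of_real (\<alpha> 0) * p (Suc 0) x + of_real (\<beta> 0))" using p_rec[of x 0] by simp
  then show ?case by simp
next
  case (Suc N)
  have "x * p (Suc N) x * cnj (p (Suc N) x) = (of_real (\<alpha> (Suc N)) * p (Suc (Suc N)) x + of_real (\<beta> (Suc N)) * p (Suc N) x + of_real (\<alpha> N) * p N x) * cnj (p (Suc N) x)"
    using p_rec[of x "Suc N"] by simp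
  then have "x * of_real ((norm (p (Suc N) x))\<^sup>2) = of_real (\<alpha> (Suc N)) * (p (Suc (Suc N)) x * cnj (p (Suc N) x)) + of_real (\<beta> (Suc N) * (norm (p (Suc N) x))\<^sup>2) + of_real (\<alpha> N) * (p N x * cnj (p (Suc N) x))"
    unfolding of_real_mult complex_norm_square by (simp add: algebra_simps)
  from arg_cong[OF this, of Im] have "Im x * (norm (p (Suc N) x))\<^sup>2 = \<alpha> (Suc N) * Im (p (Suc (Suc N)) x * cnj (p (Suc N) x)) + \<alpha> N * Im (p N x * cnj (p (Suc N) x))"
    by (simp only: plus_complex.sel Im_complex_of_real times_complex.sel Re_complex_of_real)
  moreover have "\<alpha> N * Im (p N x * cnj (p (Suc N) x)) = - (\<alpha> N * Im (p (Suc N) x * cnj (p N x)))" by (simp add: algebra_simps)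
  ultimately show ?case using Suc unfolding sum.atMost_Suc distrib_left by linarith
qed

lemma h_ratio: "(\<lambda>n. h (n + 2) / h n) \<longlonglongrightarrow> 1"
proof -
  have 1: "(\<lambda>n. recG f s (Suc n) / recA s n) \<longlonglongrightarrow> 1"
  proof -
    have "(\<lambda>n. (f + real n) / (1 + real n) * ((d + real n) / (s - 1 + real n)) * (((s - 1) / 2 + real n) / ((s + 1) / 2 + real n))) \<longlonglongrightarrow> 1 * 1 * 1"
      by (intro tendsto_mult of_nat_quotient_tendsto_1)
    moreover have "eventually (\<lambda>n. (f + real n) / (1 + real n) * ((d + real n) / (s - 1 + real n)) * (((s - 1) / 2 + real n) / ((s + 1) / 2 + real n)) = recG f s (Suc n) / recA s n) sequentially"
      using eventually_gt_at_top[of 0]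
    proof eventually_elim
      case (elim n)
      have e: "(s - 1) / 2 + real n = (s + 2 * real n - 1) / 2" "(s + 1) / 2 + real n = (s + 2 * real n + 1) / 2" by (simp_all add: field_simps)
      have nz: "s + 2 * real n \<noteq> 0" using s by (metis add_pos_nonneg less_irrefl mult_nonneg_nonneg of_nat_0_le_iff zero_le_numeral)
      have "recG f s (Suc n) = (f + real n) * (d + real n) / ((s + 2 * real n + 1) * (s + 2 * real n))"
        by (simp add: recG_def s_def algebra_simps)
      moreover have "recA s n = (1 + real n) * (s - 1 + real n) / ((s + 2 * real n - 1) * (s + 2 * real n))"
        using elim by (simp add: recA_def algebra_simps)
      moreover have "a / b * (c / u) * ((A / 2) / (B / 2)) = (a * c / (B * P)) / (b * u / (A * P))" if "P \<noteq> 0" for a b c u A B P :: real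
        using that by (simp add: mult_ac)
      ultimately show ?case unfolding e using nz by (simp only: not_False_eq_True)
    qed
    ultimately show ?thesis using Lim_transform_eventually by fastforce
  qed
  have "(\<lambda>n. recG f s (Suc (Suc n)) / recA s (Suc n) * (recG f s (Suc n) / recA s n)) \<longlonglongrightarrow> 1 * 1"
    by (intro tendsto_mult 1 LIMSEQ_Suc[OF 1])
  moreover have "recG f s (Suc (Suc n)) / recA s (Suc n) * (recG f s (Suc n) / recA s n) = h (n + 2) / h n" for n
  proof -
    have "h (Suc k) = h k * (recG f s (Suc k) / recA s k)" for k by (simp add: h_def)
    then show ?thesis using h_pos[of n] by (simp add: mult_ac)
  qed
  ultimately show ?thesis by simp
qed

lemma power_unbounded:
  fixes r M :: real
  assumes "r > 1"
  obtains n where "n \<ge> J" "r ^ n > M"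
proof -
  obtain n where "r ^ n > M" using real_arch_pow[OF assms] by blast
  moreover have "r ^ n \<le> r ^ max n J" using assms by (intro power_increasing) auto
  ultimately have "r ^ max n J > M" by linarith
  then show ?thesis using that[of "max n J"] by simp
qed

text \<open>For negative \<open>x\<close> all terms of the reflected polynomial have the same sign; for non-real \<open>x\<close>
  the identity for \<open>Im x\<close> shows that the squares of the orthonormal polynomials have
  exponentially growing partial sums.\<close>

lemma K_exponential_growth:
  assumes x: "x \<notin> complex_of_real ` {0..1}" "norm x \<le> 1"
  obtains \<rho> where "\<rho> > 1" "\<And>\<kappa> J. \<exists>n\<ge>J. norm (K n x) > \<kappa> * \<rho> ^ n"
proof (cases "Im x = 0")
  case True
  define y where "y = - Re x"
  have xy: "x = - of_real y" using True by (simp add: y_def complex_eq_iff)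
  have y: "y > 0"
  proof (rule ccontr)
    assume "\<not> y > 0"
    then have "Re x \<in> {0..1}" using x(2) complex_Re_le_cmod[of x] by (simp add: y_def)
    then have "complex_of_real (Re x) \<in> complex_of_real ` {0..1}" by (rule imageI)
    moreover have "complex_of_real (Re x) = x" using True by (simp add: complex_eq_iff)
    ultimately show False using x(1) by (simp only:)
  qed
  \<comment> \<open>Reflection replaces powers of x-1 by powers of -x = y > 0. Lowering (s+n-1)_m to
    (f)_m, possible for n >= 1, leaves a binomial sum.\<close>
  have lower: "norm (K n x) \<ge> pochhammer f n / fact n * (1 + y) ^ n" if n: "n \<ge> 1" for n
  proof -
    have "jacobiK n (1 - x) (of_real d) (of_real f) = (- 1) ^ n * K n x" by (rule jacobiK_reflect[OF s_nz_complex])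
    then have "norm (K n x) = norm (jacobiK n (1 - x) (of_real d) (of_real f))" by (simp add: norm_mult norm_power)
    moreover have "jacobiK n (1 - x) (of_real d) (of_real f) = of_real (\<Sum>m\<le>n. jacobi_coeff s f n m * y ^ m)"
    proof -
      have "jacobi_coeff (of_real d + of_real f) (of_real f) n m = complex_of_real (jacobi_coeff s f n m)" for m
      proof -
        have p: "pochhammer (of_real d + of_real f + of_nat n - 1) m = complex_of_real (pochhammer (s + real n - 1) m)"
          "pochhammer (of_real f + of_nat m) k = complex_of_real (pochhammer (f + real m) k)" for k
          by (simp_all add: s_def add.commute flip: pochhammer_of_real)
        show ?thesis by (simp add: jacobi_coeff_def p)
      qed
      then show ?thesis unfolding jacobiK_eq_sum[OF order_refl] by (simp add: xy)
    qed
    ultimately have K: "norm (K n x) = \<bar>\<Sum>m\<le>n. jacobi_coeff s f n m * y ^ m\<bar>" by (simp only: norm_of_real)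
    have "pochhammer f n / fact n * (y + 1) ^ n = (\<Sum>m\<le>n. pochhammer f n / fact n * (of_nat (n choose m) * y ^ m * 1 ^ (n - m)))"
      unfolding sum_distrib_left[symmetric] binomial_ring ..
    also have "\<dots> \<le> (\<Sum>m\<le>n. jacobi_coeff s f n m * y ^ m)"
    proof (rule sum_mono)
      fix m assume m: "m \<in> {..n}"
      have "pochhammer f m \<le> pochhammer (s + real n - 1) m"
        unfolding pochhammer_prod using f d n by (intro prod_mono) (auto simp: s_def)
      then have "pochhammer f m * (pochhammer (f + real m) (n - m) / (fact m * fact (n - m)) * y ^ m) \<le> pochhammer (s + real n - 1) m * (pochhammer (f + real m) (n - m) / (fact m * fact (n - m)) * y ^ m)"
        using f y by (intro mult_right_mono) (auto intro!: mult_nonneg_nonneg divide_nonneg_nonneg pochhammer_nonneg add_pos_nonneg)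
      moreover have "pochhammer f n = pochhammer f m * pochhammer (f + real m) (n - m)" using pochhammer_product[of m n f] m by simp
      ultimately show "pochhammer f n / fact n * (of_nat (n choose m) * y ^ m * 1 ^ (n - m)) \<le> jacobi_coeff s f n m * y ^ m"
        using m by (simp add: jacobi_coeff_def binomial_fact mult_ac)
    qed
    also have "\<dots> \<le> norm (K n x)" unfolding K by (rule abs_ge_self)
    finally show ?thesis by (simp add: add.commute)
  qed
  \<comment> \<open>Of the four factors \<rho>^n in (1+y)^n, one pays for the prefactor (f)_n / n!,
    one is the asserted growth, and the remaining two outgrow the constant.\<close>
  define \<rho> where "\<rho> = root 4 (1 + y)"
  have \<rho>: "\<rho> > 1" "\<rho> ^ 4 = 1 + y" using y by (auto simp: \<rho>_def)
  have pos: "pochhammer f n / fact n > 0" for n using pochhammer_pos[OF f] by simp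
  have ratio: "(\<lambda>n. (pochhammer f (n + 2) / fact (n + 2)) / (pochhammer f n / fact n)) \<longlonglongrightarrow> 1"
  proof -
    have "(\<lambda>n. (f + real n) / (1 + real n) * ((f + 1 + real n) / (2 + real n))) \<longlonglongrightarrow> 1 * 1"
      by (intro tendsto_mult of_nat_quotient_tendsto_1)
    moreover have "(pochhammer f (n + 2) / fact (n + 2)) / (pochhammer f n / fact n) = (f + real n) / (1 + real n) * ((f + 1 + real n) / (2 + real n))" for n
      using pochhammer_pos[OF f, of n] by (simp add: pochhammer_Suc add_ac mult_ac)
    ultimately show ?thesis by simp
  qed
  obtain \<kappa>1 J1 where \<kappa>1: "\<kappa>1 > 0" "\<And>n. n \<ge> J1 \<Longrightarrow> \<kappa>1 \<le> pochhammer f n / fact n * \<rho> ^ n"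
    using subexponential_lower_bound[OF always_eventually ratio \<rho>(1)] pos by metis
  show ?thesis
  proof (rule that[OF \<rho>(1)])
    fix \<kappa> J
    obtain n where n: "n \<ge> max J (max J1 1)" "(\<rho>\<^sup>2) ^ n > \<kappa> / \<kappa>1" using power_unbounded[of "\<rho>\<^sup>2"] \<rho> by (metis one_less_power pos2)
    have "\<kappa> * \<rho> ^ n < (\<kappa>1 * (\<rho>\<^sup>2) ^ n) * \<rho> ^ n" using n(2) \<kappa>1 \<rho> by (simp add: field_simps)
    also have "\<dots> \<le> ((pochhammer f n / fact n * \<rho> ^ n) * (\<rho>\<^sup>2) ^ n) * \<rho> ^ n"
      using \<kappa>1(2)[of n] n(1) \<rho> by (intro mult_right_mono) auto
    also have "\<dots> = pochhammer f n / fact n * (1 + y) ^ n"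
    proof -
      have "\<rho> ^ n * (\<rho>\<^sup>2) ^ n * \<rho> ^ n = (\<rho> ^ 4) ^ n"
        unfolding power_mult[symmetric] power_add[symmetric] by (rule arg_cong[of _ _ "power \<rho>"]) simp
      then show ?thesis unfolding \<rho>(2)[symmetric] by (simp only: mult.assoc)
    qed
    also have "\<dots> \<le> norm (K n x)" by (rule lower) (use n in simp)
    finally show "\<exists>n\<ge>J. norm (K n x) > \<kappa> * \<rho> ^ n" using n(1) by auto
  qed
next
  case False
  obtain M where M: "M > 0" "\<And>n. \<bar>\<alpha> n\<bar> \<le> M" using \<alpha>_bounded by (auto simp: Bseq_def)
  define S where "S = (\<lambda>N. \<Sum>n\<le>N. (norm (p n x))\<^sup>2)"
  have S0: "S N \<ge> 0" for N by (simp add: S_def sum_nonneg)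
  define \<epsilon> where "\<epsilon> = 2 * \<bar>Im x\<bar> / M"
  have \<epsilon>: "\<epsilon> > 0" using False M by (simp add: \<epsilon>_def)
  \<comment> \<open>The increment over two steps consists of the squares of the two factors whose
    product bounds the imaginary part, so the arithmetic-geometric mean inequality applies.\<close>
  have grow: "S (Suc (Suc N)) \<ge> (1 + \<epsilon>) * S N" for N
  proof -
    have "\<bar>Im x\<bar> * S (Suc N) = \<bar>\<alpha> (Suc N) * Im (p (Suc (Suc N)) x * cnj (p (Suc N) x))\<bar>"
      using sum_norm_p_square[of x "Suc N"] S0[of "Suc N"] unfolding S_def by (metis abs_mult abs_of_nonneg)
    also have "\<dots> \<le> M * (norm (p (Suc (Suc N)) x) * norm (p (Suc N) x))"
      unfolding abs_mult using M abs_Im_le_cmod[of "p (Suc (Suc N)) x * cnj (p (Suc N) x)"] by (intro mult_mono) (auto simp: norm_mult)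
    also have "\<dots> \<le> M * (((norm (p (Suc (Suc N)) x))\<^sup>2 + (norm (p (Suc N) x))\<^sup>2) / 2)"
      using M sum_squares_bound[of "norm (p (Suc (Suc N)) x)" "norm (p (Suc N) x)"] by (intro mult_left_mono) auto
    also have "\<dots> = M * ((S (Suc (Suc N)) - S N) / 2)" by (simp add: S_def)
    finally have "\<epsilon> * S (Suc N) \<le> S (Suc (Suc N)) - S N" using M by (simp add: \<epsilon>_def field_simps)
    moreover have "\<epsilon> * S N \<le> \<epsilon> * S (Suc N)" using \<epsilon> by (simp add: S_def)
    ultimately show ?thesis by (simp add: algebra_simps)
  qed
  \<comment> \<open>The sums grow at least like \<rho>^(6N). If the claim failed, |K_n|^2 would cost
    \<rho>^(2n) and 1/h_n another \<rho>^n, so the sums would be O(\<rho>^(3N)); the exponent 12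
    leaves room between the two.\<close>
  define \<rho> where "\<rho> = root 12 (1 + \<epsilon>)"
  have \<rho>: "\<rho> > 1" "\<rho> ^ 12 = 1 + \<epsilon>" using \<epsilon> by (auto simp: \<rho>_def)
  have low: "\<rho> ^ (12 * k) \<le> S (2 * k)" for k
  proof (induction k)
    case (Suc k)
    have "\<rho> ^ (12 * Suc k) = (1 + \<epsilon>) * \<rho> ^ (12 * k)"
      unfolding \<rho>(2)[symmetric] power_add[symmetric] by (rule arg_cong[of _ _ "power \<rho>"]) simp
    also have "\<dots> \<le> (1 + \<epsilon>) * S (2 * k)" using Suc \<epsilon> by (intro mult_left_mono) auto
    also have "\<dots> \<le> S (2 * Suc k)" using grow[of "2 * k"] by simp
    finally show ?case .
  qed (simp add: S_def)
  obtain \<kappa>1 J1 where \<kappa>1: "\<kappa>1 > 0" "\<And>n. n \<ge> J1 \<Longrightarrow> \<kappa>1 \<le> h n * \<rho> ^ n"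
    using subexponential_lower_bound[OF always_eventually h_ratio \<rho>(1)] h_pos by metis
  show ?thesis
  proof (rule that[OF \<rho>(1)], rule ccontr)
    fix \<kappa> J
    assume "\<not> (\<exists>n\<ge>J. norm (K n x) > \<kappa> * \<rho> ^ n)"
    then have le: "norm (K n x) \<le> \<kappa> * \<rho> ^ n" if "n \<ge> J" for n using that by (auto simp: not_less)
    define J2 where "J2 = max J J1"
    define \<kappa>2 where "\<kappa>2 = \<kappa>\<^sup>2 / \<kappa>1"
    have \<kappa>2: "\<kappa>2 \<ge> 0" using \<kappa>1 by (simp add: \<kappa>2_def)
    have ple: "(norm (p n x))\<^sup>2 \<le> \<kappa>2 * (\<rho> ^ 3) ^ n" if n: "n \<ge> J2" for n
    proof -
      have "(norm (K n x))\<^sup>2 \<le> (\<kappa> * \<rho> ^ n)\<^sup>2" using le[of n] n by (intro power_mono) (auto simp: J2_def)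
      moreover have "(norm (p n x))\<^sup>2 = (norm (K n x))\<^sup>2 / h n"
        using h_pos[of n] by (simp add: p_def norm_divide power_divide less_imp_le)
      moreover have "1 / h n \<le> \<rho> ^ n / \<kappa>1" using \<kappa>1(2)[of n] \<kappa>1(1) n h_pos[of n] by (simp add: J2_def field_simps)
      ultimately have "(norm (p n x))\<^sup>2 \<le> (\<kappa> * \<rho> ^ n)\<^sup>2 * (\<rho> ^ n / \<kappa>1)"
        using mult_mono[of "(norm (K n x))\<^sup>2" "(\<kappa> * \<rho> ^ n)\<^sup>2" "1 / h n" "\<rho> ^ n / \<kappa>1"] h_pos[of n] by simp
      also have "\<dots> = \<kappa>2 * (\<rho> ^ 3) ^ n"
        by (simp add: \<kappa>2_def power_mult_distrib power2_eq_square power3_eq_cube mult_ac)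
      finally show ?thesis .
    qed
    have r: "\<rho> ^ 3 > 1" using \<rho> by simp
    have Sle: "S N \<le> S J2 + \<kappa>2 / (\<rho> ^ 3 - 1) * (\<rho> ^ 3) ^ Suc N" if "N \<ge> J2" for N
      using that
    proof (induction N rule: dec_induct)
      case base
      then show ?case using \<kappa>2 r \<rho>(1) by (simp add: divide_nonneg_pos)
    next
      case (step N)
      have "S (Suc N) \<le> S J2 + \<kappa>2 / (\<rho> ^ 3 - 1) * (\<rho> ^ 3) ^ Suc N + \<kappa>2 * (\<rho> ^ 3) ^ Suc N"
      proof -
        have "S (Suc N) = S N + (norm (p (Suc N) x))\<^sup>2" by (simp add: S_def)
        moreover have "(norm (p (Suc N) x))\<^sup>2 \<le> \<kappa>2 * (\<rho> ^ 3) ^ Suc N" by (rule ple) (use step.hyps in simp)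
        ultimately show ?thesis using step.IH by linarith
      qed
      also have "\<dots> = S J2 + \<kappa>2 / (\<rho> ^ 3 - 1) * (\<rho> ^ 3) ^ Suc (Suc N)"
      proof -
        have "k / (r - 1) * z + k * z = k / (r - 1) * (r * z)" if "r > 1" for k r z :: real
          using that by (simp add: field_simps)
        from this[OF r, of \<kappa>2 "(\<rho> ^ 3) ^ Suc N"] show ?thesis unfolding power_Suc[of _ "Suc N"] by linarith
      qed
      finally show ?case .
    qed
    define Q where "Q = S J2 + \<kappa>2 / (\<rho> ^ 3 - 1) * \<rho> ^ 3"
    have "\<rho> ^ 6 > 1" using \<rho>(1) by simp
    from power_unbounded[OF this, of J2 Q] obtain k where k: "k \<ge> J2" "(\<rho> ^ 6) ^ k > Q" by blast
    have one: "(\<rho> ^ 6) ^ k \<ge> 1" using one_le_power[of "\<rho> ^ 6" k] \<open>\<rho> ^ 6 > 1\<close> by linarith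
    have "(\<rho> ^ 6) ^ k * (\<rho> ^ 6) ^ k = \<rho> ^ (12 * k)"
      unfolding power_mult[symmetric] power_add[symmetric] by (rule arg_cong[of _ _ "power \<rho>"]) simp
    also have "\<dots> \<le> S (2 * k)" by (rule low)
    also have "\<dots> \<le> S J2 + \<kappa>2 / (\<rho> ^ 3 - 1) * (\<rho> ^ 3) ^ Suc (2 * k)" by (rule Sle) (use k in linarith)
    also have "(\<rho> ^ 3) ^ Suc (2 * k) = \<rho> ^ 3 * (\<rho> ^ 6) ^ k"
      unfolding power_mult[symmetric] power_add[symmetric] by (rule arg_cong[of _ _ "power \<rho>"]) simp
    also have "S J2 + \<kappa>2 / (\<rho> ^ 3 - 1) * (\<rho> ^ 3 * (\<rho> ^ 6) ^ k) \<le> S J2 * (\<rho> ^ 6) ^ k + \<kappa>2 / (\<rho> ^ 3 - 1) * (\<rho> ^ 3 * (\<rho> ^ 6) ^ k)"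
      using mult_left_mono[OF one S0[of J2]] by linarith
    also have "\<dots> = Q * (\<rho> ^ 6) ^ k" unfolding Q_def distrib_right by (simp only: mult.assoc)
    finally have "(\<rho> ^ 6) ^ k * (\<rho> ^ 6) ^ k \<le> Q * (\<rho> ^ 6) ^ k" .
    moreover have "Q * (\<rho> ^ 6) ^ k < (\<rho> ^ 6) ^ k * (\<rho> ^ 6) ^ k" by (rule mult_strict_right_mono) (use k one in linarith)+
    ultimately show False by linarith
  qed
qed

section \<open>Expansions in the original polynomials K_j\<close>

definition cbar :: "(nat \<Rightarrow> complex) \<Rightarrow> nat \<Rightarrow> complex" where
  "cbar c j = (\<Sum>m. c m * of_real (conn f s m j))"

lemma C_p_eq:
  assumes "summable (\<lambda>m. norm (c m))"
  shows "C c j * p j x = cbar c j * K j x"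
proof -
  have nz: "complex_of_real (sqrt (h j)) \<noteq> 0" using sqrt_h_pos[of j] by (metis of_real_eq_0_iff less_irrefl)
  have "C c j / of_real (sqrt (h j)) = (\<Sum>m. c m * of_real (q m j) / of_real (sqrt (h j)))"
    unfolding C_def by (rule suminf_divide[symmetric]) (rule summable_C[OF assms])
  also have "\<dots> = cbar c j" unfolding cbar_def q_def using nz by simp
  finally have e: "C c j / of_real (sqrt (h j)) = cbar c j" .
  show ?thesis unfolding e[symmetric] by (simp add: p_def)
qed

text \<open>With the same \<rho>, the coefficients are eventually at least \<kappa> \<rho>^(-n),
  while |K_n| exceeds \<rho>^n / \<kappa> for arbitrarily large n. The terms therefore do not tend
  to 0.\<close>

lemma not_summable_outside:
  assumes x: "x \<notin> complex_of_real ` {0..1}" "norm x \<le> 1"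
    and nz: "eventually (\<lambda>n. u n \<noteq> 0) sequentially" and ratio: "(\<lambda>n. norm (u (n + 2)) / norm (u n :: complex)) \<longlonglongrightarrow> 1"
  shows "\<not> summable (\<lambda>n. u n * K n x)"
proof
  assume sm: "summable (\<lambda>n. u n * K n x)"
  obtain \<rho> where \<rho>: "\<rho> > 1" "\<And>\<kappa> J. \<exists>n\<ge>J. norm (K n x) > \<kappa> * \<rho> ^ n"
    using K_exponential_growth[OF x] by metis
  have "eventually (\<lambda>n. norm (u n) > 0) sequentially" using nz by simp
  then obtain \<kappa> J where \<kappa>: "\<kappa> > 0" "\<And>n. n \<ge> J \<Longrightarrow> \<kappa> \<le> norm (u n) * \<rho> ^ n"
    using subexponential_lower_bound[OF _ ratio \<rho>(1)] by metis
  obtain J' where J': "\<And>n. n \<ge> J' \<Longrightarrow> norm (u n * K n x) < 1"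
    using LIMSEQ_D[OF summable_LIMSEQ_zero[OF sm], of 1] by auto
  obtain n where n: "n \<ge> max J J'" "norm (K n x) > 1 / \<kappa> * \<rho> ^ n" using \<rho>(2) by blast
  have "\<rho> ^ n = \<kappa> * (1 / \<kappa> * \<rho> ^ n)" using \<kappa> by simp
  also have "\<dots> < \<kappa> * norm (K n x)" using n \<kappa> by (intro mult_strict_left_mono) auto
  also have "\<dots> \<le> (norm (u n) * \<rho> ^ n) * norm (K n x)" using \<kappa>(2)[of n] n by (intro mult_right_mono) auto
  also have "\<dots> = norm (u n * K n x) * \<rho> ^ n" by (simp add: norm_mult)
  also have "\<dots> \<le> 1 * \<rho> ^ n" using J'[of n] n \<rho>(1) by (intro mult_right_mono) auto
  finally show False by simp
qed

text \<open>The alternative \<open>alt\<close> settles the points outside the unit interval: an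
  infinite expansion of the second kind diverges there, so summability leaves only polynomials, for
  which the identity is a finite rearrangement.\<close>

theorem jacobi_expansion:
  assumes c: "summable (\<lambda>m. norm (c m))" and x: "norm x \<le> 1"
    and alt: "(\<exists>M. \<forall>m>M. c m = 0) \<or>
      (eventually (\<lambda>j. cbar c j \<noteq> 0) sequentially \<and> (\<lambda>j. norm (cbar c (j + 2)) / norm (cbar c j)) \<longlonglongrightarrow> 1)"
  shows "x \<in> complex_of_real ` {0<..1} \<Longrightarrow> summable (\<lambda>j. cbar c j * K j x)"
    and "summable (\<lambda>j. cbar c j * K j x) \<Longrightarrow> (\<Sum>m. c m * x ^ m) = (\<Sum>j. cbar c j * K j x)"
proof -
  have pos: "(\<lambda>j. cbar c j * K j x) sums (\<Sum>m. c m * x ^ m)" if x01: "x \<in> complex_of_real ` {0<..1}"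
  proof -
    obtain y where y: "x = of_real y" "0 < y" "y \<le> 1" using x01 by auto
    show ?thesis
    proof (cases "y = 1")
      case True
      then show ?thesis using sums_at_1[OF c] y by (simp add: C_p_eq[OF c])
    next
      case False
      then show ?thesis using sums_interior[OF c, of y] y by (simp add: C_p_eq[OF c])
    qed
  qed
  then show "x \<in> complex_of_real ` {0<..1} \<Longrightarrow> summable (\<lambda>j. cbar c j * K j x)"
    using sums_summable by blast
  assume sm: "summable (\<lambda>j. cbar c j * K j x)"
  consider "x \<in> complex_of_real ` {0<..1}" | "x = 0" | "x \<notin> complex_of_real ` {0..1}"
  proof -
    have "x = 0" if "x \<in> complex_of_real ` {0..1}" "x \<notin> complex_of_real ` {0<..1}"
      using that by force
    then show ?thesis using that by blast
  qed
  then show "(\<Sum>m. c m * x ^ m) = (\<Sum>j. cbar c j * K j x)"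
  proof cases
    case 1
    then show ?thesis using pos by (simp add: sums_iff)
  next
    case 2
    have "(\<lambda>j. C c j * p j 0) sums (\<Sum>j. cbar c j * K j x)"
      using sm unfolding C_p_eq[OF c] 2 by (rule summable_sums)
    then have "(\<Sum>j. cbar c j * K j x) = c 0" by (rule sums_at_0_unique[OF c])
    moreover have "(\<Sum>m. c m * x ^ m) = c 0" using 2 by (simp add: powser_zero)
    ultimately show ?thesis by simp
  next
    case 3
    with not_summable_outside[OF 3 x] sm alt obtain M where M: "\<And>m. m > M \<Longrightarrow> c m = 0" by blast
    have cb: "cbar c j = (\<Sum>m\<le>M. c m * of_real (conn f s m j))" for j
      unfolding cbar_def by (rule suminf_finite) (use M in auto)
    have "(\<Sum>j. cbar c j * K j x) = (\<Sum>j\<le>M. cbar c j * K j x)"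
      by (rule suminf_finite) (auto simp: cb)
    also have "\<dots> = (\<Sum>m\<le>M. c m * (\<Sum>j\<le>M. of_real (q m j) * p j x))"
    proof -
      have "of_real (conn f s m j) * K j x = of_real (q m j) * p j x" for m j
        unfolding K_eq q_def by simp
      then have "cbar c j * K j x = (\<Sum>m\<le>M. c m * (of_real (q m j) * p j x))" for j
        unfolding cb sum_distrib_right by (simp add: mult.assoc)
      then show ?thesis by (simp only: sum_distrib_left) (rule sum.swap)
    qed
    also have "\<dots> = (\<Sum>m\<le>M. c m * x ^ m)"
      by (intro sum.cong refl) (simp add: power_eq_sum_p[symmetric])
    also have "\<dots> = (\<Sum>m. c m * x ^ m)"
      by (rule suminf_finite[symmetric]) (use M in auto)
    finally show ?thesis by simp
  qed
qed

end

subsection \<open>Expansions of hypergeometric functions\<close>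

lemma hyp2F1_altdef: "hyp2F1 a b c x = (\<Sum>m. hyp3F2_term a b 1 c 1 m * x ^ m)"
  unfolding hyp2F1_def hyp3F2_term_def by (intro suminf_cong) (simp add: pochhammer_fact[symmetric])

context jacobi_params
begin

text \<open>\<open>conn\<close> vanishes for m < j, and with m = k + j every Pochhammer symbol
  splits at j. The shifted 3F2 has parametric excess c - a - b + d for every j, so it
  converges.\<close>

lemma cbar_hyp3F2:
  fixes a b c :: complex
  assumes c: "c \<notin> \<int>\<^sub>\<le>\<^sub>0" and pos: "Re (c - a - b) > 0"
  shows "cbar (hyp3F2_term a b 1 c 1) j = pochhammer a j * pochhammer b j / (pochhammer c j * pochhammer (of_real s + of_nat j - 1) j)
    * (\<Sum>k. hyp3F2_term (a + of_nat j) (b + of_nat j) (of_real f + of_nat j) (c + of_nat j) (of_real s + 2 * of_nat j) k)"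
proof -
  let ?P = "pochhammer a j * pochhammer b j / (pochhammer c j * pochhammer (of_real s + of_nat j - 1) j)"
  let ?T = "hyp3F2_term (a + of_nat j) (b + of_nat j) (of_real f + of_nat j) (c + of_nat j) (of_real s + 2 * of_nat j)"
  let ?g = "\<lambda>m. hyp3F2_term a b 1 c 1 m * of_real (conn f s m j)"
  have eq: "?g (k + j) = ?P * ?T k" for k
  proof -
    have sp: "pochhammer z (k + j) = pochhammer z j * pochhammer (z + of_nat j) k" for z :: complex
      using pochhammer_product'[of z j k] by (simp add: add.commute)
    have bf: "of_nat ((k + j) choose j) * fact j / fact (k + j) = (1 / fact k :: complex)"
      by (simp add: binomial_fact[of j "k + j"])
    have "?g (k + j) = pochhammer a (k + j) * pochhammer b (k + j) / pochhammer c (k + j) * (of_nat ((k + j) choose j) * fact j / fact (k + j))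
      * pochhammer (of_real f + of_nat j) k / (pochhammer (of_real s + of_nat j - 1) j * pochhammer (of_real s + 2 * of_nat j) k)"
    proof -
      have "A * B * F / (D * F * G) * (M * N * Q / (R * T)) = A * B / D * (M * N / G) * Q / (R * T)"
        if "F \<noteq> 0" for A B F D G M N Q R T :: complex
        using that by simp
      moreover have "pochhammer 1 (k + j) \<noteq> (0 :: complex)" by (simp flip: pochhammer_fact)
      ultimately show ?thesis
        unfolding hyp3F2_term_def of_real_rec unfolding conn_def add_diff_cancel_right' by blast
    qed
    also have "\<dots> = ?P * ?T k"
      unfolding bf sp hyp3F2_term_def by (simp add: mult_ac)
    finally show ?thesis .
  qed
  have T: "summable ?T"
  proof (rule summable_norm_cancel[OF summable_norm_hyp3F2_term])
    show "c + of_nat j \<notin> \<int>\<^sub>\<le>\<^sub>0" by (rule add_of_nat_notin_nonpos_Ints(1)[OF c])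
    show "complex_of_real s + 2 * of_nat j \<notin> \<int>\<^sub>\<le>\<^sub>0" using s by (intro Re_pos_notin_nonpos_Ints) (simp add: add_pos_nonneg)
    show "Re (c + of_nat j + (of_real s + 2 * of_nat j) - (a + of_nat j) - (b + of_nat j) - (of_real f + of_nat j)) > 0"
      using pos d by (simp add: s_def)
  qed
  have "summable (\<lambda>k. ?g (k + j))" unfolding eq by (intro summable_mult T)
  then have g: "summable ?g" using summable_iff_shift[of ?g j] by blast
  have "cbar (hyp3F2_term a b 1 c 1) j = (\<Sum>k. ?g (k + j)) + (\<Sum>m<j. ?g m)"
    unfolding cbar_def by (rule suminf_split_initial_segment[OF g])
  also have "(\<Sum>m<j. ?g m) = 0" by (intro sum.neutral) auto
  also have "(\<Sum>k. ?g (k + j)) = ?P * (\<Sum>k. ?T k)" unfolding eq by (rule suminf_mult[OF T])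
  finally show ?thesis by simp
qed

text \<open>The common frame of the three cases: a summation theorem supplies the constant k and the
  coefficients u. If a or b is a nonpositive integer the Gauss series is a polynomial; otherwise u
  has to satisfy the ratio condition.\<close>

lemma expansion_hyp2F1:
  fixes a b c x k :: complex
  assumes c: "c \<notin> \<int>\<^sub>\<le>\<^sub>0" and pos: "Re (c - a - b) > 0" and x: "norm x \<le> 1"
    and cb: "\<And>j. cbar (hyp3F2_term a b 1 c 1) j = k * u j" and k: "k \<noteq> 0" and t: "\<And>j. t j = u j * K j x"
    and alt: "a \<notin> \<int>\<^sub>\<le>\<^sub>0 \<Longrightarrow> b \<notin> \<int>\<^sub>\<le>\<^sub>0 \<Longrightarrow> eventually (\<lambda>j. u j \<noteq> 0) sequentially \<and> (\<lambda>j. u (j + 2) / u j) \<longlonglongrightarrow> 1"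
  shows "(x \<in> complex_of_real ` {0<..1} \<longrightarrow> summable t) \<and> (summable t \<longrightarrow> hyp2F1 a b c x = k * (\<Sum>j. t j))"
proof -
  let ?c = "hyp3F2_term a b 1 c 1"
  have sm: "summable (\<lambda>m. norm (?c m))"
    by (rule summable_norm_hyp3F2_term) (use c pos in auto)
  have alt': "(\<exists>M. \<forall>m>M. ?c m = 0) \<or>
      (eventually (\<lambda>j. cbar ?c j \<noteq> 0) sequentially \<and> (\<lambda>j. norm (cbar ?c (j + 2)) / norm (cbar ?c j)) \<longlonglongrightarrow> 1)"
  proof (cases "a \<in> \<int>\<^sub>\<le>\<^sub>0 \<or> b \<in> \<int>\<^sub>\<le>\<^sub>0")
    case True
    then obtain M where "a = - of_nat M \<or> b = - of_nat M" by (auto elim!: nonpos_Ints_cases')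
    then have "?c m = 0" if "m > M" for m
      using that by (auto simp: hyp3F2_term_def pochhammer_of_nat_eq_0_iff)
    then show ?thesis by blast
  next
    case False
    then have "eventually (\<lambda>j. cbar ?c j \<noteq> 0) sequentially" using alt k by (simp add: cb)
    moreover have "(\<lambda>j. norm (u (j + 2) / u j)) \<longlonglongrightarrow> norm (1 :: complex)"
      using alt False by (intro tendsto_norm) blast
    then have "(\<lambda>j. norm (cbar ?c (j + 2)) / norm (cbar ?c j)) \<longlonglongrightarrow> 1"
      using k by (simp add: cb norm_mult norm_divide)
    ultimately show ?thesis by blast
  qed
  have eq: "cbar ?c j * K j x = k * t j" for j by (simp add: cb t)
  have iff: "summable (\<lambda>j. cbar ?c j * K j x) \<longleftrightarrow> summable t"
    unfolding eq using k by (simp add: summable_cmult_iff)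
  note J = jacobi_expansion[OF sm x alt']
  show ?thesis
  proof (intro conjI impI)
    assume "x \<in> complex_of_real ` {0<..1}"
    then show "summable t" using J(1) iff by blast
  next
    assume st: "summable t"
    have "hyp2F1 a b c x = (\<Sum>j. k * t j)" unfolding hyp2F1_altdef using J(2) iff st by (simp only: eq)
    also have "\<dots> = k * (\<Sum>j. t j)" by (rule suminf_mult[OF st])
    finally show "hyp2F1 a b c x = k * (\<Sum>j. t j)" .
  qed
qed

end

text \<open>For f = c the parameters f + j and c + j of the 3F2 cancel, which leaves a Gauss series
  with lower parameter c + d + 2j. The conditions \<open>sa\<close> and \<open>sb\<close> keep the
  Gamma functions away from their poles and the Pochhammer symbols in the denominator away from
  0.\<close>

lemma hyp2F1_jacobi_gauss:
  fixes a b c x :: complex and d f :: real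
  assumes c: "c \<notin> \<int>\<^sub>\<le>\<^sub>0" and pos: "Re (c - a - b) > 0" and x: "norm x \<le> 1" and d: "d > 0" and f: "f > 0"
    and fc: "of_real f = c" and s1: "c + of_real d \<noteq> 1"
    and sa: "c + of_real d - a \<notin> \<int>\<^sub>\<le>\<^sub>0" and sb: "c + of_real d - b \<notin> \<int>\<^sub>\<le>\<^sub>0"
  defines "t \<equiv> \<lambda>j. jacobiK j x c (of_real d) *
                    (pochhammer a j * pochhammer b j * pochhammer (c + of_real d - 1) j *
                       (c + of_real d + 2 * of_nat j - 1)) /
                    (pochhammer c j * pochhammer (of_real d + c - a) j *
                       pochhammer (of_real d + c - b) j)"
  shows "(x \<in> complex_of_real ` {0<..1} \<longrightarrow> summable t) \<and> (summable t \<longrightarrow>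
    hyp2F1 a b c x = Gamma (c + of_real d - 1) * Gamma (c + of_real d - a - b) /
                  (Gamma (c + of_real d - a) * Gamma (c + of_real d - b)) * (\<Sum>j. t j))"
proof -
  interpret jacobi_params f d by unfold_locales (use f d in auto)
  define S where "S = c + of_real d"
  have S: "S = of_real s" by (simp add: S_def s_def fc[symmetric])
  have ReS: "Re S > 0" using s by (simp add: S)
  have Sab: "Re (S - a - b) > 0" using pos d by (simp add: S_def)
  have sa': "S - a \<notin> \<int>\<^sub>\<le>\<^sub>0" and sb': "S - b \<notin> \<int>\<^sub>\<le>\<^sub>0" using sa sb by (simp_all add: S_def)
  \<comment> \<open>Since Re S > 0, the only nonpositive integer that S - 1 could be is 0, and this
    is excluded by c + d being different from 1.\<close>
  have S1: "S - 1 \<notin> \<int>\<^sub>\<le>\<^sub>0"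
  proof
    assume "S - 1 \<in> \<int>\<^sub>\<le>\<^sub>0"
    then obtain n where n: "S - 1 = - of_nat n" by (auto elim!: nonpos_Ints_cases')
    have "Re (S - 1) = - real n" unfolding n by simp
    then have "real n < 1" using ReS by simp
    then have "n = 0" by simp
    then show False using n s1 by (simp add: S_def)
  qed
  define u where "u = (\<lambda>j. pochhammer a j * pochhammer b j * pochhammer (S - 1) j * (S + 2 * of_nat j - 1) /
     (pochhammer c j * pochhammer (S - a) j * pochhammer (S - b) j))"
  define k where "k = Gamma (S - 1) * Gamma (S - a - b) / (Gamma (S - a) * Gamma (S - b))"
  have knz: "k \<noteq> 0"
    unfolding k_def using S1 Re_pos_notin_nonpos_Ints[OF Sab] sa' sb' by (simp add: Gamma_eq_zero_iff)
  have cb: "cbar (hyp3F2_term a b 1 c 1) j = k * u j" for j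
  proof -
    have "hyp3F2_term (a + of_nat j) (b + of_nat j) (of_real f + of_nat j) (c + of_nat j) (of_real s + 2 * of_nat j) m
        = hyp3F2_term (a + of_nat j) (b + of_nat j) 1 (S + 2 * of_nat j) 1 m" for m
      unfolding hyp3F2_term_def fc S
      using add_of_nat_notin_nonpos_Ints(3)[OF add_of_nat_notin_nonpos_Ints(1)[OF c, of j], of m]
      by (simp add: pochhammer_fact[symmetric] mult_ac)
    then have "(\<Sum>m. hyp3F2_term (a + of_nat j) (b + of_nat j) (of_real f + of_nat j) (c + of_nat j) (of_real s + 2 * of_nat j) m)
      = (\<Sum>m. hyp3F2_term (a + of_nat j) (b + of_nat j) 1 (S + 2 * of_nat j) 1 m)" by (rule suminf_cong)
    also have "\<dots> = Gamma (S + 2 * of_nat j) * Gamma (S + 2 * of_nat j - (a + of_nat j) - (b + of_nat j))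
       * rGamma (S + 2 * of_nat j - (a + of_nat j)) * rGamma (S + 2 * of_nat j - (b + of_nat j))"
      by (rule gauss_sum) (use ReS Sab in \<open>auto intro!: Re_pos_notin_nonpos_Ints simp: add_pos_nonneg\<close>)
    also have "S + 2 * of_nat j - (a + of_nat j) - (b + of_nat j) = S - a - b" by simp
    also have "S + 2 * of_nat j - (a + of_nat j) = S - a + of_nat j" by simp
    also have "S + 2 * of_nat j - (b + of_nat j) = S - b + of_nat j" by simp
    also have "rGamma (S - a + of_nat j) = rGamma (S - a) / pochhammer (S - a) j"
      using pochhammer_rGamma[of "S - a" j] add_of_nat_notin_nonpos_Ints(3)[OF sa', of j] by simp
    also have "rGamma (S - b + of_nat j) = rGamma (S - b) / pochhammer (S - b) j"
      using pochhammer_rGamma[of "S - b" j] add_of_nat_notin_nonpos_Ints(3)[OF sb', of j] by simp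
    \<comment> \<open>The 2j + 1 steps from S - 1 to S + 2j are split so that the middle block
      cancels the Pochhammer symbol in the denominator of \<open>cbar_hyp3F2\<close>.\<close>
    also have "Gamma (S + 2 * of_nat j) = pochhammer (S - 1) j * (pochhammer (S + of_nat j - 1) j * (S + 2 * of_nat j - 1)) * Gamma (S - 1)"
    proof -
      have "pochhammer (S - 1) (j + Suc j) = pochhammer (S - 1) j * (pochhammer (S + of_nat j - 1) j * (S + 2 * of_nat j - 1))"
        unfolding pochhammer_product' pochhammer_Suc by (simp add: algebra_simps)
      moreover have "pochhammer (S - 1) (j + Suc j) * Gamma (S - 1) = Gamma (S - 1 + of_nat (j + Suc j))"
        using pochhammer_Gamma[OF S1, of "j + Suc j"] S1 by (simp add: Gamma_eq_zero_iff)
      moreover have "S - 1 + of_nat (j + Suc j) = S + 2 * of_nat j" by simp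
      ultimately show ?thesis by simp
    qed
    finally have W: "(\<Sum>m. hyp3F2_term (a + of_nat j) (b + of_nat j) (of_real f + of_nat j) (c + of_nat j) (of_real s + 2 * of_nat j) m)
      = pochhammer (S - 1) j * (pochhammer (S + of_nat j - 1) j * (S + 2 * of_nat j - 1)) * Gamma (S - 1) * Gamma (S - a - b)
        * (rGamma (S - a) / pochhammer (S - a) j) * (rGamma (S - b) / pochhammer (S - b) j)" .
    have nz: "pochhammer (S + of_nat j - 1) j \<noteq> 0"
      using add_of_nat_notin_nonpos_Ints(3)[OF add_of_nat_notin_nonpos_Ints(1)[OF S1, of j], of j] by (simp add: add_diff_eq diff_add_eq)
    show ?thesis
      unfolding cbar_hyp3F2[OF c pos] W unfolding S[symmetric] k_def u_def rGamma_inverse_Gamma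
      using nz by (simp add: divide_inverse mult_ac)
  qed
  have alt: "eventually (\<lambda>j. u j \<noteq> 0) sequentially \<and> (\<lambda>j. u (j + 2) / u j) \<longlonglongrightarrow> 1" if ab: "a \<notin> \<int>\<^sub>\<le>\<^sub>0" "b \<notin> \<int>\<^sub>\<le>\<^sub>0"
  proof -
    have n1: "S + 2 * of_nat j - 1 \<noteq> 0" for j
      using add_of_nat_notin_nonpos_Ints(2)[OF S1, of "2 * j"] by (simp add: algebra_simps)
    have unz: "u j \<noteq> 0" for j
      unfolding u_def using add_of_nat_notin_nonpos_Ints(3)[of _ j] ab c sa' sb' S1 n1[of j] by auto
    define r where "r = (\<lambda>j. (a + of_nat j) / (c + of_nat j) * ((b + of_nat j) / (S - a + of_nat j)) * ((S - 1 + of_nat j) / (S - b + of_nat j))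
       * (((S + 1) / 2 + of_nat j) / ((S - 1) / 2 + of_nat j)))"
    have r: "r \<longlonglongrightarrow> 1 * 1 * 1 * 1" unfolding r_def by (intro tendsto_mult of_nat_quotient_tendsto_1)
    have u_Suc: "u (Suc j) = u j * r j" for j
    proof -
      have e: "(S + 1) / 2 + of_nat j = (S + 2 * of_nat (Suc j) - 1) / 2" "(S - 1) / 2 + of_nat j = (S + 2 * of_nat j - 1) / 2"
        by (simp_all add: field_simps)
      have "A * x1 * (B * x2) * (P * x3) * n2 / (D * y1 * (E * y2) * (F * y3)) = A * B * P * n / (D * E * F) * (x1 / y1 * (x2 / y2) * (x3 / y3) * ((n2 / 2) / (n / 2)))"
        if "n \<noteq> 0" for A B P D E F x1 x2 x3 y1 y2 y3 n2 n :: complex using that by (simp add: mult_ac)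
      from this[OF n1] show ?thesis unfolding u_def r_def e pochhammer_Suc .
    qed
    have "u (j + 2) / u j = r (Suc j) * r j" for j using unz[of j] by (simp add: u_Suc mult_ac)
    then have "(\<lambda>j. u (j + 2) / u j) \<longlonglongrightarrow> 1" using tendsto_mult[OF LIMSEQ_Suc[OF r] r] by simp
    then show ?thesis using unz by simp
  qed
  have tu: "t j = u j * jacobiK j x (of_real f) (of_real d)" for j
    unfolding t_def u_def S_def fc by (simp add: add_ac mult_ac)
  show ?thesis
    using expansion_hyp2F1[OF c pos x cb knz tu alt] unfolding k_def S_def by simp
qed

text \<open>The common shape of the coefficients in both applications of Watson's theorem, with four
  Gamma arguments moving by 1/2 per index. Since Gamma is 0 at its poles and 1/0 = 0,
  \<open>rGamma\<close> agrees everywhere with the reciprocals of Gamma in the final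
  statement.\<close>

definition watson_coeff :: "complex \<Rightarrow> complex \<Rightarrow> complex \<Rightarrow> complex \<Rightarrow> complex \<Rightarrow> complex \<Rightarrow> complex \<Rightarrow> complex \<Rightarrow> nat \<Rightarrow> complex" where
  "watson_coeff a b c s z1 z2 z3 z4 j = pochhammer a j * pochhammer b j * Gamma ((s + 1) / 2 + of_nat j) * Gamma (c + of_nat j)
     / (pochhammer c j * pochhammer (s + of_nat j - 1) j)
     * (rGamma (z1 + of_nat j / 2) * rGamma (z2 + of_nat j / 2) * rGamma (z3 + of_nat j / 2) * rGamma (z4 + of_nat j / 2))"

text \<open>Raising j by 2 raises each of the four Gamma arguments by 1, so the quotient is a
  product of eight factors (v+j)/(w+j). All powers of 2 cancel, and each factor tends to 1 whatever
  the shifts, so z1, ..., z4 are arbitrary.\<close>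

lemma watson_coeff_alt:
  fixes a b c z1 z2 z3 z4 :: complex and s :: real
  assumes c: "c \<notin> \<int>\<^sub>\<le>\<^sub>0" and ab: "a \<notin> \<int>\<^sub>\<le>\<^sub>0" "b \<notin> \<int>\<^sub>\<le>\<^sub>0" and s: "s > 0"
  defines "u \<equiv> watson_coeff a b c (of_real s) z1 z2 z3 z4"
  shows "eventually (\<lambda>j. u j \<noteq> 0) sequentially \<and> (\<lambda>j. u (j + 2) / u j) \<longlonglongrightarrow> 1"
proof -
  let ?s = "complex_of_real s"
  let ?e = "(?s + 1) / 2"
  have ReE: "Re (?e + of_nat j) > 0" for j using s by (simp add: add_pos_nonneg)
  \<comment> \<open>For small j an argument may be a pole of Gamma and the coefficient 0; hence the
    claims hold only eventually.\<close>
  have zpos: "eventually (\<lambda>j. Re (z + of_nat j / 2) > 0) sequentially" for z :: complex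
  proof -
    obtain N where "real N > 2 * \<bar>Re z\<bar>" using reals_Archimedean2 by blast
    then have "\<forall>j\<ge>N. Re (z + of_nat j / 2) > 0" by auto
    then show ?thesis unfolding eventually_sequentially by blast
  qed
  have spn: "pochhammer (?s + of_nat j - 1) j \<noteq> 0" for j
  proof (cases j)
    case (Suc i)
    have "Re (?s + of_nat j - 1) > 0" using s by (simp add: Suc)
    from add_of_nat_notin_nonpos_Ints(3)[OF Re_pos_notin_nonpos_Ints[OF this]] show ?thesis .
  qed simp
  define r where "r = (\<lambda>j. (a + of_nat j) / (2 * z1 + of_nat j) * ((a + 1 + of_nat j) / (2 * z2 + of_nat j)) * ((b + of_nat j) / (2 * z3 + of_nat j))
    * ((b + 1 + of_nat j) / (2 * z4 + of_nat j)) * ((?e + of_nat j) / ((?s - 1) / 2 + of_nat j)) * ((?e + 1 + of_nat j) / (?s / 2 + of_nat j))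
    * ((?s - 1 + of_nat j) / ((?s + 1) / 2 + of_nat j)) * ((?s + of_nat j) / ((?s + 2) / 2 + of_nat j)))"
  have r: "r \<longlonglongrightarrow> 1 * 1 * 1 * 1 * 1 * 1 * 1 * 1"
    unfolding r_def by (intro tendsto_mult of_nat_quotient_tendsto_1)
  have ev: "eventually (\<lambda>j. u j \<noteq> 0 \<and> u (j + 2) / u j = r j) sequentially"
    using zpos[of z1] zpos[of z2] zpos[of z3] zpos[of z4] eventually_gt_at_top[of 0]
  proof eventually_elim
    case (elim j)
    let ?z = "\<lambda>z. z + of_nat j / 2 :: complex"
    have rz: "rGamma (?z z) \<noteq> 0" if "Re (?z z) > 0" for z
      using Re_pos_notin_nonpos_Ints[OF that] by (simp add: rGamma_eq_zero_iff)
    have rg: "rGamma (z + of_nat (j + 2) / 2) = rGamma (?z z) / ((2 * z + of_nat j) / 2)" if "Re (?z z) > 0" for z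
    proof -
      have "z + of_nat (j + 2) / 2 = ?z z + 1" by (simp add: field_simps)
      moreover have "(2 * z + of_nat j) / 2 = ?z z" by (simp add: field_simps)
      moreover have "?z z \<noteq> 0" using that by (metis less_irrefl zero_complex.sel(1))
      ultimately show ?thesis using rGamma_plus1[of "?z z"] by (simp add: field_simps)
    qed
    have Gc: "Gamma (c + of_nat i) / pochhammer c i = Gamma c" for i
      using pochhammer_Gamma[OF c, of i] add_of_nat_notin_nonpos_Ints(3)[OF c, of i] c by (simp add: Gamma_eq_zero_iff field_simps)
    have Gcnz: "Gamma c \<noteq> 0" using c by (simp add: Gamma_eq_zero_iff)
    have Ge: "Gamma (?e + of_nat j) \<noteq> 0" using Re_pos_notin_nonpos_Ints[OF ReE] by (simp add: Gamma_eq_zero_iff)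
    have Ge2: "Gamma (?e + of_nat (j + 2)) = (?e + of_nat j) * (?e + 1 + of_nat j) * Gamma (?e + of_nat j)"
    proof -
      have e: "?e + of_nat (j + 2) = ?e + of_nat j + 1 + 1" "?e + 1 + of_nat j = ?e + of_nat j + 1" by simp_all
      have 1: "?e + of_nat j \<notin> \<int>\<^sub>\<le>\<^sub>0" by (rule Re_pos_notin_nonpos_Ints[OF ReE])
      have 2: "?e + of_nat j + 1 \<notin> \<int>\<^sub>\<le>\<^sub>0" using add_of_nat_notin_nonpos_Ints(1)[OF 1, of 1] by simp
      show ?thesis unfolding e Gamma_plus1[OF 2] Gamma_plus1[OF 1] by (simp only: mult_ac)
    qed
    \<comment> \<open>The Pochhammer symbol of length j + 4 starting at s + j - 1, split once after
      two factors and once after j factors.\<close>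
    have sp2: "(?s - 1 + of_nat j) * (?s + of_nat j) * pochhammer (?s + of_nat (j + 2) - 1) (j + 2)
       = pochhammer (?s + of_nat j - 1) j * (16 * (((?s - 1) / 2 + of_nat j) * (?s / 2 + of_nat j) * ((?s + 1) / 2 + of_nat j) * ((?s + 2) / 2 + of_nat j)))"
    proof -
      define z where "z = ?s + of_nat j - 1"
      have z: "z + of_nat j = 2 * ((?s - 1) / 2 + of_nat j)" "z + of_nat j + 1 = 2 * (?s / 2 + of_nat j)"
        "z + of_nat j + 2 = 2 * ((?s + 1) / 2 + of_nat j)" "z + of_nat j + 3 = 2 * ((?s + 2) / 2 + of_nat j)"
        by (simp_all add: z_def field_simps)
      have p4: "pochhammer w 4 = w * (w + 1) * (w + 2) * (w + 3)" and p2: "pochhammer w 2 = w * (w + 1)" for w :: complex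
        by (simp_all add: numeral_eq_Suc pochhammer_Suc add_ac)
      have z2: "z + of_nat 2 = ?s + of_nat (j + 2) - 1" "z = ?s - 1 + of_nat j" "z + 1 = ?s + of_nat j" by (simp_all add: z_def)
      have "(?s - 1 + of_nat j) * (?s + of_nat j) * pochhammer (?s + of_nat (j + 2) - 1) (j + 2) = pochhammer z (2 + (j + 2))"
        unfolding pochhammer_product'[of z 2] p2 z2(1) by (simp only: z2(2,3)[symmetric])
      also have "2 + (j + 2) = j + 4" by simp
      also have "pochhammer z (j + 4) = pochhammer z j * ((z + of_nat j) * (z + of_nat j + 1) * (z + of_nat j + 2) * (z + of_nat j + 3))"
        unfolding pochhammer_product'[of z j] p4 ..
      also have "(z + of_nat j) * (z + of_nat j + 1) * (z + of_nat j + 2) * (z + of_nat j + 3)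
        = 16 * (((?s - 1) / 2 + of_nat j) * (?s / 2 + of_nat j) * ((?s + 1) / 2 + of_nat j) * ((?s + 2) / 2 + of_nat j))"
      proof -
        have "(2 * x1) * (2 * x2) * (2 * x3) * (2 * x4) = 16 * (x1 * x2 * x3 * x4)" for x1 x2 x3 x4 :: complex by simp
        then show ?thesis unfolding z(2-4) unfolding z(1) .
      qed
      finally show ?thesis unfolding z_def .
    qed
    define D where "D = 16 * (((?s - 1) / 2 + of_nat j) * (?s / 2 + of_nat j) * ((?s + 1) / 2 + of_nat j) * ((?s + 2) / 2 + of_nat j))"
    have Rs: "?s - 1 + of_nat j \<noteq> 0" "?s + of_nat j \<noteq> 0"
    proof -
      have "Re (?s - 1 + of_nat j) > 0" "Re (?s + of_nat j) > 0" using s elim(5) by auto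
      then show "?s - 1 + of_nat j \<noteq> 0" "?s + of_nat j \<noteq> 0" by (metis less_irrefl zero_complex.sel(1))+
    qed
    have sp2': "pochhammer (?s + of_nat (j + 2) - 1) (j + 2) = pochhammer (?s + of_nat j - 1) j * D / ((?s - 1 + of_nat j) * (?s + of_nat j))"
    proof -
      have "P = Q / (X * Y)" if "X * Y * P = Q" "X \<noteq> 0" "Y \<noteq> 0" for P Q X Y :: complex
        using that by auto
      from this[OF sp2 Rs] show ?thesis unfolding D_def .
    qed
    have pa: "pochhammer z (j + 2) = pochhammer z j * ((z + of_nat j) * (z + 1 + of_nat j))" for z :: complex
      by (simp add: pochhammer_Suc add_ac)
    have ue: "u i = pochhammer a i * pochhammer b i * Gamma (?e + of_nat i) * (Gamma (c + of_nat i) / pochhammer c i) / pochhammer (?s + of_nat i - 1) i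
     * (rGamma (z1 + of_nat i / 2) * rGamma (z2 + of_nat i / 2) * rGamma (z3 + of_nat i / 2) * rGamma (z4 + of_nat i / 2))" for i
      unfolding u_def watson_coeff_def by simp
    have unz: "u j \<noteq> 0"
      unfolding ue Gc using add_of_nat_notin_nonpos_Ints(3)[OF ab(1), of j] add_of_nat_notin_nonpos_Ints(3)[OF ab(2), of j] Ge Gcnz spn[of j] rz elim by simp
    define W where "W = (2 * z1 + of_nat j) * (2 * z2 + of_nat j) * (2 * z3 + of_nat j) * (2 * z4 + of_nat j)"
    have rg4: "rGamma (z1 + of_nat (j + 2) / 2) * rGamma (z2 + of_nat (j + 2) / 2) * rGamma (z3 + of_nat (j + 2) / 2) * rGamma (z4 + of_nat (j + 2) / 2)
      = rGamma (?z z1) * rGamma (?z z2) * rGamma (?z z3) * rGamma (?z z4) * (16 / W)"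
      unfolding rg[OF elim(1)] rg[OF elim(2)] rg[OF elim(3)] rg[OF elim(4)] W_def by simp
    have "u (j + 2) = u j * (((a + of_nat j) * (a + 1 + of_nat j)) * ((b + of_nat j) * (b + 1 + of_nat j)) * ((?e + of_nat j) * (?e + 1 + of_nat j))
       * (((?s - 1 + of_nat j) * (?s + of_nat j)) / D) * (16 / W))"
    proof -
      have "(A * X1) * (B * X2) * (X3 * G) * H / (P * D / X4) * (R * X5) = A * B * G * H / P * R * (X1 * X2 * X3 * (X4 / D) * X5)"
        for A B G H P R X1 X2 X3 X4 X5 :: complex by (simp add: mult_ac)
      then show ?thesis unfolding ue unfolding Gc sp2' pa[of a] pa[of b] Ge2 rg4 .
    qed
    also have "\<dots> = u j * r j"
    proof -
      have "X1 * X2 * X3 * (X4 / (16 * Y)) * (16 / W) = (X1 * X2 * X3 * X4) / (W * Y)" for X1 X2 X3 X4 Y W :: complex by simp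
      then show ?thesis unfolding r_def times_divide_times_eq D_def W_def by (simp only: mult.assoc times_divide_eq_right)
    qed
    finally have "u (j + 2) = u j * r j" .
    then show ?case using unz by simp
  qed
  have "eventually (\<lambda>j. r j = u (j + 2) / u j) sequentially" using ev by eventually_elim simp
  then have "(\<lambda>j. u (j + 2) / u j) \<longlonglongrightarrow> 1" using Lim_transform_eventually[OF r] by simp
  moreover have "eventually (\<lambda>j. u j \<noteq> 0) sequentially" using ev by eventually_elim simp
  ultimately show ?thesis by blast
qed

lemma watson_rearrange:
  fixes A B D E X G H Y r1 r2 r3 r4 :: complex
  shows "A * B / (D * E) * (X * G * H * Y * r1 * r2 * r3 * r4) = X * Y * (A * B * G * H / (D * E) * (r1 * r2 * r3 * r4))"
  by (simp only: divide_inverse mult_ac)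

text \<open>With d = f the lower parameter s + 2j is twice f + j, and shifting a, b and c by j
  preserves 2c = a + b + 1, so Watson's theorem applies with e = f + j. It contributes Gamma (c +
  j), which together with the 1/(c)_j of \<open>cbar_hyp3F2\<close> is the constant Gamma c.\<close>

lemma hyp2F1_jacobi_watson_symmetric:
  fixes a b c x :: complex and f :: real
  assumes c: "c \<notin> \<int>\<^sub>\<le>\<^sub>0" and pos: "Re (c - a - b) > 0" and x: "norm x \<le> 1" and f: "f > 0"
    and cab: "c = (a + b + 1) / 2" and f2: "2 * f + 1 > Re (a + b)"
  defines "t \<equiv> \<lambda>j. jacobiK j x (of_real f) (of_real f) *
                    (pochhammer a j * pochhammer b j * Gamma (of_real f + 1/2 + of_nat j) *
                       Gamma ((a + b + 1) / 2 + of_nat j)) /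
                    (pochhammer ((a + b + 1) / 2) j * pochhammer (2 * of_real f + of_nat j - 1) j *
                       Gamma ((a + 1 + of_nat j) / 2) * Gamma ((b + 1 + of_nat j) / 2) *
                       Gamma ((2 * of_real f + 1 - a + of_nat j) / 2) *
                       Gamma ((2 * of_real f + 1 - b + of_nat j) / 2))"
  shows "(x \<in> complex_of_real ` {0<..1} \<longrightarrow> summable t) \<and> (summable t \<longrightarrow>
    hyp2F1 a b ((a + b + 1) / 2) x = Gamma (1/2) * Gamma (of_real f + (1 - a - b) / 2) * (\<Sum>j. t j))"
proof -
  interpret jacobi_params f f by unfold_locales (use f in auto)
  have s2: "of_real s = 2 * complex_of_real f" by (simp add: s_def)
  let ?F = "complex_of_real f"
  define u where "u = watson_coeff a b c (of_real s) ((a + 1) / 2) ((b + 1) / 2) ((2 * ?F + 1 - a) / 2) ((2 * ?F + 1 - b) / 2)"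
  define k where "k = Gamma (1/2) * Gamma (?F + (1 - a - b) / 2)"
  have Rek: "Re (?F + (1 - a - b) / 2) > 0" using f2 by (simp add: field_simps)
  have knz: "k \<noteq> 0"
    unfolding k_def using Re_pos_notin_nonpos_Ints[OF Rek] by (simp add: Gamma_eq_zero_iff Gamma_one_half_complex)
  have half: "z / 2 + of_nat j / 2 = (z + of_nat j) / 2" for z :: complex and j by (simp add: field_simps)
  have e: "(of_real s + 1) / 2 = ?F + 1 / 2" unfolding s2 by (simp add: field_simps)
  have cb: "cbar (hyp3F2_term a b 1 c 1) j = k * u j" for j
  proof -
    have c': "c + of_nat j = (a + of_nat j + (b + of_nat j) + 1) / 2" by (simp add: cab field_simps)
    have s': "of_real s + 2 * of_nat j = 2 * (?F + of_nat j)" by (simp add: s2)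
    have "(\<Sum>m. hyp3F2_term (a + of_nat j) (b + of_nat j) (?F + of_nat j) (c + of_nat j) (of_real s + 2 * of_nat j) m) =
      Gamma (1 / 2) * Gamma (?F + of_nat j + 1 / 2) * Gamma (c + of_nat j) * Gamma (?F + of_nat j + (1 - (a + of_nat j) - (b + of_nat j)) / 2)
      * rGamma ((a + of_nat j + 1) / 2) * rGamma ((b + of_nat j + 1) / 2) * rGamma (?F + of_nat j + (1 - (a + of_nat j)) / 2) * rGamma (?F + of_nat j + (1 - (b + of_nat j)) / 2)"
      unfolding c' s'
    proof (rule watson_sum)
      show "(a + of_nat j + (b + of_nat j) + 1) / 2 \<notin> \<int>\<^sub>\<le>\<^sub>0" unfolding c'[symmetric] by (rule add_of_nat_notin_nonpos_Ints(1)[OF c])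
      show "2 * (?F + of_nat j) \<notin> \<int>\<^sub>\<le>\<^sub>0" using f by (intro Re_pos_notin_nonpos_Ints) (simp add: add_pos_nonneg)
      show "Re (2 * (?F + of_nat j) - (a + of_nat j) - (b + of_nat j)) > - 1" using f2 by simp
    qed
    also have "?F + of_nat j + (1 - (a + of_nat j) - (b + of_nat j)) / 2 = ?F + (1 - a - b) / 2" by (simp add: field_simps)
    also have "?F + of_nat j + (1 - (a + of_nat j)) / 2 = (2 * ?F + 1 - a + of_nat j) / 2" by (simp add: field_simps)
    also have "?F + of_nat j + (1 - (b + of_nat j)) / 2 = (2 * ?F + 1 - b + of_nat j) / 2" by (simp add: field_simps)
    also have "?F + of_nat j + 1 / 2 = ?F + 1 / 2 + of_nat j" by simp
    also have "a + of_nat j + 1 = a + 1 + of_nat j" by simp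
    also have "b + of_nat j + 1 = b + 1 + of_nat j" by simp
    finally have W: "(\<Sum>m. hyp3F2_term (a + of_nat j) (b + of_nat j) (?F + of_nat j) (c + of_nat j) (of_real s + 2 * of_nat j) m) =
      Gamma (1 / 2) * Gamma (?F + 1 / 2 + of_nat j) * Gamma (c + of_nat j) * Gamma (?F + (1 - a - b) / 2)
      * rGamma ((a + 1 + of_nat j) / 2) * rGamma ((b + 1 + of_nat j) / 2) * rGamma ((2 * ?F + 1 - a + of_nat j) / 2) * rGamma ((2 * ?F + 1 - b + of_nat j) / 2)" .
    show ?thesis
      unfolding cbar_hyp3F2[OF c pos] W k_def u_def watson_coeff_def half e by (rule watson_rearrange)
  qed
  have alt: "eventually (\<lambda>j. u j \<noteq> 0) sequentially \<and> (\<lambda>j. u (j + 2) / u j) \<longlonglongrightarrow> 1" if "a \<notin> \<int>\<^sub>\<le>\<^sub>0" "b \<notin> \<int>\<^sub>\<le>\<^sub>0"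
    unfolding u_def by (rule watson_coeff_alt[OF c that s])
  have tu: "t j = u j * jacobiK j x ?F ?F" for j
    unfolding t_def u_def watson_coeff_def half e cab[symmetric] rGamma_inverse_Gamma unfolding s2
    by (simp only: divide_inverse inverse_mult_distrib mult_ac)
  show ?thesis
    using expansion_hyp2F1[OF c pos x cb knz tu alt] unfolding k_def cab[symmetric] by simp
qed

text \<open>Watson's theorem with the roles permuted: now s = 2a makes a + j the middle parameter,
  and 2c = b + f + 1 belongs to the pair b + j, f + j.\<close>

lemma hyp2F1_jacobi_watson:
  fixes a b c x :: complex and d f :: real
  assumes c: "c \<notin> \<int>\<^sub>\<le>\<^sub>0" and pos: "Re (c - a - b) > 0" and x: "norm x \<le> 1" and d: "d > 0" and f: "f > 0"
    and ff: "of_real f = 2 * c - b - 1" and dd: "of_real d = 1 + b + 2 * a - 2 * c"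
  defines "t \<equiv> \<lambda>j. jacobiK j x (2 * c - b - 1) (1 + b + 2 * a - 2 * c) *
                    (pochhammer a j * pochhammer b j) /
                    (pochhammer c j * pochhammer (2 * a + of_nat j - 1) j) *
                    (Gamma (a + 1/2 + of_nat j) * Gamma (c + of_nat j)) /
                    (Gamma ((b + 1 + of_nat j) / 2) * Gamma (c + (of_nat j - b) / 2) *
                       Gamma (a + (of_nat j + 1 - b) / 2) *
                       Gamma (a + 1 - c + (of_nat j + b) / 2))"
  shows "(x \<in> complex_of_real ` {0<..1} \<longrightarrow> summable t) \<and> (summable t \<longrightarrow>
    hyp2F1 a b c x = Gamma (1/2) * Gamma (a + 1 - c) * (\<Sum>j. t j))"
proof -
  interpret jacobi_params f d by unfold_locales (use f d in auto)
  have s2: "of_real s = 2 * a" by (simp add: s_def ff dd)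
  have Rea: "Re a > 0" using s arg_cong[OF s2, of Re] by simp
  have Ref: "f = 2 * Re c - Re b - 1" using arg_cong[OF ff, of Re] by simp
  have Red: "d = 1 + Re b + 2 * Re a - 2 * Re c" using arg_cong[OF dd, of Re] by simp
  define u where "u = watson_coeff a b c (of_real s) ((b + 1) / 2) (c - b / 2) (a + (1 - b) / 2) (a + 1 - c + b / 2)"
  define k where "k = Gamma (1/2) * Gamma (a + 1 - c)"
  \<comment> \<open>The number a + 1 - c equals d + (c - a - b), a sum of two quantities with
    positive real part.\<close>
  have Rek: "Re (a + 1 - c) > 0" using Red d pos by (simp add: field_simps)
  have knz: "k \<noteq> 0"
    unfolding k_def using Re_pos_notin_nonpos_Ints[OF Rek] by (simp add: Gamma_eq_zero_iff Gamma_one_half_complex)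
  have e: "(of_real s + 1) / 2 = a + 1 / 2" unfolding s2 by (simp add: field_simps)
  have z: "(b + 1) / 2 + of_nat j / 2 = (b + 1 + of_nat j) / 2" "c - b / 2 + of_nat j / 2 = c + (of_nat j - b) / 2"
    "a + (1 - b) / 2 + of_nat j / 2 = a + (of_nat j + 1 - b) / 2" "a + 1 - c + b / 2 + of_nat j / 2 = a + 1 - c + (of_nat j + b) / 2" for j
    by (simp_all add: field_simps)
  have cb: "cbar (hyp3F2_term a b 1 c 1) j = k * u j" for j
  proof -
    have c': "c + of_nat j = (b + of_nat j + (of_real f + of_nat j) + 1) / 2" by (simp add: ff field_simps)
    have s': "of_real s + 2 * of_nat j = 2 * (a + of_nat j)" by (simp add: s2)
    have perm: "hyp3F2_term (a + of_nat j) (b + of_nat j) (of_real f + of_nat j) C S m = hyp3F2_term (b + of_nat j) (of_real f + of_nat j) (a + of_nat j) C S m" for C S m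
      by (simp add: hyp3F2_term_def mult_ac)
    have "(\<Sum>m. hyp3F2_term (a + of_nat j) (b + of_nat j) (of_real f + of_nat j) (c + of_nat j) (of_real s + 2 * of_nat j) m) =
      Gamma (1 / 2) * Gamma (a + of_nat j + 1 / 2) * Gamma (c + of_nat j) * Gamma (a + of_nat j + (1 - (b + of_nat j) - (of_real f + of_nat j)) / 2)
      * rGamma ((b + of_nat j + 1) / 2) * rGamma ((of_real f + of_nat j + 1) / 2) * rGamma (a + of_nat j + (1 - (b + of_nat j)) / 2) * rGamma (a + of_nat j + (1 - (of_real f + of_nat j)) / 2)"
      unfolding c' s' perm
    proof (rule watson_sum)
      show "(b + of_nat j + (of_real f + of_nat j) + 1) / 2 \<notin> \<int>\<^sub>\<le>\<^sub>0" unfolding c'[symmetric] by (rule add_of_nat_notin_nonpos_Ints(1)[OF c])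
      show "2 * (a + of_nat j) \<notin> \<int>\<^sub>\<le>\<^sub>0" using Rea by (intro Re_pos_notin_nonpos_Ints) (simp add: add_pos_nonneg)
      show "Re (2 * (a + of_nat j) - (b + of_nat j) - (of_real f + of_nat j)) > - 1"
        using Rek Ref by simp
    qed
    also have "a + of_nat j + (1 - (b + of_nat j) - (of_real f + of_nat j)) / 2 = a + 1 - c" by (simp add: ff field_simps)
    also have "(of_real f + of_nat j + 1) / 2 = c + (of_nat j - b) / 2" by (simp add: ff field_simps)
    also have "a + of_nat j + (1 - (b + of_nat j)) / 2 = a + (of_nat j + 1 - b) / 2" by (simp add: field_simps)
    also have "a + of_nat j + (1 - (of_real f + of_nat j)) / 2 = a + 1 - c + (of_nat j + b) / 2" by (simp add: ff field_simps)
    also have "a + of_nat j + 1 / 2 = a + 1 / 2 + of_nat j" by simp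
    also have "b + of_nat j + 1 = b + 1 + of_nat j" by simp
    finally have W: "(\<Sum>m. hyp3F2_term (a + of_nat j) (b + of_nat j) (of_real f + of_nat j) (c + of_nat j) (of_real s + 2 * of_nat j) m) =
      Gamma (1 / 2) * Gamma (a + 1 / 2 + of_nat j) * Gamma (c + of_nat j) * Gamma (a + 1 - c)
      * rGamma ((b + 1 + of_nat j) / 2) * rGamma (c + (of_nat j - b) / 2) * rGamma (a + (of_nat j + 1 - b) / 2) * rGamma (a + 1 - c + (of_nat j + b) / 2)" .
    show ?thesis
      unfolding cbar_hyp3F2[OF c pos] W k_def u_def watson_coeff_def z e by (rule watson_rearrange)
  qed
  have alt: "eventually (\<lambda>j. u j \<noteq> 0) sequentially \<and> (\<lambda>j. u (j + 2) / u j) \<longlonglongrightarrow> 1" if "a \<notin> \<int>\<^sub>\<le>\<^sub>0" "b \<notin> \<int>\<^sub>\<le>\<^sub>0"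
    unfolding u_def by (rule watson_coeff_alt[OF c that s])
  have tu: "t j = u j * jacobiK j x (of_real f) (of_real d)" for j
    unfolding t_def u_def watson_coeff_def z e rGamma_inverse_Gamma unfolding s2 ff dd
    by (simp only: divide_inverse inverse_mult_distrib mult_ac)
  show ?thesis
    using expansion_hyp2F1[OF c pos x cb knz tu alt] unfolding k_def by simp
qed

theorem lemma2:
  shows
  "(\<forall>(x::complex) (a::complex) (b::complex) (c::complex) (d::real) (f::real).
      c \<notin> \<int>\<^sub>\<le>\<^sub>0 \<and> Re (c - a - b) > 0 \<and> norm x \<le> 1 \<and> d > 0 \<and> f > 0 \<longrightarrow>

      (complex_of_real f = c \<and> c + of_real d \<noteq> 1 \<and>
       c + of_real d - a \<notin> \<int>\<^sub>\<le>\<^sub>0 \<and> c + of_real d - b \<notin> \<int>\<^sub>\<le>\<^sub>0 \<longrightarrow>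
         (let t = (\<lambda>j. jacobiK j x c (of_real d) *
                    (pochhammer a j * pochhammer b j * pochhammer (c + of_real d - 1) j *
                       (c + of_real d + 2 * of_nat j - 1)) /
                    (pochhammer c j * pochhammer (of_real d + c - a) j *
                       pochhammer (of_real d + c - b) j))
          in (x \<in> complex_of_real ` {0<..1} \<longrightarrow> summable t) \<and>
             (summable t \<longrightarrow>
                hyp2F1 a b c x =
                  Gamma (c + of_real d - 1) * Gamma (c + of_real d - a - b) /
                  (Gamma (c + of_real d - a) * Gamma (c + of_real d - b)) * (\<Sum>j. t j)))) \<and>

      (d = f \<and> c = (a + b + 1) / 2 \<and> 2 * f + 1 > Re (a + b) \<longrightarrow>
         (let t = (\<lambda>j. jacobiK j x (of_real f) (of_real f) *
                    (pochhammer a j * pochhammer b j * Gamma (of_real f + 1/2 + of_nat j) *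
                       Gamma ((a + b + 1) / 2 + of_nat j)) /
                    (pochhammer ((a + b + 1) / 2) j * pochhammer (2 * of_real f + of_nat j - 1) j *
                       Gamma ((a + 1 + of_nat j) / 2) * Gamma ((b + 1 + of_nat j) / 2) *
                       Gamma ((2 * of_real f + 1 - a + of_nat j) / 2) *
                       Gamma ((2 * of_real f + 1 - b + of_nat j) / 2)))
          in (x \<in> complex_of_real ` {0<..1} \<longrightarrow> summable t) \<and>
             (summable t \<longrightarrow>
                hyp2F1 a b ((a + b + 1) / 2) x =
                  Gamma (1/2) * Gamma (of_real f + (1 - a - b) / 2) * (\<Sum>j. t j)))) \<and>

      (complex_of_real f = 2 * c - b - 1 \<and> complex_of_real d = 1 + b + 2 * a - 2 * c \<longrightarrow>
         complex_of_real (f + d) = 2 * a \<and> b + complex_of_real f + 1 = 2 * c \<and>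
         (let t = (\<lambda>j. jacobiK j x (2 * c - b - 1) (1 + b + 2 * a - 2 * c) *
                    (pochhammer a j * pochhammer b j) /
                    (pochhammer c j * pochhammer (2 * a + of_nat j - 1) j) *
                    (Gamma (a + 1/2 + of_nat j) * Gamma (c + of_nat j)) /
                    (Gamma ((b + 1 + of_nat j) / 2) * Gamma (c + (of_nat j - b) / 2) *
                       Gamma (a + (of_nat j + 1 - b) / 2) *
                       Gamma (a + 1 - c + (of_nat j + b) / 2)))
          in (x \<in> complex_of_real ` {0<..1} \<longrightarrow> summable t) \<and>
             (summable t \<longrightarrow>
                hyp2F1 a b c x = Gamma (1/2) * Gamma (a + 1 - c) * (\<Sum>j. t j)))))
   \<and>
   (\<forall>(n::nat) (x::complex) (b::complex) (c::complex) (d::complex) (f::complex).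
      c \<notin> \<int>\<^sub>\<le>\<^sub>0 \<and> d = b - c + 1 - of_nat n \<and>
      (\<forall>j\<le>n. pochhammer (d + f + of_nat j - 1) (n + 1) \<noteq> 0) \<longrightarrow>
        pochhammer c n * hyp2F1 (- of_nat n) b c x =
          pochhammer c n *
          (\<Sum>j=0..n. (- 1) ^ j * of_nat (n choose j) * (pochhammer b j * x ^ j) / pochhammer c j) \<and>
        pochhammer c n *
          (\<Sum>j=0..n. (- 1) ^ j * of_nat (n choose j) * (pochhammer b j * x ^ j) / pochhammer c j) =
          (- 1) ^ n *
          (\<Sum>j=0..n. fact n / fact (n - j) * jacobiK j x f d *
             (pochhammer b j * pochhammer (c - b) (n - j) * pochhammer (c - f) (n - j) *
                (d + f + 2 * of_nat j - 1)) /
             pochhammer (d + f + of_nat j - 1) (n + 1)))"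
proof (intro conjI allI impI)
  fix x a b c :: complex and d f :: real
  assume H: "c \<notin> \<int>\<^sub>\<le>\<^sub>0 \<and> Re (c - a - b) > 0 \<and> norm x \<le> 1 \<and> d > 0 \<and> f > 0"
  {
    assume A: "complex_of_real f = c \<and> c + of_real d \<noteq> 1 \<and>
       c + of_real d - a \<notin> \<int>\<^sub>\<le>\<^sub>0 \<and> c + of_real d - b \<notin> \<int>\<^sub>\<le>\<^sub>0"
    show "let t = (\<lambda>j. jacobiK j x c (of_real d) *
                    (pochhammer a j * pochhammer b j * pochhammer (c + of_real d - 1) j *
                       (c + of_real d + 2 * of_nat j - 1)) /
                    (pochhammer c j * pochhammer (of_real d + c - a) j *
                       pochhammer (of_real d + c - b) j))
          in (x \<in> complex_of_real ` {0<..1} \<longrightarrow> summable t) \<and>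
             (summable t \<longrightarrow>
                hyp2F1 a b c x =
                  Gamma (c + of_real d - 1) * Gamma (c + of_real d - a - b) /
                  (Gamma (c + of_real d - a) * Gamma (c + of_real d - b)) * (\<Sum>j. t j))"
      unfolding Let_def by (rule hyp2F1_jacobi_gauss[of c a b x d f]) (use H A in blast)+
  }
  {
    assume B: "d = f \<and> c = (a + b + 1) / 2 \<and> 2 * f + 1 > Re (a + b)"
    show "let t = (\<lambda>j. jacobiK j x (of_real f) (of_real f) *
                    (pochhammer a j * pochhammer b j * Gamma (of_real f + 1/2 + of_nat j) *
                       Gamma ((a + b + 1) / 2 + of_nat j)) /
                    (pochhammer ((a + b + 1) / 2) j * pochhammer (2 * of_real f + of_nat j - 1) j *
                       Gamma ((a + 1 + of_nat j) / 2) * Gamma ((b + 1 + of_nat j) / 2) *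
                       Gamma ((2 * of_real f + 1 - a + of_nat j) / 2) *
                       Gamma ((2 * of_real f + 1 - b + of_nat j) / 2)))
          in (x \<in> complex_of_real ` {0<..1} \<longrightarrow> summable t) \<and>
             (summable t \<longrightarrow>
                hyp2F1 a b ((a + b + 1) / 2) x =
                  Gamma (1/2) * Gamma (of_real f + (1 - a - b) / 2) * (\<Sum>j. t j))"
      unfolding Let_def by (rule hyp2F1_jacobi_watson_symmetric) (use H B in blast)+
  }
  assume C: "complex_of_real f = 2 * c - b - 1 \<and> complex_of_real d = 1 + b + 2 * a - 2 * c"
  then show "complex_of_real (f + d) = 2 * a" "b + complex_of_real f + 1 = 2 * c" by simp_all
  show "let t = (\<lambda>j. jacobiK j x (2 * c - b - 1) (1 + b + 2 * a - 2 * c) *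
                    (pochhammer a j * pochhammer b j) /
                    (pochhammer c j * pochhammer (2 * a + of_nat j - 1) j) *
                    (Gamma (a + 1/2 + of_nat j) * Gamma (c + of_nat j)) /
                    (Gamma ((b + 1 + of_nat j) / 2) * Gamma (c + (of_nat j - b) / 2) *
                       Gamma (a + (of_nat j + 1 - b) / 2) *
                       Gamma (a + 1 - c + (of_nat j + b) / 2)))
          in (x \<in> complex_of_real ` {0<..1} \<longrightarrow> summable t) \<and>
             (summable t \<longrightarrow>
                hyp2F1 a b c x = Gamma (1/2) * Gamma (a + 1 - c) * (\<Sum>j. t j))"
    unfolding Let_def by (rule hyp2F1_jacobi_watson[of c a b x d f]) (use H C in blast)+
next
  fix n :: nat and x b c d f :: complex
  assume H: "c \<notin> \<int>\<^sub>\<le>\<^sub>0 \<and> d = b - c + 1 - of_nat n \<and>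
      (\<forall>j\<le>n. pochhammer (d + f + of_nat j - 1) (n + 1) \<noteq> 0)"
  show "pochhammer c n * hyp2F1 (- of_nat n) b c x = pochhammer c n *
      (\<Sum>j=0..n. (- 1) ^ j * of_nat (n choose j) * (pochhammer b j * x ^ j) / pochhammer c j)"
    unfolding hyp2F1_minus_of_nat atLeast0AtMost ..
  show "pochhammer c n *
          (\<Sum>j=0..n. (- 1) ^ j * of_nat (n choose j) * (pochhammer b j * x ^ j) / pochhammer c j) =
          (- 1) ^ n *
          (\<Sum>j=0..n. fact n / fact (n - j) * jacobiK j x f d *
             (pochhammer b j * pochhammer (c - b) (n - j) * pochhammer (c - f) (n - j) *
                (d + f + 2 * of_nat j - 1)) /
             pochhammer (d + f + of_nat j - 1) (n + 1))"
    unfolding atLeast0AtMost by (rule terminating_expansion) (use H in blast)+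
qed

end
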